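(* Let $\alpha\in\mathbb{R}$ with $\alpha\ge1$, let $\ell\in\{0,1,\ldots,\lfloor\alpha-\tfrac12\rfloor\}$, and let $\varphi$ be the pseudo-spline of order $(\alpha,\ell)$. For $n\in\mathbb{Z}$ define the linear operator $\mathscr{P}_n$ on $L^2(\mathbb{R})$ by $$\mathscr{P}_n(f):=\sum_{k\in\mathbb{Z}}\langle f,D^nT_k\varphi\rangle\,D^nT_k\varphi.$$ Then $\mathscr{P}_n$ provides approximation order $\min\{2\alpha,\,2(\ell+1)\}$.
   Context: The Fourier transform is $\widehat{f}(\gamma)=\int_{\mathbb{R}}f(t)e^{-2\pi i t\gamma}\,dt$ (extended to $L^2(\mathbb{R})$). $D$ is the unitary dilation operator $(Df)(x):=\sqrt2\,f(2x)$ and $T_k$ the translation operator $(T_kf)(x):=f(x-k)$. The (fractional) pseudo-spline $\varphi$ of order $(\alpha,\ell)$ is the function in $L^2(\mathbb{R})$ whose Fourier transform is $\widehat{\varphi}(\gamma)=\prod_{m=1}^\infty H_0(2^{-m}\gamma)$ (so $\widehat{\varphi}(0)=1$), where $$H_0(\gamma):=H_0^{(\alpha,\ell)}(\gamma):=(\cos^2\pi\gamma)^\alpha\sum_{k=0}^{\ell}\binom{\alpha+\ell}{k}(\sin^2\pi\gamma)^k(\cos^2\pi\gamma)^{\ell-k},$$ with $\binom{w}{k}:=\frac{\Gamma(w+1)}{\Gamma(k+1)\Gamma(w-k+1)}$ for real $w$ and $k\in\mathbb{N}_0$, and $0^0:=1$ for integer powers. The operator $\mathscr{P}_n$ maps into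 $V_n:=\overline{\operatorname{span}}\{D^nT_k\varphi:k\in\mathbb{Z}\}$ (closure in $L^2(\mathbb{R})$). For $\rho>0$, the operator $\mathscr{P}_n$ is said to provide approximation order $\rho$ if $\|f-\mathscr{P}_nf\|_{L^2}\in\mathcal{O}(2^{-n\rho})$ as $n\to\infty$ for all $f$ in the Sobolev space $H^\rho(\mathbb{R})$. *)

theory Defs
  imports "HOL-Analysis.Analysis" "HOL-Library.Landau_Symbols"
begin

section \<open>Square-integrable functions on the real line\<close>

text \<open>Elements of $L^2$ are represented by Borel functions; every Lebesgue a.e.-class has
  such a representative. All notions below respect a.e. equality.\<close>

definition L2 :: "(real \<Rightarrow> complex) set" where
  "L2 = {f \<in> borel_measurable lborel. integrable lborel (\<lambda>x. (cmod (f x))\<^sup>2)}"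

text \<open>Only meaningful on \<^const>\<open>L2\<close>: a Bochner integral that does not exist is 0.\<close>

definition L2_norm :: "(real \<Rightarrow> complex) \<Rightarrow> real" where
  "L2_norm f = sqrt (LINT x|lborel. (cmod (f x))\<^sup>2)"

definition L2_inner :: "(real \<Rightarrow> complex) \<Rightarrow> (real \<Rightarrow> complex) \<Rightarrow> complex" where
  "L2_inner f g = (LINT x|lborel. f x * cnj (g x))"

text \<open>Unconditional convergence in $L^2$: the filter is that of \<^const>\<open>has_sum\<close>. The sum \<open>g\<close>
  is determined up to a.e. equality.\<close>

definition L2_has_sum :: "('i \<Rightarrow> real \<Rightarrow> complex) \<Rightarrow> (real \<Rightarrow> complex) \<Rightarrow> bool" where
  "L2_has_sum h g \<longleftrightarrow> (\<forall>k. h k \<in> L2) \<and> g \<in> L2 \<and>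
     ((\<lambda>K. L2_norm (\<lambda>x. g x - (\<Sum>k\<in>K. h k x))) \<longlongrightarrow> 0) (finite_subsets_at_top UNIV)"


section \<open>Fourier transform and Sobolev spaces\<close>

definition fourier :: "(real \<Rightarrow> complex) \<Rightarrow> real \<Rightarrow> complex" where
  "fourier f \<gamma> = (LINT t|lborel. f t * exp (- 2 * of_real pi * \<i> * of_real t * of_real \<gamma>))"

text \<open>The extension to $L^2$: \<open>F\<close> is the $L^2$-limit of the Fourier transforms of the truncations
  of \<open>f\<close>, which lie in $L^1 \cap L^2$. It is a relation because \<open>F\<close> is only determined a.e.\<close>

definition L2_fourier :: "(real \<Rightarrow> complex) \<Rightarrow> (real \<Rightarrow> complex) \<Rightarrow> bool" where
  "L2_fourier f F \<longleftrightarrow> f \<in> L2 \<and> F \<in> L2 \<and>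
     ((\<lambda>R. L2_norm (\<lambda>\<gamma>. F \<gamma> - fourier (\<lambda>t. indicator {-R..R} t * f t) \<gamma>)) \<longlongrightarrow> 0) at_top"

definition sobolev :: "real \<Rightarrow> (real \<Rightarrow> complex) set" where
  "sobolev \<rho> = {f \<in> L2. \<exists>F. L2_fourier f F \<and>
     integrable lborel (\<lambda>\<gamma>. (1 + \<gamma>\<^sup>2) powr \<rho> * (cmod (F \<gamma>))\<^sup>2)}"


section \<open>Dilation and translation\<close>

definition dilation :: "(real \<Rightarrow> complex) \<Rightarrow> real \<Rightarrow> complex" where
  "dilation f = (\<lambda>x. of_real (sqrt 2) * f (2 * x))"

definition translation :: "int \<Rightarrow> (real \<Rightarrow> complex) \<Rightarrow> real \<Rightarrow> complex" where
  "translation k f = (\<lambda>x. f (x - of_int k))"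

definition dilation_pow :: "int \<Rightarrow> (real \<Rightarrow> complex) \<Rightarrow> real \<Rightarrow> complex" where
  "dilation_pow n = (if 0 \<le> n then dilation ^^ nat n else inv dilation ^^ nat (- n))"

lemma inv_dilation: "inv dilation = (\<lambda>f x. f (x / 2) / of_real (sqrt 2))"
  by (rule inv_equality) (auto simp: dilation_def)

lemma dilation_pow_eq:
  "dilation_pow n f = (\<lambda>x. of_real (sqrt 2 powi n) * f (2 powi n * x))"
proof -
  have pos: "(dilation ^^ m) f = (\<lambda>x. of_real (sqrt 2 ^ m) * f (2 ^ m * x))" for m
    by (induction m) (auto simp: dilation_def fun_eq_iff mult_ac)
  have neg: "(inv dilation ^^ m) f = (\<lambda>x. of_real (inverse (sqrt 2) ^ m) * f (inverse 2 ^ m * x))" for m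
    by (induction m) (auto simp: inv_dilation fun_eq_iff field_simps)
  show ?thesis
    unfolding dilation_pow_def power_int_def by (simp add: pos neg)
qed


section \<open>Fractional pseudo-splines\<close>

definition real_binomial :: "real \<Rightarrow> nat \<Rightarrow> real" where
  "real_binomial w k = Gamma (w + 1) / (Gamma (real k + 1) * Gamma (w - real k + 1))"

definition refinement_mask :: "real \<Rightarrow> nat \<Rightarrow> real \<Rightarrow> real" where
  "refinement_mask \<alpha> l \<gamma> = ((cos (pi * \<gamma>))\<^sup>2) powr \<alpha> *
     (\<Sum>k=0..l. real_binomial (\<alpha> + real l) k * ((sin (pi * \<gamma>))\<^sup>2) ^ k * ((cos (pi * \<gamma>))\<^sup>2) ^ (l - k))"

text \<open>The product in the literature starts at index 1, \<^const>\<open>prodinf\<close> at 0.\<close>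

definition pseudo_spline :: "real \<Rightarrow> nat \<Rightarrow> (real \<Rightarrow> complex) \<Rightarrow> bool" where
  "pseudo_spline \<alpha> l \<phi> \<longleftrightarrow> \<phi> \<in> L2 \<and>
     L2_fourier \<phi> (\<lambda>\<gamma>. of_real (\<Prod>m. refinement_mask \<alpha> l (\<gamma> / 2 ^ Suc m)))"


section \<open>The operators and their approximation order\<close>

definition projection_term ::
    "(real \<Rightarrow> complex) \<Rightarrow> int \<Rightarrow> (real \<Rightarrow> complex) \<Rightarrow> int \<Rightarrow> real \<Rightarrow> complex" where
  "projection_term \<phi> n f k = (\<lambda>x.
     L2_inner f (dilation_pow n (translation k \<phi>)) * dilation_pow n (translation k \<phi>) x)"

text \<open>A choice of representative of the $L^2$-sum.\<close>

definition quasi_projection ::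
    "(real \<Rightarrow> complex) \<Rightarrow> int \<Rightarrow> (real \<Rightarrow> complex) \<Rightarrow> real \<Rightarrow> complex" where
  "quasi_projection \<phi> n f = (SOME g. L2_has_sum (projection_term \<phi> n f) g)"

definition provides_approximation_order ::
    "(int \<Rightarrow> (real \<Rightarrow> complex) \<Rightarrow> real \<Rightarrow> complex) \<Rightarrow> real \<Rightarrow> bool" where
  "provides_approximation_order P \<rho> \<longleftrightarrow>
     (\<forall>n. \<forall>f\<in>L2. P n f \<in> L2) \<and>
     (\<forall>f\<in>sobolev \<rho>.
        (\<lambda>n. L2_norm (\<lambda>x. f x - P n f x)) \<in> O[at_top](\<lambda>n::int. 2 powr (- (of_int n * \<rho>))))"

end

theory Submission
  imports Defs
begin

text \<open>On the Fourier side the partial sums of the operator at level \<open>0\<close> multiply \<open>\<Phi>\<close>, the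
  transform of \<open>\<phi>\<close>, by Fourier partial sums. The condition on \<open>l\<close> makes the mask satisfy
  $H_0(\gamma)^2 + H_0(\gamma + 1/2)^2 \le 1$, so that $\sum_k \Phi(\gamma + k)^2 \le 1$ and the
  integer translates of \<open>\<phi>\<close> form a Bessel system. Split the transform of \<open>f\<close> into its part on
  $[-1/2, 1/2)$ and the rest. The rest is controlled by the Sobolev weight and the Bessel bound. On
  the low-frequency part the error at frequency \<open>u\<close> is the vector
  $(\delta_{0j} - \Phi(u) \Phi(u + j))_j$, whose norm is of order $|u|^\rho$ since
  $1 - \Phi(u)$ is of order $|u|^{2 l + 2}$ and $\sum_{j \ne 0} \Phi(u + j)^2$ of order $|u|^{4 \alpha}$. Level \<open>n\<close>
  follows by dilation. Plancherel's theorem is obtained from Parseval's identity by integrating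
  over all shifts of the integer lattice of frequencies.\<close>

section \<open>The refinement mask\<close>

text \<open>Everything rests on one transfer. A finite combination of translates has transform
  \<open>p * \<Phi>\<close> with \<open>p\<close> a trigonometric polynomial of period 1. Folding
  the frequency line onto one period pulls \<open>|p|^2\<close> out of the lattice sum and leaves
  the bracket, which is at most 1. Norms on the line are thus dominated by norms on
  \<open>[-1/2, 1/2)\<close>, and L2 convergence of an ordinary Fourier series there becomes
  convergence of the partial sums on the line. The error is bounded with the homogeneous weight
  \<open>|\<gamma>| powr \<rho>\<close>, not with the full Sobolev weight: a homogeneous bound turns
  into the exact factor \<open>2 powr (- n * \<rho>)\<close> under dilation. The integral defining
  \<open>fourier\<close> need not exist for a function in \<open>L2\<close>, and a Bochner integral
  that fails to exist is 0. Linearity and Plancherel are therefore proved first for functions of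
  bounded support and carried over by truncation; polarisation then supplies the inner
  products.\<close>

definition spline_poly :: "real \<Rightarrow> nat \<Rightarrow> real \<Rightarrow> real" where
  "spline_poly \<alpha> l x = x powr \<alpha> *
     (\<Sum>k=0..l. real_binomial (\<alpha> + real l) k * (1 - x) ^ k * x ^ (l - k))"

lemma real_binomial_0: "w > - 1 \<Longrightarrow> real_binomial w 0 = 1"
  using Gamma_real_pos[of "w + 1"] by (simp add: real_binomial_def less_imp_neq[symmetric])

text \<open>The binomial recurrence, from the functional equation of Gamma; the strict bound on
  \<open>w\<close> keeps the argument \<open>w - k\<close> positive, away from the poles.\<close>

lemma real_binomial_Suc:
  assumes "w > real k"
  shows "real (Suc k) * real_binomial w (Suc k) = (w - real k) * real_binomial w k"
proof -
  have 1: "Gamma (real k + 1 + 1) = (real k + 1) * Gamma (real k + 1)"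
    by (rule Gamma_plus1) auto
  have 2: "Gamma (w - real k + 1) = (w - real k) * Gamma (w - real k)"
    by (rule Gamma_plus1) (use assms in auto)
  have "Gamma (real k + 1) > 0" "Gamma (w - real k) > 0"
    using assms by (auto intro!: Gamma_real_pos)
  moreover have "real (Suc k) > 0" "w - real k > 0"
    using assms by auto
  ultimately have "real (Suc k) * (G / ((real k + 1) * Gamma (real k + 1) * Gamma (w - real k)))
      = (w - real k) * (G / (Gamma (real k + 1) * ((w - real k) * Gamma (w - real k))))" for G
    by (simp add: add.commute)
  moreover have "real (Suc k) + 1 = real k + 1 + 1" "w - real (Suc k) + 1 = w - real k"
    by auto
  ultimately show ?thesis
    unfolding real_binomial_def by (simp only: 1 2)
qed

lemma real_binomial_nonneg: "w + 1 > real k \<Longrightarrow> 0 \<le> real_binomial w k"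
  unfolding real_binomial_def
  by (intro divide_nonneg_nonneg mult_nonneg_nonneg less_imp_le[OF Gamma_real_pos]) auto

text \<open>In the variable \<open>cos^2\<close> the shift of the frequency by 1/2 becomes
  \<open>x -> 1 - x\<close>, so the behaviour of the mask at 0 and at 1/2 reduces to calculus on
  [0, 1].\<close>

lemma refinement_mask_eq: "refinement_mask \<alpha> l \<gamma> = spline_poly \<alpha> l ((cos (pi * \<gamma>))\<^sup>2)"
  by (simp add: refinement_mask_def spline_poly_def sin_squared_eq)

locale spline_order =
  fixes \<alpha> :: real and l :: nat
  assumes \<alpha>: "1 \<le> \<alpha>" and l: "real l \<le> \<alpha> - 1/2"
begin

abbreviation (input) B :: "nat \<Rightarrow> real" where "B \<equiv> real_binomial (\<alpha> + real l)"
abbreviation (input) h :: "real \<Rightarrow> real" where "h \<equiv> spline_poly \<alpha> l"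

lemma B_nonneg: "k \<le> Suc l \<Longrightarrow> 0 \<le> B k"
  using \<alpha> by (intro real_binomial_nonneg) auto

lemma B_Suc: "k \<le> l \<Longrightarrow> real (Suc k) * B (Suc k) = (\<alpha> + real l - real k) * B k"
  using \<alpha> by (intro real_binomial_Suc) auto

lemma spline_poly_nonneg: "0 \<le> x \<Longrightarrow> x \<le> 1 \<Longrightarrow> 0 \<le> h x"
  unfolding spline_poly_def
  by (intro mult_nonneg_nonneg sum_nonneg B_nonneg) auto

lemma spline_poly_1: "h 1 = 1"
proof -
  have "(\<Sum>k=0..l. B k * (1 - 1) ^ k * 1 ^ (l - k)) = (\<Sum>k=0..l. if k = 0 then B k else 0)"
    by (intro sum.cong) auto
  also have "\<dots> = 1"
    using \<alpha> by (simp add: real_binomial_0)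
  finally show ?thesis
    by (simp add: spline_poly_def)
qed

lemma spline_poly_0: "h 0 = 0"
  using \<alpha> by (simp add: spline_poly_def)

lemma continuous_spline_poly: "continuous_on {0..} h"
proof -
  have "continuous_on {0..} (\<lambda>x::real. x powr \<alpha>)"
    using \<alpha> by (intro continuous_on_powr') (auto intro!: continuous_intros)
  then show ?thesis
    unfolding spline_poly_def by (rule continuous_on_mult) (intro continuous_intros)
qed

text \<open>The derivative telescopes: the spline polynomial is a regularised incomplete beta function.\<close>

lemma spline_poly_deriv:
  assumes x: "0 < x"
  shows "(h has_real_derivative real (Suc l) * B (Suc l) * (1 - x) ^ l * x powr (\<alpha> - 1)) (at x)"
proof -
  \<comment> \<open>The product rule gives summand \<open>k\<close> two terms. By the binomial
    recurrence, differentiating the power of \<open>x\<close> gives \<open>A (Suc k)\<close>, and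
    differentiating \<open>(1 - x) ^ k\<close> gives \<open>- A k\<close>. The factor
    \<open>real k\<close> makes \<open>A 0\<close> vanish.\<close>
  define A where "A k = real k * B k * (1 - x) ^ (k - 1) * x powr (\<alpha> + real l - real k)" for k
  have tele: "(\<Sum>k=0..l. A (Suc k) - A k) = A (Suc l) - A 0"
    by (rule sum_Suc_diff) simp
  have "((\<lambda>x. \<Sum>k=0..l. B k * (1 - x) ^ k * x powr (\<alpha> + real l - real k)) has_real_derivative
      (\<Sum>k=0..l. A (Suc k) - A k)) (at x)"
  proof (rule DERIV_sum)
    fix k assume k: "k \<in> {0..l}"
    have "((\<lambda>x. B k * (1 - x) ^ k * x powr (\<alpha> + real l - real k)) has_real_derivative
      (B k * (1 - x) ^ k) * ((\<alpha> + real l - real k) * x powr (\<alpha> + real l - real k - 1))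
      + B k * (real k * (1 - x) ^ (k - 1) * (-1)) * x powr (\<alpha> + real l - real k)) (at x)"
    proof (rule derivative_eq_intros)
      show "((\<lambda>x. x powr (\<alpha> + real l - real k)) has_real_derivative
          (\<alpha> + real l - real k) * x powr (\<alpha> + real l - real k - 1)) (at x)"
        using x by (rule has_real_derivative_powr)
      show "((\<lambda>x. B k * (1 - x) ^ k) has_real_derivative B k * (real k * (1 - x) ^ (k - 1) * (-1))) (at x)"
        by (rule derivative_eq_intros refl | simp)+
    qed simp
    moreover have "A (Suc k) = (B k * (1 - x) ^ k) * ((\<alpha> + real l - real k) * x powr (\<alpha> + real l - real k - 1))"
    proof -
      have "\<alpha> + real l - real (Suc k) = \<alpha> + real l - real k - 1"
        by simp
      moreover have "real (Suc k) * B (Suc k) = (\<alpha> + real l - real k) * B k"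
        using B_Suc[of k] k by simp
      ultimately show ?thesis
        unfolding A_def by (simp only:) simp
    qed
    moreover have "A k = real k * B k * (1 - x) ^ (k - 1) * x powr (\<alpha> + real l - real k)"
      by (simp add: A_def)
    ultimately show "((\<lambda>x. B k * (1 - x) ^ k * x powr (\<alpha> + real l - real k)) has_real_derivative
        A (Suc k) - A k) (at x)"
      by (simp only:) (simp add: mult_ac)
  qed
  then have "((\<lambda>x. \<Sum>k=0..l. B k * (1 - x) ^ k * x powr (\<alpha> + real l - real k)) has_real_derivative
      A (Suc l)) (at x)"
    unfolding tele by (simp add: A_def)
  moreover have "A (Suc l) = real (Suc l) * B (Suc l) * (1 - x) ^ l * x powr (\<alpha> - 1)"
    by (simp add: A_def)
  ultimately have "((\<lambda>x. \<Sum>k=0..l. B k * (1 - x) ^ k * x powr (\<alpha> + real l - real k)) has_real_derivative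
      real (Suc l) * B (Suc l) * (1 - x) ^ l * x powr (\<alpha> - 1)) (at x)"
    by simp
  then show ?thesis
  \<comment> \<open>Within distance \<open>x\<close> of \<open>x\<close> the argument stays
    positive, where real and natural exponents agree.\<close>
  proof (rule has_field_derivative_transform_within[where d = x])
    fix y assume "dist y x < x"
    then have y: "0 < y" by (auto simp: dist_real_def)
    have "y powr (\<alpha> + real l - real k) = y powr \<alpha> * y ^ (l - k)" if "k \<le> l" for k
    proof -
      have "\<alpha> + real l - real k = \<alpha> + real (l - k)"
        using that by (simp add: of_nat_diff)
      then show ?thesis
        using y by (simp only: powr_add powr_realpow)
    qed
    then show "(\<Sum>k=0..l. B k * (1 - y) ^ k * y powr (\<alpha> + real l - real k)) = h y"
      by (simp add: spline_poly_def sum_distrib_left mult_ac cong: sum.cong_simp)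
  qed (use x in auto)
qed

lemma spline_poly_mono:
  assumes "0 \<le> x" "x \<le> y" "y \<le> 1"
  shows "h x \<le> h y"
proof (rule DERIV_nonneg_imp_increasing_open[OF assms(2)])
  show "continuous_on {x..y} h"
    using assms by (intro continuous_on_subset[OF continuous_spline_poly]) auto
  fix z assume "x < z" "z < y"
  then show "\<exists>d. (h has_real_derivative d) (at z) \<and> 0 \<le> d"
    using assms B_nonneg[of "Suc l"]
    by (intro exI[of _ "real (Suc l) * B (Suc l) * (1 - z) ^ l * z powr (\<alpha> - 1)"] conjI spline_poly_deriv) auto
qed

lemma spline_poly_le_1: "0 \<le> x \<Longrightarrow> x \<le> 1 \<Longrightarrow> h x \<le> 1"
  using spline_poly_mono[of x 1] by (simp add: spline_poly_1)

text \<open>Since \<open>x powr (\<alpha> - 1) \<le> 1\<close>, the derivative of \<open>h\<close>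
  is at most that of \<open>- B (Suc l) * (1 - x) ^ Suc l\<close>, so
  \<open>h x + B (Suc l) * (1 - x) ^ Suc l\<close> decreases to its value 1 at \<open>x = 1\<close>.
  With \<open>1 - x = sin^2\<close> this is the flatness of order \<open>2 * l + 2\<close> of the
  mask at 0.\<close>

lemma one_minus_spline_poly_le:
  assumes x: "0 \<le> x" "x \<le> 1"
  shows "1 - h x \<le> B (Suc l) * (1 - x) ^ Suc l"
proof -
  define f where "f x = h x + B (Suc l) * (1 - x) ^ Suc l" for x
  have "f 1 \<le> f x"
  proof (rule DERIV_nonpos_imp_decreasing_open[OF x(2)])
    show "continuous_on {x..1} f"
      unfolding f_def using x
      by (intro continuous_intros continuous_on_subset[OF continuous_spline_poly]) auto
    fix z assume z: "x < z" "z < 1"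
    have "(f has_real_derivative real (Suc l) * B (Suc l) * (1 - z) ^ l * z powr (\<alpha> - 1)
        - B (Suc l) * real (Suc l) * (1 - z) ^ l) (at z)"
    proof -
      have "((\<lambda>x. (1 - x) ^ Suc l) has_real_derivative real (Suc l) * (1 - z) ^ l * (- 1)) (at z)"
        by (rule derivative_eq_intros refl | simp)+
      from DERIV_add[OF spline_poly_deriv DERIV_cmult[OF this, of "B (Suc l)"]] show ?thesis
        using z x by (simp add: f_def[abs_def] mult_ac)
    qed
    moreover have "real (Suc l) * B (Suc l) * (1 - z) ^ l * z powr (\<alpha> - 1)
        \<le> real (Suc l) * B (Suc l) * (1 - z) ^ l * 1"
      using z x \<alpha> B_nonneg[of "Suc l"]
      by (intro mult_left_mono mult_nonneg_nonneg powr_le1) auto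
    ultimately show "\<exists>d. (f has_real_derivative d) (at z) \<and> d \<le> 0"
      by (intro exI conjI) (auto simp: mult_ac)
  qed
  then show ?thesis
    by (simp add: f_def spline_poly_1)
qed

text \<open>The cross term in the derivative of \<open>h(x)\<^sup>2 + h(1 - x)\<^sup>2\<close>, compared term by term;
  the exponents require exactly \<open>2 * l \<le> 2 * \<alpha> - 1\<close>.\<close>

lemma spline_poly_cross:
  assumes x: "0 < x" "x \<le> 1/2"
  shows "h x * ((1 - x) ^ l * x powr (\<alpha> - 1)) \<le> h (1 - x) * (x ^ l * (1 - x) powr (\<alpha> - 1))"
proof -
  have eq: "h x * ((1 - x) ^ l * x powr (\<alpha> - 1)) = (\<Sum>k=0..l. B k * ((1 - x) powr (real k + real l)
        * x powr (2 * \<alpha> - 1 + real l - real k)))" if "0 < x" "x < 1" for x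
  proof -
    have "(1 - x) powr (real k + real l) = (1 - x) ^ k * (1 - x) ^ l"
      "x powr (2 * \<alpha> - 1 + real l - real k) = x powr \<alpha> * x powr (\<alpha> - 1) * x ^ (l - k)" if "k \<le> l" for k
    proof -
      show "(1 - x) powr (real k + real l) = (1 - x) ^ k * (1 - x) ^ l"
        using \<open>x < 1\<close> by (simp add: powr_add powr_realpow)
      have "2 * \<alpha> - 1 + real l - real k = \<alpha> + (\<alpha> - 1) + real (l - k)"
        using that by (simp add: of_nat_diff)
      then show "x powr (2 * \<alpha> - 1 + real l - real k) = x powr \<alpha> * x powr (\<alpha> - 1) * x ^ (l - k)"
        using \<open>0 < x\<close> by (simp only: powr_add powr_realpow)
    qed
    then show ?thesis
      by (simp add: spline_poly_def sum_distrib_left sum_distrib_right mult_ac cong: sum.cong_simp)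
  qed
  have "(1 - x) powr (real k + real l) * x powr (2 * \<alpha> - 1 + real l - real k)
      \<le> x powr (real k + real l) * (1 - x) powr (2 * \<alpha> - 1 + real l - real k)" if "k \<le> l" for k
  proof -
    \<comment> \<open>Both sides share the factor \<open>(x * (1 - x)) powr (k + l)\<close>. What is
      left has exponent \<open>2 * \<alpha> - 1 - 2 * k\<close>, nonnegative because
      \<open>k \<le> l\<close>, on the bases \<open>x \<le> 1 - x\<close>.\<close>
    have e: "2 * \<alpha> - 1 + real l - real k = (real k + real l) + (2 * \<alpha> - 1 - 2 * real k)"
      by simp
    have "x powr (2 * \<alpha> - 1 - 2 * real k) \<le> (1 - x) powr (2 * \<alpha> - 1 - 2 * real k)"
      using x l that by (intro powr_mono2) auto
    then show ?thesis
      unfolding e powr_add by (simp add: mult_left_mono mult.left_commute)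
  qed
  then show ?thesis
    using x eq[of x] eq[of "1 - x"]
    by (auto intro!: sum_mono mult_left_mono B_nonneg)
qed

text \<open>The left side is 1 at \<open>x = 0\<close> and symmetric under
  \<open>x -> 1 - x\<close>, so it suffices that it decreases on [0, 1/2]. Its derivative there is a
  nonnegative constant times the difference of the two sides of
  \<open>spline_poly_cross\<close>.\<close>

lemma spline_poly_squares_le_1:
  assumes x: "0 \<le> x" "x \<le> 1"
  shows "(h x)\<^sup>2 + (h (1 - x))\<^sup>2 \<le> 1"
proof -
  define G where "G x = (h x)\<^sup>2 + (h (1 - x))\<^sup>2" for x
  have G: "G x \<le> 1" if x: "0 \<le> x" "x \<le> 1/2" for x
  proof -
    have "G x \<le> G 0"
    proof (rule DERIV_nonpos_imp_decreasing_open[OF x(1)])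
      have "continuous_on {0..x} (\<lambda>z. h (1 - z))"
        using x by (intro continuous_on_compose2[OF continuous_spline_poly]) (auto intro!: continuous_intros)
      moreover have "continuous_on {0..x} h"
        by (intro continuous_on_subset[OF continuous_spline_poly]) auto
      ultimately show "continuous_on {0..x} G"
        unfolding G_def by (intro continuous_intros)
      fix z assume z: "0 < z" "z < x"
      define c where "c = real (Suc l) * B (Suc l)"
      have c: "c \<ge> 0" using B_nonneg[of "Suc l"] by (auto simp: c_def)
      have d1: "(h has_real_derivative c * (1 - z) ^ l * z powr (\<alpha> - 1)) (at z)"
        unfolding c_def by (rule spline_poly_deriv) (use z in auto)
      have "(h has_real_derivative c * (1 - (1 - z)) ^ l * (1 - z) powr (\<alpha> - 1)) (at (1 - z))"
        unfolding c_def by (rule spline_poly_deriv) (use z x in auto)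
      then have "((\<lambda>z. h (1 - z)) has_real_derivative c * (1 - (1 - z)) ^ l * (1 - z) powr (\<alpha> - 1) * (-1)) (at z)"
        by (rule DERIV_chain2) (auto intro!: derivative_eq_intros)
      then have d2: "((\<lambda>z. h (1 - z)) has_real_derivative - (c * z ^ l * (1 - z) powr (\<alpha> - 1))) (at z)"
        by simp
      have "(G has_real_derivative 2 * h z * (c * (1 - z) ^ l * z powr (\<alpha> - 1))
          + 2 * h (1 - z) * (- (c * z ^ l * (1 - z) powr (\<alpha> - 1)))) (at z)"
        unfolding G_def
        by (rule derivative_eq_intros d1 d2 refl | simp)+
      moreover have "2 * h z * (c * (1 - z) ^ l * z powr (\<alpha> - 1))
          + 2 * h (1 - z) * (- (c * z ^ l * (1 - z) powr (\<alpha> - 1))) \<le> 0"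
        using mult_left_mono[OF spline_poly_cross[of z], of "2 * c"] z x c
        by (simp add: mult_ac)
      ultimately show "\<exists>d. (G has_real_derivative d) (at z) \<and> d \<le> 0"
        by blast
    qed
    then show ?thesis
      by (simp add: G_def spline_poly_0 spline_poly_1)
  qed
  show ?thesis
    using G[of x] G[of "1 - x"] x by (cases "x \<le> 1/2") (auto simp: G_def)
qed

text \<open>All factors besides \<open>x powr \<alpha>\<close> and the binomials are at most 1. At
  \<open>x = sin^2\<close> this is the zero of order \<open>2 * \<alpha>\<close> of the mask at
  1/2.\<close>

lemma spline_poly_le_powr:
  assumes x: "0 \<le> x" "x \<le> 1"
  shows "h x \<le> (\<Sum>k=0..l. B k) * x powr \<alpha>"
proof -
  have "B k * (1 - x) ^ k * x ^ (l - k) \<le> B k * 1 * 1" if "k \<le> l" for k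
    using that x B_nonneg[of k] by (intro mult_mono power_le_one mult_nonneg_nonneg) auto
  then have "(\<Sum>k=0..l. B k * (1 - x) ^ k * x ^ (l - k)) \<le> (\<Sum>k=0..l. B k)"
    by (intro sum_mono) auto
  then show ?thesis
    unfolding spline_poly_def by (subst mult.commute) (intro mult_right_mono, auto)
qed

end

section \<open>The infinite product and its bracket sums\<close>

text \<open>Lattice sums are written as integrals over \<open>count_space UNIV\<close>, so that they
  can be exchanged with Lebesgue integrals; this rule reduces such a sum to its finite
  parts.\<close>

lemma nn_integral_count_int_le:
  fixes f :: "int \<Rightarrow> ennreal"
  assumes "\<And>K. finite K \<Longrightarrow> sum f K \<le> c"
  shows "(\<integral>\<^sup>+k. f k \<partial>count_space UNIV) \<le> c"
proof -
  have "bij_betw int_decode UNIV UNIV"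
    by (rule bij_int_decode)
  then have "(\<integral>\<^sup>+k. f k \<partial>count_space UNIV) = (\<integral>\<^sup>+i. f (int_decode i) \<partial>count_space UNIV)"
    by (rule nn_integral_bij_count_space[symmetric])
  also have "\<dots> = (\<Sum>i. f (int_decode i))"
    by (rule nn_integral_count_space_nat)
  also have "\<dots> \<le> c"
  proof (rule suminf_le_const)
    fix n
    have "(\<Sum>i<n. f (int_decode i)) = sum f (int_decode ` {..<n})"
      by (subst sum.reindex) (auto intro: inj_on_subset[OF inj_int_decode])
    also have "\<dots> \<le> c"
      by (rule assms) auto
    finally show "(\<Sum>i<n. f (int_decode i)) \<le> c" .
  qed auto
  finally show ?thesis .
qed

text \<open>The properties of the mask on which the infinite product depends: \<open>p\<close> is
  the order of contact with 1 at the origin, \<open>q\<close> the order of the zero at 1/2.\<close>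

locale lowpass =
  fixes m :: "real \<Rightarrow> real" and C C' p q :: real
  assumes nonneg: "0 \<le> m x" and le_1: "m x \<le> 1"
    and periodic: "m (x + 1) = m x"
    and squares: "(m x)\<^sup>2 + (m (x + 1/2))\<^sup>2 \<le> 1"
    and at_0: "1 - m x \<le> C * \<bar>x\<bar> powr p"
    and at_half: "m (x + 1/2) \<le> C' * \<bar>x\<bar> powr q"
    and pos: "0 < p" "0 < q" "0 \<le> C" "0 \<le> C'"
begin

definition partial :: "nat \<Rightarrow> real \<Rightarrow> real" where
  "partial n x = (\<Prod>i<n. m (x / 2 ^ Suc i))"

definition limit :: "real \<Rightarrow> real" where
  "limit x = (\<Prod>i. m (x / 2 ^ Suc i))"

lemma at_0_scaled: "1 - m (x / 2 ^ Suc i) \<le> C * \<bar>x\<bar> powr p * (2 powr (- p)) ^ Suc i"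
proof -
  have "1 - m (x / 2 ^ Suc i) \<le> C * \<bar>x / 2 ^ Suc i\<bar> powr p"
    by (rule at_0)
  also have "\<bar>x / 2 ^ Suc i\<bar> powr p = \<bar>x\<bar> powr p * (2 powr (- p)) ^ Suc i"
  proof -
    have "\<bar>x / 2 ^ Suc i\<bar> = \<bar>x\<bar> * 2 powr (- real (Suc i))"
      by (simp add: abs_mult powr_minus powr_realpow divide_inverse del: power_Suc of_nat_Suc)
    then show ?thesis
      by (simp add: powr_mult powr_powr powr_power mult.commute del: power_Suc of_nat_Suc)
  qed
  finally show ?thesis
    by (simp add: mult.assoc)
qed

lemma ratio: "0 < 2 powr (- p)" "2 powr (- p) < 1"
  using pos by (auto simp: powr_less_one)

text \<open>The defects \<open>1 - m\<close> decay geometrically along the factors, so the product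
  converges absolutely; vanishing factors do no harm.\<close>

lemma partial_tendsto: "(\<lambda>n. partial n x) \<longlonglongrightarrow> limit x"
proof -
  have "summable (\<lambda>i. norm (m (x / 2 ^ Suc i) - 1))"
  proof (rule summable_comparison_test')
    show "summable (\<lambda>i. C * \<bar>x\<bar> powr p * (2 powr (- p)) ^ Suc i)"
      using ratio by (intro summable_mult summable_ignore_initial_segment[of _ 1, simplified] summable_geometric) auto
    fix i :: nat
    show "norm (norm (m (x / 2 ^ Suc i) - 1)) \<le> C * \<bar>x\<bar> powr p * (2 powr (- p)) ^ Suc i"
      using at_0_scaled[of x i] le_1[of "x / 2 ^ Suc i"] by simp
  qed
  then have "convergent_prod (\<lambda>i. m (x / 2 ^ Suc i))"
    by (intro abs_convergent_prod_imp_convergent_prod summable_imp_abs_convergent_prod)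
  then have "(\<lambda>n. \<Prod>i\<le>n. m (x / 2 ^ Suc i)) \<longlonglongrightarrow> limit x"
    unfolding limit_def by (rule convergent_prod_LIMSEQ)
  then have "(\<lambda>n. partial (Suc n) x) \<longlonglongrightarrow> limit x"
    by (simp only: partial_def lessThan_Suc_atMost)
  then show ?thesis
    by (rule LIMSEQ_imp_Suc)
qed

lemma partial_nonneg: "0 \<le> partial n x"
  unfolding partial_def by (intro prod_nonneg) (auto intro: nonneg)

lemma partial_le_1: "partial n x \<le> 1"
  unfolding partial_def by (intro prod_le_1) (auto intro: nonneg le_1)

lemma limit_nonneg: "0 \<le> limit x"
  by (rule LIMSEQ_le_const[OF partial_tendsto]) (auto intro: partial_nonneg)

lemma limit_le_1: "limit x \<le> 1"
  by (rule LIMSEQ_le_const2[OF partial_tendsto]) (auto intro: partial_le_1)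

text \<open>For \<open>a\<close> and \<open>b\<close> at most 1,
  \<open>1 - a * b \<le> (1 - a) + (1 - b)\<close>. The defect of the product is thus at most the
  sum of the defects, a geometric series with ratio \<open>2 powr (- p)\<close>.\<close>

lemma one_minus_limit_le:
  "1 - limit x \<le> C * (2 powr (- p) / (1 - 2 powr (- p))) * \<bar>x\<bar> powr p"
proof -
  define r where "r = 2 powr (- p)"
  have r: "0 < r" "r < 1"
    using ratio by (auto simp: r_def)
  have "1 - partial n x \<le> (\<Sum>i<n. C * \<bar>x\<bar> powr p * r ^ Suc i)" for n
  proof (induction n)
    case (Suc n)
    define a b where "a = partial n x" and "b = m (x / 2 ^ Suc n)"
    have "0 \<le> (1 - a) * (1 - b)"
      unfolding a_def b_def by (intro mult_nonneg_nonneg) (use partial_le_1 le_1 in auto)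
    then have "1 - a * b \<le> (1 - a) + (1 - b)"
      by (simp add: algebra_simps)
    moreover have "partial (Suc n) x = a * b"
      by (simp add: partial_def a_def b_def)
    ultimately show ?case
      using Suc at_0_scaled[of x n] by (simp add: a_def b_def r_def)
  qed (simp add: partial_def)
  also have "(\<Sum>i<n. C * \<bar>x\<bar> powr p * r ^ Suc i) \<le> C * (r / (1 - r)) * \<bar>x\<bar> powr p" for n
  proof -
    have "(\<Sum>i<n. r ^ i) \<le> 1 / (1 - r)"
      using r by (simp add: sum_gp_strict divide_right_mono)
    then have "C * \<bar>x\<bar> powr p * r * (\<Sum>i<n. r ^ i) \<le> C * \<bar>x\<bar> powr p * r * (1 / (1 - r))"
      using pos r by (intro mult_left_mono) auto
    then show ?thesis
      by (simp add: sum_distrib_left mult_ac)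
  qed
  finally have le: "1 - partial n x \<le> C * (r / (1 - r)) * \<bar>x\<bar> powr p" for n .
  show ?thesis
    by (rule LIMSEQ_le_const2[OF tendsto_diff[OF tendsto_const partial_tendsto]])
      (use le in \<open>auto simp: r_def\<close>)
qed

lemma partial_Suc: "partial (Suc n) x = m (x / 2) * partial n (x / 2)"
  unfolding partial_def by (subst prod.lessThan_Suc_shift) (simp add: mult.assoc)

text \<open>The two-scale relation, inherited from \<open>partial_Suc\<close>; it makes the halving
  in \<open>limit_bracket_tail_le\<close> possible.\<close>

lemma limit_refine: "limit x = m (x / 2) * limit (x / 2)"
proof (rule LIMSEQ_unique)
  show "(\<lambda>n. partial (Suc n) x) \<longlonglongrightarrow> limit x"
    by (rule LIMSEQ_Suc[OF partial_tendsto])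
  show "(\<lambda>n. partial (Suc n) x) \<longlonglongrightarrow> m (x / 2) * limit (x / 2)"
    unfolding partial_Suc by (intro tendsto_intros partial_tendsto)
qed

lemma periodic_nat: "m (x + real n) = m x"
proof (induction n)
  case (Suc n)
  then show ?case
    using periodic[of "x + real n"] by (simp add: add_ac)
qed simp

lemma periodic_int: "m (x + real_of_int k) = m x"
proof (cases "k \<ge> 0")
  case True
  then show ?thesis
    using periodic_nat[of x "nat k"] by simp
next
  case False
  then show ?thesis
    using periodic_nat[of "x + real_of_int k" "nat (- k)"] by simp
qed

section \<open>Bracket sums over integer shifts\<close>

text \<open>Halving sends the even shifts to \<open>x / 2 + j\<close> and the odd ones to
  \<open>x / 2 + 1 / 2 + j\<close>. By periodicity the mask factor is constant on each class, the
  induction hypothesis at the two base points bounds the rest by 1, and \<open>squares\<close>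
  bounds the sum of the two squared mask factors.\<close>

lemma partial_bracket_le_1: "(\<Sum>k<2^n. (partial n (x + real k))\<^sup>2) \<le> 1"
proof (induction n arbitrary: x)
  case (Suc n)
  have even: "partial (Suc n) (x + real (2 * j)) = m (x / 2) * partial n (x / 2 + real j)" for j
    using periodic_nat[of "x / 2" j] by (simp add: partial_Suc add_divide_distrib)
  have odd: "partial (Suc n) (x + real (2 * j + 1))
      = m (x / 2 + 1 / 2) * partial n ((x / 2 + 1 / 2) + real j)" for j
    using periodic_nat[of "x / 2 + 1 / 2" j]
    by (simp add: partial_Suc add_divide_distrib add_ac)
  have "(\<Sum>k<2^Suc n. (partial (Suc n) (x + real k))\<^sup>2)
      = (\<Sum>j<2^n. (partial (Suc n) (x + real (2 * j)))\<^sup>2 + (partial (Suc n) (x + real (2 * j + 1)))\<^sup>2)"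
    using sum.nat_group[of "\<lambda>k. (partial (Suc n) (x + real k))\<^sup>2" 2 "2^n", symmetric]
    by (simp add: numeral_2_eq_2 mult.commute add.commute)
  also have "\<dots> = (m (x / 2))\<^sup>2 * (\<Sum>j<2^n. (partial n (x / 2 + real j))\<^sup>2)
      + (m (x / 2 + 1 / 2))\<^sup>2 * (\<Sum>j<2^n. (partial n ((x / 2 + 1 / 2) + real j))\<^sup>2)"
    unfolding even odd by (simp only: power_mult_distrib sum.distrib sum_distrib_left)
  also have "\<dots> \<le> (m (x / 2))\<^sup>2 * 1 + (m (x / 2 + 1 / 2))\<^sup>2 * 1"
    by (intro add_mono mult_left_mono Suc) auto
  also have "\<dots> \<le> 1"
    using squares[of "x / 2"] by simp
  finally show ?case .
qed (simp add: partial_def)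

text \<open>A fixed finite \<open>K\<close> lies in a window of \<open>2 ^ n\<close> consecutive
  integers for all large \<open>n\<close>. The window may start at any integer, because
  \<open>partial_bracket_le_1\<close> holds at every base point. Then \<open>n\<close> tends to
  infinity in the finite sum.\<close>

lemma limit_bracket_le_1:
  assumes "finite K"
  shows "(\<Sum>k\<in>K. (limit (x + real_of_int k))\<^sup>2) \<le> 1"
proof (cases "K = {}")
  case False
  define a where "a = Min K"
  define b where "b = nat (Max K - a)"
  have sub: "K \<subseteq> (\<lambda>j. a + int j) ` {..<2^n}" if "b \<le> n" for n
  proof
    fix k assume "k \<in> K"
    then have "a \<le> k" "k \<le> Max K"
      using assms by (auto simp: a_def)
    then have "k = a + int (nat (k - a))" "nat (k - a) \<le> n"
      using that by (auto simp: b_def)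
    moreover have "n < 2 ^ n"
      by (rule less_exp)
    ultimately have "k = a + int (nat (k - a))" "nat (k - a) < 2 ^ n"
      by (blast, linarith)
    then show "k \<in> (\<lambda>j. a + int j) ` {..<2^n}"
      by blast
  qed
  have le: "(\<Sum>k\<in>K. (partial n (x + real_of_int k))\<^sup>2) \<le> 1" if "b \<le> n" for n
  proof -
    have "(\<Sum>k\<in>K. (partial n (x + real_of_int k))\<^sup>2)
        \<le> (\<Sum>k\<in>(\<lambda>j. a + int j) ` {..<2^n}. (partial n (x + real_of_int k))\<^sup>2)"
      using sub[OF that] by (intro sum_mono2) auto
    also have "\<dots> = (\<Sum>j<2^n. (partial n ((x + real_of_int a) + real j))\<^sup>2)"
      by (subst sum.reindex) (auto simp: inj_on_def add.assoc)
    also have "\<dots> \<le> 1"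
      by (rule partial_bracket_le_1)
    finally show ?thesis .
  qed
  show ?thesis
  proof (rule LIMSEQ_le_const2)
    show "(\<lambda>n. \<Sum>k\<in>K. (partial n (x + real_of_int k))\<^sup>2) \<longlonglongrightarrow> (\<Sum>k\<in>K. (limit (x + real_of_int k))\<^sup>2)"
      by (intro tendsto_intros partial_tendsto)
  qed (use le in auto)
qed simp

text \<open>Odd shifts see a factor of the mask near its zero at \<open>1/2\<close>; even shifts reduce to \<open>x / 2\<close>.\<close>

lemma limit_bracket_tail_le:
  assumes "K \<subseteq> {- int n..int n} - {0}"
  shows "(\<Sum>k\<in>K. (limit (x + real_of_int k))\<^sup>2)
    \<le> C'\<^sup>2 * 2 powr (- 2 * q) / (1 - 2 powr (- 2 * q)) * \<bar>x\<bar> powr (2 * q)"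
  using assms
proof (induction n arbitrary: K x rule: less_induct)
  case (less n)
  define r where "r = 2 powr (- 2 * q)"
  have r: "0 < r" "r < 1"
    using pos by (auto simp: r_def powr_less_one)
  \<comment> \<open>The fixed point of \<open>D = (D + C'\<^sup>2) * r\<close>: even shifts
    contribute \<open>D\<close> and odd ones \<open>C'\<^sup>2\<close>, both at
    \<open>x / 2\<close>, and halving \<open>x\<close> costs the factor \<open>r\<close>.\<close>
  define D where "D = C'\<^sup>2 * r / (1 - r)"
  have half: "\<bar>x / 2\<bar> powr (2 * q) = r * \<bar>x\<bar> powr (2 * q)"
  proof -
    have "r = 1 / 2 powr (2 * q)"
      unfolding r_def by (metis mult_minus_left powr_minus_divide)
    then show ?thesis
      by (simp add: powr_divide)
  qed
  define J where "J = {j. 2 * j \<in> K}"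
  define L where "L = {j. 2 * j + 1 \<in> K}"
  have fin: "finite K"
    using less.prems finite_subset by fastforce
  have finJ: "finite J" and finL: "finite L"
    unfolding J_def L_def by (auto intro!: finite_vimageI[OF fin, unfolded vimage_def] simp: inj_def)
  have K: "K = (\<lambda>j. 2 * j) ` J \<union> (\<lambda>j. 2 * j + 1) ` L"
    unfolding J_def L_def
  proof (intro equalityI subsetI)
    fix k assume "k \<in> K"
    then show "k \<in> (*) 2 ` {j. 2 * j \<in> K} \<union> (\<lambda>j. 2 * j + 1) ` {j. 2 * j + 1 \<in> K}"
      by (cases "even k") (auto elim!: evenE oddE)
  qed auto
  have evenpart: "(\<Sum>j\<in>J. (limit (x + real_of_int (2 * j)))\<^sup>2) \<le> D * \<bar>x / 2\<bar> powr (2 * q)"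
  proof (cases "n = 0")
    case True
    then have "J = {}"
      using less.prems by (auto simp: J_def)
    then show ?thesis
      using r by (auto simp: D_def)
  next
    case False
    have "(\<Sum>j\<in>J. (limit (x + real_of_int (2 * j)))\<^sup>2) \<le> (\<Sum>j\<in>J. (limit (x / 2 + real_of_int j))\<^sup>2)"
    proof (intro sum_mono power_mono limit_nonneg)
      fix j
      have "limit (x + real_of_int (2 * j)) = m (x / 2 + real_of_int j) * limit (x / 2 + real_of_int j)"
        by (subst limit_refine) (simp add: add_divide_distrib)
      also have "\<dots> \<le> 1 * limit (x / 2 + real_of_int j)"
        by (intro mult_right_mono le_1 limit_nonneg)
      finally show "limit (x + real_of_int (2 * j)) \<le> limit (x / 2 + real_of_int j)" by simp
    qed
    also have "\<dots> \<le> D * \<bar>x / 2\<bar> powr (2 * q)"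
      unfolding D_def r_def
    proof (rule less.IH)
      show "n div 2 < n" using False by simp
      show "J \<subseteq> {- int (n div 2)..int (n div 2)} - {0}"
        using less.prems by (auto simp: J_def subset_iff zdiv_int)
    qed
    finally show ?thesis .
  qed
  have oddpart: "(\<Sum>j\<in>L. (limit (x + real_of_int (2 * j + 1)))\<^sup>2) \<le> C'\<^sup>2 * \<bar>x / 2\<bar> powr (2 * q)"
  proof -
    have eq: "limit (x + real_of_int (2 * j + 1)) = m (x / 2 + 1 / 2) * limit (x / 2 + 1 / 2 + real_of_int j)" for j
      using periodic_int[of "x / 2 + 1 / 2" j]
      by (subst limit_refine) (simp add: add_divide_distrib add_ac)
    have "(\<Sum>j\<in>L. (limit (x + real_of_int (2 * j + 1)))\<^sup>2)
        = (m (x / 2 + 1 / 2))\<^sup>2 * (\<Sum>j\<in>L. (limit (x / 2 + 1 / 2 + real_of_int j))\<^sup>2)"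
      unfolding eq by (simp only: power_mult_distrib sum_distrib_left)
    also have "\<dots> \<le> (C' * \<bar>x / 2\<bar> powr q)\<^sup>2 * 1"
      by (intro mult_mono power_mono at_half nonneg limit_bracket_le_1 finL) (auto intro: sum_nonneg)
    also have "\<dots> = C'\<^sup>2 * \<bar>x / 2\<bar> powr (2 * q)"
      by (simp add: power_mult_distrib power2_eq_square[of "_ powr _"] flip: powr_add)
    finally show ?thesis .
  qed
  have "(\<Sum>k\<in>K. (limit (x + real_of_int k))\<^sup>2)
      = (\<Sum>j\<in>J. (limit (x + real_of_int (2 * j)))\<^sup>2) + (\<Sum>j\<in>L. (limit (x + real_of_int (2 * j + 1)))\<^sup>2)"
    unfolding K
  proof (subst sum.union_disjoint)
    show "(*) 2 ` J \<inter> (\<lambda>j. 2 * j + 1) ` L = {}"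
      by (auto, presburger)
  qed (use finJ finL in \<open>auto simp: sum.reindex inj_on_def\<close>)
  also have "\<dots> \<le> D * \<bar>x / 2\<bar> powr (2 * q) + C'\<^sup>2 * \<bar>x / 2\<bar> powr (2 * q)"
    by (rule add_mono[OF evenpart oddpart])
  also have "\<dots> = (D + C'\<^sup>2) * r * \<bar>x\<bar> powr (2 * q)"
    unfolding half by (simp add: algebra_simps)
  also have "(D + C'\<^sup>2) * r = D"
    using r by (simp add: D_def field_simps)
  finally show ?case
    by (simp add: D_def r_def)
qed

end

text \<open>The powers of \<open>pi\<close> come from \<open>|sin (pi * x)| \<le> pi * |x|\<close>:
  at 0 the defect is of order \<open>sin^2\<close> to the power \<open>l + 1\<close>, at 1/2 the
  mask is of order \<open>sin^2\<close> to the power \<open>\<alpha>\<close>.\<close>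

lemma (in spline_order) lowpass_refinement_mask:
  "lowpass (refinement_mask \<alpha> l) (B (Suc l) * pi ^ (2 * Suc l)) ((\<Sum>k=0..l. B k) * pi powr (2 * \<alpha>))
     (2 * (real l + 1)) (2 * \<alpha>)"
proof
  fix x :: real
  have c: "0 \<le> (cos (pi * x))\<^sup>2" "(cos (pi * x))\<^sup>2 \<le> 1"
    by (auto simp: abs_square_le_1)
  show "0 \<le> refinement_mask \<alpha> l x" "refinement_mask \<alpha> l x \<le> 1"
    unfolding refinement_mask_eq using c by (auto intro: spline_poly_nonneg spline_poly_le_1)
  show "refinement_mask \<alpha> l (x + 1) = refinement_mask \<alpha> l x"
    by (simp add: refinement_mask_eq distrib_left)
  have shift: "(cos (pi * (x + 1 / 2)))\<^sup>2 = (sin (pi * x))\<^sup>2"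
    by (simp add: distrib_left cos_add)
  have compl: "1 - (cos (pi * x))\<^sup>2 = (sin (pi * x))\<^sup>2"
    by (simp add: sin_squared_eq)
  show "(refinement_mask \<alpha> l x)\<^sup>2 + (refinement_mask \<alpha> l (x + 1 / 2))\<^sup>2 \<le> 1"
    unfolding refinement_mask_eq shift using spline_poly_squares_le_1[OF c] by (simp add: compl)
  have sin: "(sin (pi * x))\<^sup>2 \<le> (pi * \<bar>x\<bar>)\<^sup>2"
    using abs_sin_x_le_abs_x[of "pi * x"] by (simp add: abs_le_square_iff[symmetric] abs_mult)
  have "1 - refinement_mask \<alpha> l x \<le> B (Suc l) * ((sin (pi * x))\<^sup>2) ^ Suc l"
    unfolding refinement_mask_eq using one_minus_spline_poly_le[OF c] by (simp add: compl)
  also have "\<dots> \<le> B (Suc l) * ((pi * \<bar>x\<bar>)\<^sup>2) ^ Suc l"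
    by (intro mult_left_mono power_mono sin B_nonneg) auto
  also have "((pi * \<bar>x\<bar>)\<^sup>2) ^ Suc l = pi ^ (2 * Suc l) * \<bar>x\<bar> ^ (2 * Suc l)"
    by (simp only: power_mult[symmetric] power_mult_distrib)
  also have "\<bar>x\<bar> ^ (2 * Suc l) = \<bar>x\<bar> powr (2 * (real l + 1))"
    using powr_realpow'[of "\<bar>x\<bar>" "2 * Suc l"] by (simp add: add.commute)
  finally show "1 - refinement_mask \<alpha> l x \<le> B (Suc l) * pi ^ (2 * Suc l) * \<bar>x\<bar> powr (2 * (real l + 1))"
    by (simp add: mult.assoc)
  have "refinement_mask \<alpha> l (x + 1 / 2) \<le> (\<Sum>k=0..l. B k) * ((sin (pi * x))\<^sup>2) powr \<alpha>"
    unfolding refinement_mask_eq shift by (rule spline_poly_le_powr) (auto simp: abs_square_le_1)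
  also have "\<dots> \<le> (\<Sum>k=0..l. B k) * ((pi * \<bar>x\<bar>)\<^sup>2) powr \<alpha>"
    using \<alpha> by (intro mult_left_mono powr_mono2 sin sum_nonneg B_nonneg) auto
  also have "((pi * \<bar>x\<bar>)\<^sup>2) powr \<alpha> = pi powr (2 * \<alpha>) * \<bar>x\<bar> powr (2 * \<alpha>)"
    by (cases "x = 0") (auto simp: powr_mult powr_powr simp flip: powr_numeral)
  finally show "refinement_mask \<alpha> l (x + 1 / 2)
      \<le> (\<Sum>k=0..l. B k) * pi powr (2 * \<alpha>) * \<bar>x\<bar> powr (2 * \<alpha>)"
    by (simp add: mult.assoc)
next
  show "0 < 2 * (real l + 1)" "0 < 2 * \<alpha>"
    using \<alpha> by auto
  show "0 \<le> B (Suc l) * pi ^ (2 * Suc l)" "0 \<le> (\<Sum>k=0..l. B k) * pi powr (2 * \<alpha>)"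
    by (auto intro!: mult_nonneg_nonneg sum_nonneg B_nonneg)
qed

section \<open>Square-integrable functions and Bessel systems\<close>

lemma L2_measurable [measurable_dest]: "f \<in> L2 \<Longrightarrow> f \<in> borel_measurable borel"
  by (simp add: L2_def)

lemma L2_integrable: "f \<in> L2 \<Longrightarrow> integrable lborel (\<lambda>x. (cmod (f x))\<^sup>2)"
  by (simp add: L2_def)

lemma L2I: "f \<in> borel_measurable borel \<Longrightarrow> integrable lborel (\<lambda>x. (cmod (f x))\<^sup>2) \<Longrightarrow> f \<in> L2"
  by (simp add: L2_def)

lemma L2_iff_nn_integral:
  "f \<in> L2 \<longleftrightarrow> f \<in> borel_measurable borel \<and> (\<integral>\<^sup>+x. ennreal ((cmod (f x))\<^sup>2) \<partial>lborel) < \<infinity>"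
  by (auto simp: L2_def integrable_iff_bounded)

lemma L2_norm_nonneg: "0 \<le> L2_norm f"
  by (simp add: L2_norm_def)

lemma L2_norm_sq: "(L2_norm f)\<^sup>2 = (LINT x|lborel. (cmod (f x))\<^sup>2)"
  by (simp add: L2_norm_def)

lemma nn_integral_L2: "f \<in> L2 \<Longrightarrow> (\<integral>\<^sup>+x. ennreal ((cmod (f x))\<^sup>2) \<partial>lborel) = ennreal ((L2_norm f)\<^sup>2)"
  unfolding L2_norm_sq by (intro nn_integral_eq_integral L2_integrable) auto

text \<open>The form in which estimates are made below: a bound on the nonnegative integral yields
  membership in \<open>L2\<close> and the norm bound together, with no integrability to check
  first.\<close>

lemma L2_norm_le_nn_integral:
  assumes "(\<integral>\<^sup>+x. ennreal ((cmod (f x))\<^sup>2) \<partial>lborel) \<le> ennreal (b\<^sup>2)" "0 \<le> b" "f \<in> borel_measurable borel"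
  shows "f \<in> L2" "L2_norm f \<le> b"
proof -
  show f: "f \<in> L2"
    unfolding L2_iff_nn_integral using assms by (auto intro: le_less_trans)
  show "L2_norm f \<le> b"
    using assms(1) unfolding nn_integral_L2[OF f]
    using assms(2) by (auto intro: power2_le_imp_le)
qed

lemma L2_mono:
  assumes "g \<in> L2" "f \<in> borel_measurable borel" "AE x in lborel. cmod (f x) \<le> cmod (g x)"
  shows "f \<in> L2" "L2_norm f \<le> L2_norm g"
proof -
  have "(\<integral>\<^sup>+x. ennreal ((cmod (f x))\<^sup>2) \<partial>lborel) \<le> (\<integral>\<^sup>+x. ennreal ((cmod (g x))\<^sup>2) \<partial>lborel)"
    using assms(3) by (intro nn_integral_mono_AE) (auto elim!: eventually_mono intro: power_mono)
  also have "\<dots> = ennreal ((L2_norm g)\<^sup>2)"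
    by (rule nn_integral_L2[OF assms(1)])
  finally have le: "(\<integral>\<^sup>+x. ennreal ((cmod (f x))\<^sup>2) \<partial>lborel) \<le> ennreal ((L2_norm g)\<^sup>2)" .
  show "f \<in> L2" "L2_norm f \<le> L2_norm g"
    using L2_norm_le_nn_integral[OF le L2_norm_nonneg assms(2)] by auto
qed

lemma L2_zero [simp]: "(\<lambda>x. 0) \<in> L2"
  by (simp add: L2_def)

lemma L2_norm_zero [simp]: "L2_norm (\<lambda>x. 0) = 0"
  by (simp add: L2_norm_def)

lemma L2_norm_cmult: "L2_norm (\<lambda>x. c * f x) = cmod c * L2_norm f"
  by (simp add: L2_norm_def norm_mult power_mult_distrib real_sqrt_mult)

lemma L2_norm_minus_commute: "L2_norm (\<lambda>x. f x - g x) = L2_norm (\<lambda>x. g x - f x)"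
  by (simp add: L2_norm_def norm_minus_commute)

lemma L2_cmult: "f \<in> L2 \<Longrightarrow> (\<lambda>x. c * f x) \<in> L2"
  by (auto simp: L2_def norm_mult power_mult_distrib)

lemma L2_bounded_mult:
  assumes "f \<in> L2" "g \<in> borel_measurable borel" "\<And>x. cmod (g x) \<le> 1"
  shows "(\<lambda>x. g x * f x) \<in> L2" "L2_norm (\<lambda>x. g x * f x) \<le> L2_norm f"
proof -
  have "cmod (g x * f x) \<le> cmod (f x)" for x
    using assms(3)[of x] by (simp add: norm_mult mult_left_le_one_le)
  then show "(\<lambda>x. g x * f x) \<in> L2" "L2_norm (\<lambda>x. g x * f x) \<le> L2_norm f"
    using assms(2) L2_measurable[OF assms(1)] L2_mono[OF assms(1), of "\<lambda>x. g x * f x"] by auto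
qed

lemma L2_indicator: "f \<in> L2 \<Longrightarrow> A \<in> sets borel \<Longrightarrow> (\<lambda>x. indicator A x * f x) \<in> L2"
  by (rule L2_bounded_mult) (auto simp: indicator_def)

lemma cmod_add_sq_le: "(cmod (a + b))\<^sup>2 \<le> 2 * (cmod a)\<^sup>2 + 2 * (cmod b)\<^sup>2"
proof -
  have "(cmod (a + b))\<^sup>2 \<le> (cmod a + cmod b)\<^sup>2"
    by (intro power_mono norm_triangle_ineq) auto
  also have "\<dots> \<le> 2 * (cmod a)\<^sup>2 + 2 * (cmod b)\<^sup>2"
    using sum_squares_bound[of "cmod a" "cmod b"] by (simp add: power2_sum)
  finally show ?thesis .
qed

lemma L2_add:
  assumes "f \<in> L2" "g \<in> L2"
  shows "(\<lambda>x. f x + g x) \<in> L2"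
proof (rule L2I)
  have [measurable]: "f \<in> borel_measurable borel" "g \<in> borel_measurable borel"
    using assms by (auto intro: L2_measurable)
  show "(\<lambda>x. f x + g x) \<in> borel_measurable borel"
    by measurable
  show "integrable lborel (\<lambda>x. (cmod (f x + g x))\<^sup>2)"
  proof (rule Bochner_Integration.integrable_bound)
    show "integrable lborel (\<lambda>x. 2 * (cmod (f x))\<^sup>2 + 2 * (cmod (g x))\<^sup>2)"
      using assms by (intro Bochner_Integration.integrable_add integrable_mult_right L2_integrable) auto
    show "AE x in lborel. norm ((cmod (f x + g x))\<^sup>2) \<le> norm (2 * (cmod (f x))\<^sup>2 + 2 * (cmod (g x))\<^sup>2)"
      by (auto intro!: AE_I2 order_trans[OF cmod_add_sq_le])
  qed auto
qed

lemma L2_diff: "f \<in> L2 \<Longrightarrow> g \<in> L2 \<Longrightarrow> (\<lambda>x. f x - g x) \<in> L2"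
  using L2_add[of f "\<lambda>x. (-1) * g x"] L2_cmult[of g "-1"] by simp

lemma L2_sum: "(\<And>k. k \<in> K \<Longrightarrow> f k \<in> L2) \<Longrightarrow> (\<lambda>x. \<Sum>k\<in>K. f k x) \<in> L2"
  by (induction K rule: infinite_finite_induct) (auto intro: L2_add)

lemma measurable_cnj [measurable]: "cnj \<in> borel_measurable borel"
  by (intro borel_measurable_continuous_onI continuous_intros)

lemma L2_inner_integrable:
  assumes "f \<in> L2" "g \<in> L2"
  shows "integrable lborel (\<lambda>x. f x * cnj (g x))"
proof (rule Bochner_Integration.integrable_bound)
  have [measurable]: "f \<in> borel_measurable borel" "g \<in> borel_measurable borel"
    using assms by (auto intro: L2_measurable)
  show "integrable lborel (\<lambda>x. (cmod (f x))\<^sup>2 + (cmod (g x))\<^sup>2)"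
    using assms by (intro Bochner_Integration.integrable_add L2_integrable) auto
  show "(\<lambda>x. f x * cnj (g x)) \<in> borel_measurable lborel"
    by measurable
  show "AE x in lborel. norm (f x * cnj (g x)) \<le> norm ((cmod (f x))\<^sup>2 + (cmod (g x))\<^sup>2)"
  proof (rule AE_I2)
    fix x
    have "cmod (f x) * cmod (g x) \<le> 2 * cmod (f x) * cmod (g x)"
      by simp
    also have "\<dots> \<le> (cmod (f x))\<^sup>2 + (cmod (g x))\<^sup>2"
      by (rule sum_squares_bound)
    finally show "norm (f x * cnj (g x)) \<le> norm ((cmod (f x))\<^sup>2 + (cmod (g x))\<^sup>2)"
      by (simp add: norm_mult)
  qed
qed

lemma L2_inner_commute: "L2_inner g f = cnj (L2_inner f g)"
  unfolding L2_inner_def by (subst Bochner_Integration.integral_cnj[symmetric]) (simp add: mult.commute)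

lemma L2_inner_self: "L2_inner f f = of_real ((L2_norm f)\<^sup>2)"
  unfolding L2_inner_def L2_norm_sq
  by (simp add: complex_norm_square[symmetric] flip: of_real_power)

lemma L2_inner_diff_left:
  "f \<in> L2 \<Longrightarrow> g \<in> L2 \<Longrightarrow> h \<in> L2 \<Longrightarrow> L2_inner (\<lambda>x. f x - g x) h = L2_inner f h - L2_inner g h"
  unfolding L2_inner_def left_diff_distrib
  by (rule Bochner_Integration.integral_diff) (auto intro: L2_inner_integrable)

lemma L2_inner_cmult_right: "L2_inner f (\<lambda>x. c * g x) = cnj c * L2_inner f g"
  unfolding L2_inner_def by (simp add: mult.left_commute)

lemma L2_inner_sum_right:
  assumes "f \<in> L2" "\<And>k. k \<in> K \<Longrightarrow> g k \<in> L2"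
  shows "L2_inner f (\<lambda>x. \<Sum>k\<in>K. g k x) = (\<Sum>k\<in>K. L2_inner f (g k))"
  unfolding L2_inner_def using assms
  by (subst Bochner_Integration.integral_sum[symmetric]) (auto intro: L2_inner_integrable simp: sum_distrib_left)

lemma L2_norm_diff_sq:
  assumes "f \<in> L2" "g \<in> L2"
  shows "(L2_norm (\<lambda>x. f x - g x))\<^sup>2 = (L2_norm f)\<^sup>2 - 2 * Re (L2_inner f g) + (L2_norm g)\<^sup>2"
proof -
  have eq: "(cmod (a - b))\<^sup>2 = (cmod a)\<^sup>2 - 2 * Re (a * cnj b) + (cmod b)\<^sup>2" for a b
    by (simp add: cmod_power2 power2_diff algebra_simps)
  have "(L2_norm (\<lambda>x. f x - g x))\<^sup>2
      = (LINT x|lborel. (cmod (f x))\<^sup>2 - 2 * Re (f x * cnj (g x)) + (cmod (g x))\<^sup>2)"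
    by (simp only: L2_norm_sq eq)
  also have "\<dots> = (L2_norm f)\<^sup>2 - 2 * (LINT x|lborel. Re (f x * cnj (g x))) + (L2_norm g)\<^sup>2"
    using assms unfolding L2_norm_sq
    by (simp add: L2_integrable L2_inner_integrable del: times_complex.sel)
  also have "(LINT x|lborel. Re (f x * cnj (g x))) = Re (L2_inner f g)"
    unfolding L2_inner_def by (intro integral_Re L2_inner_integrable assms)
  finally show ?thesis .
qed

text \<open>The squared norm of \<open>f - t * s * g\<close>, with \<open>s\<close> the inner
  product and \<open>t\<close> real, is a quadratic in \<open>t\<close>, minimised at
  \<open>t = 1 / (L2_norm g)\<^sup>2\<close>. If the norm of \<open>g\<close> is 0, it is linear in
  \<open>t\<close>, which forces \<open>s = 0\<close>.\<close>

lemma L2_Cauchy_Schwarz: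
  assumes "f \<in> L2" "g \<in> L2"
  shows "cmod (L2_inner f g) \<le> L2_norm f * L2_norm g"
proof -
  define s where "s = L2_inner f g"
  have ineq: "0 \<le> (L2_norm f)\<^sup>2 - 2 * t * (cmod s)\<^sup>2 + t\<^sup>2 * (cmod s)\<^sup>2 * (L2_norm g)\<^sup>2" for t :: real
  proof -
    have "0 \<le> (L2_norm (\<lambda>x. f x - of_real t * s * g x))\<^sup>2"
      by simp
    also have "\<dots> = (L2_norm f)\<^sup>2 - 2 * Re (cnj (of_real t * s) * s) + (cmod (of_real t * s) * L2_norm g)\<^sup>2"
      using assms by (simp add: L2_norm_diff_sq L2_cmult L2_norm_cmult L2_inner_cmult_right s_def del: times_complex.sel)
    also have "Re (cnj (of_real t * s) * s) = t * (cmod s)\<^sup>2"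
      unfolding cmod_power2 by (simp add: algebra_simps power2_eq_square)
    finally show ?thesis
      by (simp add: norm_mult power_mult_distrib algebra_simps)
  qed
  have "(cmod s)\<^sup>2 \<le> (L2_norm f)\<^sup>2 * (L2_norm g)\<^sup>2"
  proof (cases "L2_norm g = 0")
    case True
    have "cmod s = 0"
    proof (rule ccontr)
      assume "cmod s \<noteq> 0"
      \<comment> \<open>This \<open>t\<close> turns the linear expression into
        \<open>- (L2_norm f)\<^sup>2 - 2\<close>, which is negative.\<close>
      define t where "t = ((L2_norm f)\<^sup>2 + 1) / (cmod s)\<^sup>2"
      have "t * (cmod s)\<^sup>2 = (L2_norm f)\<^sup>2 + 1"
        using \<open>cmod s \<noteq> 0\<close> by (simp add: t_def)
      moreover have "0 \<le> (L2_norm f)\<^sup>2 - 2 * (t * (cmod s)\<^sup>2)"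
        using ineq[of t] True by (simp add: mult.assoc)
      ultimately show False
        using zero_le_power2[of "L2_norm f"] by linarith
    qed
    then show ?thesis by simp
  next
    case False
    then show ?thesis
    proof -
      have "0 \<le> (L2_norm f)\<^sup>2 - (cmod s)\<^sup>2 / (L2_norm g)\<^sup>2"
      proof -
      have "(1 / (L2_norm g)\<^sup>2)\<^sup>2 * (cmod s)\<^sup>2 * (L2_norm g)\<^sup>2 = (cmod s)\<^sup>2 / (L2_norm g)\<^sup>2"
        using False by (simp add: power2_eq_square)
      then show ?thesis
        using ineq[of "1 / (L2_norm g)\<^sup>2"] by simp
    qed
      then show ?thesis
        using False by (simp add: pos_divide_le_eq)
    qed
  qed
  then have "cmod s \<le> L2_norm f * L2_norm g"
    unfolding power_mult_distrib[symmetric]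
    by (rule power2_le_imp_le) (intro mult_nonneg_nonneg L2_norm_nonneg)
  then show ?thesis
    by (simp add: s_def)
qed

lemma L2_norm_diff_triangle:
  assumes "f \<in> L2" "g \<in> L2"
  shows "L2_norm (\<lambda>x. f x - g x) \<le> L2_norm f + L2_norm g"
proof (rule power2_le_imp_le)
  have "- Re (L2_inner f g) \<le> L2_norm f * L2_norm g"
    using L2_Cauchy_Schwarz[OF assms] abs_Re_le_cmod[of "L2_inner f g"] by linarith
  then show "(L2_norm (\<lambda>x. f x - g x))\<^sup>2 \<le> (L2_norm f + L2_norm g)\<^sup>2"
    unfolding L2_norm_diff_sq[OF assms] by (simp add: power2_sum)
qed (simp add: L2_norm_nonneg)

lemma L2_norm_triangle:
  assumes "f \<in> L2" "g \<in> L2"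
  shows "L2_norm (\<lambda>x. f x + g x) \<le> L2_norm f + L2_norm g"
  using L2_norm_diff_triangle[OF assms(1) L2_cmult[OF assms(2), of "-1"]] L2_norm_cmult[of "-1" g] by simp

lemma L2_dist_triangle:
  assumes "f \<in> L2" "g \<in> L2" "h \<in> L2"
  shows "L2_norm (\<lambda>x. f x - h x) \<le> L2_norm (\<lambda>x. f x - g x) + L2_norm (\<lambda>x. g x - h x)"
  using L2_norm_triangle[OF L2_diff[OF assms(1,2)] L2_diff[OF assms(2,3)]] by simp

lemma L2_norm_diff_abs:
  assumes "f \<in> L2" "g \<in> L2"
  shows "\<bar>L2_norm f - L2_norm g\<bar> \<le> L2_norm (\<lambda>x. f x - g x)"
  using L2_dist_triangle[of f g "\<lambda>x. 0"] L2_dist_triangle[of g f "\<lambda>x. 0"] assms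
    L2_norm_minus_commute[of f g] by simp

lemma L2_norm_tendsto:
  assumes "((\<lambda>i. L2_norm (\<lambda>x. f x - g i x)) \<longlongrightarrow> 0) F" "f \<in> L2" "eventually (\<lambda>i. g i \<in> L2) F"
  shows "((\<lambda>i. L2_norm (g i)) \<longlongrightarrow> L2_norm f) F"
proof -
  have "((\<lambda>i. L2_norm f - L2_norm (g i)) \<longlongrightarrow> 0) F"
    by (rule Lim_null_comparison[OF _ assms(1)])
      (use assms(3) in eventually_elim, use assms(2) L2_norm_diff_abs in auto)
  from tendsto_diff[OF tendsto_const this, of "L2_norm f"] show ?thesis by simp
qed

section \<open>Completeness of L2\<close>

text \<open>Riesz-Fischer for fast Cauchy sequences. The squared increments have integral at most
  \<open>(1/4) ^ n\<close>, so they stay summable after weighting by \<open>2 ^ n\<close>. The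
  pointwise inequality \<open>D \<le> 2 ^ n * D\<^sup>2 + (1/2) ^ n\<close> then makes the
  increments summable almost everywhere, and Fatou's lemma gives the norm bound for the pointwise
  limit.\<close>

lemma L2_complete:
  assumes f: "\<And>n. f n \<in> L2" and d: "\<And>n. L2_norm (\<lambda>x. f (Suc n) x - f n x) \<le> (1/2) ^ n"
  obtains g where "g \<in> L2" "(\<lambda>n. L2_norm (\<lambda>x. g x - f n x)) \<longlonglongrightarrow> 0"
proof -
  have [measurable]: "f n \<in> borel_measurable borel" for n
    using f by (rule L2_measurable)
  define D where "D n x = cmod (f (Suc n) x - f n x)" for n x
  have [measurable]: "D n \<in> borel_measurable borel" for n
    unfolding D_def by measurable
  have dint: "(\<integral>\<^sup>+x. ennreal ((D n x)\<^sup>2) \<partial>lborel) \<le> ennreal ((1/4) ^ n)" for n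
  proof -
    have "(L2_norm (\<lambda>x. f (Suc n) x - f n x))\<^sup>2 \<le> ((1/2) ^ n)\<^sup>2"
      by (intro power_mono d L2_norm_nonneg)
    also have "((1/2) ^ n)\<^sup>2 = (1/4 :: real) ^ n"
      by (simp add: power2_eq_square flip: power_mult_distrib)
    finally show ?thesis
      unfolding D_def nn_integral_L2[OF L2_diff[OF f f]] by (intro ennreal_leI) simp
  qed
  have "(\<integral>\<^sup>+x. (\<Sum>n. ennreal (2 ^ n * (D n x)\<^sup>2)) \<partial>lborel) = (\<Sum>n. \<integral>\<^sup>+x. ennreal (2 ^ n * (D n x)\<^sup>2) \<partial>lborel)"
    by (intro nn_integral_suminf) measurable
  also have "\<dots> \<le> (\<Sum>n. ennreal ((1/2) ^ n))"
  proof (intro suminf_le)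
    fix n
    have "(\<integral>\<^sup>+x. ennreal (2 ^ n * (D n x)\<^sup>2) \<partial>lborel) = ennreal (2 ^ n) * (\<integral>\<^sup>+x. ennreal ((D n x)\<^sup>2) \<partial>lborel)"
      by (subst nn_integral_cmult[symmetric]) (auto simp: ennreal_mult)
    also have "\<dots> \<le> ennreal (2 ^ n) * ennreal ((1/4) ^ n)"
      by (intro mult_left_mono dint) auto
    also have "\<dots> = ennreal ((1/2) ^ n)"
      by (simp add: ennreal_mult'[symmetric] flip: power_mult_distrib)
    finally show "(\<integral>\<^sup>+x. ennreal (2 ^ n * (D n x)\<^sup>2) \<partial>lborel) \<le> ennreal ((1/2) ^ n)" .
  qed auto
  also have "\<dots> = ennreal (\<Sum>n. (1/2) ^ n)"
    by (intro suminf_ennreal2) (auto intro: summable_geometric)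
  finally have "(\<integral>\<^sup>+x. (\<Sum>n. ennreal (2 ^ n * (D n x)\<^sup>2)) \<partial>lborel) \<noteq> \<infinity>"
    by (auto simp: top_unique)
  then have "AE x in lborel. (\<Sum>n. ennreal (2 ^ n * (D n x)\<^sup>2)) \<noteq> \<infinity>"
    by (intro nn_integral_PInf_AE) auto
  then have AEconv: "AE x in lborel. convergent (\<lambda>n. f n x)"
  proof eventually_elim
    case (elim x)
    have s: "summable (\<lambda>n. 2 ^ n * (D n x)\<^sup>2)"
      using elim by (intro summable_suminf_not_top) auto
    have "summable (\<lambda>n. D n x)"
    proof (rule summable_comparison_test')
      show "summable (\<lambda>n. 2 ^ n * (D n x)\<^sup>2 + (1/2) ^ n)"
        by (intro summable_add s summable_geometric) auto
      fix n :: nat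
      have "sqrt (2 ^ n) * D n x * (sqrt ((1/2) ^ n)) = D n x"
      proof -
        have "sqrt (2 ^ n) * sqrt ((1/2) ^ n) = 1"
          by (simp flip: real_sqrt_mult power_mult_distrib)
        then show ?thesis
          by (metis mult.assoc mult.commute mult.right_neutral)
      qed
      moreover have "2 * (sqrt (2 ^ n) * D n x) * (sqrt ((1/2) ^ n)) \<le> (sqrt (2 ^ n) * D n x)\<^sup>2 + (sqrt ((1/2) ^ n))\<^sup>2"
        by (rule sum_squares_bound)
      moreover have "0 \<le> D n x"
        by (simp add: D_def)
      ultimately show "norm (D n x) \<le> 2 ^ n * (D n x)\<^sup>2 + (1/2) ^ n"
        by (simp only: mult.assoc) (simp add: power_mult_distrib)
    qed
    then have "summable (\<lambda>n. f (Suc n) x - f n x)"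
      unfolding D_def by (rule summable_norm_cancel)
    then have "convergent (\<lambda>N. \<Sum>n<N. f (Suc n) x - f n x)"
      by (simp add: summable_iff_convergent)
    then have "convergent (\<lambda>N. f N x - f 0 x)"
      by (simp only: sum_lessThan_telescope[of "\<lambda>n. f n x"])
    from convergent_add[OF this convergent_const[of "f 0 x"]] show ?case
      by simp
  qed
  define g where "g x = lim (\<lambda>n. f n x)" for x
  have g[measurable]: "g \<in> borel_measurable borel"
    unfolding g_def by measurable
  \<comment> \<open>Carrying the exact value of the finite geometric sum lets the induction
    close.\<close>
  have bound: "L2_norm (\<lambda>x. f (n + k) x - f n x) \<le> 2 * (1/2) ^ n - 2 * (1/2) ^ (n + k)" for n k
  proof (induction k)
    case (Suc k)
    have "L2_norm (\<lambda>x. f (n + Suc k) x - f n x)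
      \<le> L2_norm (\<lambda>x. f (Suc (n + k)) x - f (n + k) x) + L2_norm (\<lambda>x. f (n + k) x - f n x)"
      using L2_dist_triangle[OF f f f] by simp
    also have "\<dots> \<le> (1/2) ^ (n + k) + (2 * (1/2) ^ n - 2 * (1/2) ^ (n + k))"
      by (intro add_mono d Suc)
    finally show ?case
      by simp
  qed simp
  have main: "(\<lambda>x. g x - f n x) \<in> L2" "L2_norm (\<lambda>x. g x - f n x) \<le> 2 * (1/2) ^ n" for n
  proof -
    have "(\<integral>\<^sup>+x. ennreal ((cmod (g x - f n x))\<^sup>2) \<partial>lborel)
      = (\<integral>\<^sup>+x. liminf (\<lambda>k. ennreal ((cmod (f (n + k) x - f n x))\<^sup>2)) \<partial>lborel)"
    proof (intro nn_integral_cong_AE, use AEconv in eventually_elim)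
      case (elim x)
      then have "(\<lambda>k. f k x) \<longlonglongrightarrow> g x"
        unfolding g_def by (simp add: convergent_LIMSEQ_iff)
      then have "(\<lambda>k. f (n + k) x) \<longlonglongrightarrow> g x"
        by (subst add.commute) (rule LIMSEQ_ignore_initial_segment)
      then have "(\<lambda>k. ennreal ((cmod (f (n + k) x - f n x))\<^sup>2)) \<longlonglongrightarrow> ennreal ((cmod (g x - f n x))\<^sup>2)"
        by (intro tendsto_intros)
      then show ?case
        by (intro lim_imp_Liminf[symmetric]) auto
    qed
    also have "\<dots> \<le> liminf (\<lambda>k. \<integral>\<^sup>+x. ennreal ((cmod (f (n + k) x - f n x))\<^sup>2) \<partial>lborel)"
      by (intro nn_integral_liminf) measurable
    also have "\<dots> \<le> limsup (\<lambda>k. \<integral>\<^sup>+x. ennreal ((cmod (f (n + k) x - f n x))\<^sup>2) \<partial>lborel)"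
      by (rule Liminf_le_Limsup) auto
    also have "\<dots> \<le> ennreal ((2 * (1/2) ^ n)\<^sup>2)"
    proof (intro Limsup_bounded always_eventually allI)
      fix k
      have "L2_norm (\<lambda>x. f (n + k) x - f n x) \<le> 2 * (1/2) ^ n"
        using bound[of n k] by (rule order_trans) simp
      then show "(\<integral>\<^sup>+x. ennreal ((cmod (f (n + k) x - f n x))\<^sup>2) \<partial>lborel) \<le> ennreal ((2 * (1/2) ^ n)\<^sup>2)"
        unfolding nn_integral_L2[OF L2_diff[OF f f]] by (intro ennreal_leI power_mono L2_norm_nonneg)
    qed
    finally have "(\<integral>\<^sup>+x. ennreal ((cmod (g x - f n x))\<^sup>2) \<partial>lborel) \<le> ennreal ((2 * (1/2) ^ n)\<^sup>2)" .
    from L2_norm_le_nn_integral[OF this] show "(\<lambda>x. g x - f n x) \<in> L2" "L2_norm (\<lambda>x. g x - f n x) \<le> 2 * (1/2) ^ n"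
      by auto
  qed
  show ?thesis
  proof
    show "g \<in> L2"
      using L2_add[OF main(1)[of 0] f[of 0]] by simp
    show "(\<lambda>n. L2_norm (\<lambda>x. g x - f n x)) \<longlonglongrightarrow> 0"
    proof (rule Lim_null_comparison)
      show "(\<lambda>n. 2 * (1/2 :: real) ^ n) \<longlonglongrightarrow> 0"
        by (intro tendsto_mult_right_zero LIMSEQ_realpow_zero) auto
    qed (auto intro!: always_eventually simp: L2_norm_nonneg main(2))
  qed
qed

section \<open>Bessel systems and unconditional sums\<close>

text \<open>Bessel systems with bound 1 in synthesis form, since a bracket of at most 1 directly
  bounds finite combinations; the inequality for coefficients follows by duality.\<close>

definition bessel :: "('i \<Rightarrow> real \<Rightarrow> complex) \<Rightarrow> bool" where
  "bessel \<psi> \<longleftrightarrow> (\<forall>k. \<psi> k \<in> L2) \<and>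
     (\<forall>K c. finite K \<longrightarrow> (L2_norm (\<lambda>x. \<Sum>k\<in>K. c k * \<psi> k x))\<^sup>2 \<le> (\<Sum>k\<in>K. (cmod (c k))\<^sup>2))"

lemma besselD:
  assumes "bessel \<psi>"
  shows "\<psi> k \<in> L2"
    and "finite K \<Longrightarrow> (L2_norm (\<lambda>x. \<Sum>k\<in>K. c k * \<psi> k x))\<^sup>2 \<le> (\<Sum>k\<in>K. (cmod (c k))\<^sup>2)"
  using assms by (auto simp: bessel_def)

text \<open>With \<open>g\<close> the partial sum, \<open>S\<close> is the inner product of
  \<open>f\<close> and \<open>g\<close>. Cauchy-Schwarz and the synthesis bound give
  \<open>S\<^sup>2 \<le> (L2_norm f)\<^sup>2 * S\<close>, and \<open>S\<close> cancels.\<close>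

lemma bessel_coeff_le:
  assumes "bessel \<psi>" "f \<in> L2" "finite K"
  shows "(\<Sum>k\<in>K. (cmod (L2_inner f (\<psi> k)))\<^sup>2) \<le> (L2_norm f)\<^sup>2"
proof -
  note \<psi> = besselD[OF assms(1)]
  define S where "S = (\<Sum>k\<in>K. (cmod (L2_inner f (\<psi> k)))\<^sup>2)"
  define g where "g x = (\<Sum>k\<in>K. L2_inner f (\<psi> k) * \<psi> k x)" for x
  have S: "0 \<le> S"
    unfolding S_def by (intro sum_nonneg) auto
  have g: "g \<in> L2"
    unfolding g_def by (intro L2_sum L2_cmult \<psi>)
  have "L2_inner f g = of_real S"
    unfolding g_def S_def of_real_sum complex_norm_square using assms \<psi>(1)
    by (subst L2_inner_sum_right) (auto simp: L2_cmult L2_inner_cmult_right intro!: sum.cong mult.commute)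
  then have "S \<le> L2_norm f * L2_norm g"
    using L2_Cauchy_Schwarz[OF assms(2) g] S by simp
  then have "S\<^sup>2 \<le> (L2_norm f)\<^sup>2 * (L2_norm g)\<^sup>2"
    using S by (simp add: power_mono flip: power_mult_distrib)
  also have "\<dots> \<le> (L2_norm f)\<^sup>2 * S"
    unfolding g_def S_def by (intro mult_left_mono \<psi>(2) assms) auto
  finally have "S\<^sup>2 \<le> (L2_norm f)\<^sup>2 * S" .
  then show ?thesis
    unfolding S_def[symmetric] using S by (cases "S = 0") (auto simp: power2_eq_square)
qed

lemma bessel_sum_le:
  assumes "bessel \<psi>" "f \<in> L2" "finite K"
  shows "L2_norm (\<lambda>x. \<Sum>k\<in>K. L2_inner f (\<psi> k) * \<psi> k x) \<le> L2_norm f"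
  by (rule power2_le_imp_le[OF order_trans[OF besselD(2)[OF assms(1,3)] bessel_coeff_le[OF assms]] L2_norm_nonneg])

text \<open>The squared coefficients are summable, so the partial sums are Cauchy along the net of
  finite sets. \<open>L2_complete\<close> handles sequences, hence the detour through finite sets
  \<open>K n\<close> with tails at most \<open>((1/2) ^ n)\<^sup>2\<close>; the Cauchy estimate then
  carries the limit back to the net.\<close>

lemma bessel_has_sum:
  assumes "bessel \<psi>" "f \<in> L2"
  shows "\<exists>g. L2_has_sum (\<lambda>k x. L2_inner f (\<psi> k) * \<psi> k x) g"
proof -
  note \<psi> = besselD[OF assms(1)]
  define c where "c k = L2_inner f (\<psi> k)" for k
  define s where "s K x = (\<Sum>k\<in>K. c k * \<psi> k x)" for K x
  have s: "s K \<in> L2" for K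
    unfolding s_def by (intro L2_sum L2_cmult \<psi>)
  have "(\<lambda>k. (cmod (c k))\<^sup>2) summable_on UNIV"
    by (rule nonneg_bdd_above_summable_on)
      (auto intro!: bdd_aboveI2[where M = "(L2_norm f)\<^sup>2"] bessel_coeff_le assms simp: c_def)
  then obtain T where T: "((\<lambda>k. (cmod (c k))\<^sup>2) has_sum T) UNIV"
    by (auto simp: summable_on_def)
  have diff: "(L2_norm (\<lambda>x. s L x - s K x))\<^sup>2 \<le> T - (\<Sum>k\<in>K. (cmod (c k))\<^sup>2)" if "K \<subseteq> L" "finite L" for K L
  proof -
    have fin: "finite K" using that finite_subset by auto
    have "s L x - s K x = (\<Sum>k\<in>L - K. c k * \<psi> k x)" for x
      unfolding s_def using that fin by (simp add: sum_diff)
    then have "(L2_norm (\<lambda>x. s L x - s K x))\<^sup>2 \<le> (\<Sum>k\<in>L - K. (cmod (c k))\<^sup>2)"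
      using \<psi>(2) that by simp
    also have "\<dots> = (\<Sum>k\<in>L. (cmod (c k))\<^sup>2) - (\<Sum>k\<in>K. (cmod (c k))\<^sup>2)"
      using that fin by (simp add: sum_diff)
    also have "(\<Sum>k\<in>L. (cmod (c k))\<^sup>2) \<le> T"
      using has_sum_finite[OF that(2)] by (rule has_sum_mono2[OF _ T]) auto
    finally show ?thesis by simp
  qed
  have "\<exists>K. finite K \<and> T - (\<Sum>k\<in>K. (cmod (c k))\<^sup>2) \<le> e" if "0 < e" for e
  proof -
    have "eventually (\<lambda>K. dist (\<Sum>k\<in>K. (cmod (c k))\<^sup>2) T < e) (finite_subsets_at_top UNIV)"
      using T that unfolding has_sum_def by (rule tendstoD)
    then obtain K where "finite K" "dist (\<Sum>k\<in>K. (cmod (c k))\<^sup>2) T < e"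
      by (auto simp: eventually_finite_subsets_at_top)
    then show ?thesis
      by (intro exI[of _ K]) (auto simp: dist_real_def)
  qed
  then have "\<forall>n. \<exists>K. finite K \<and> T - (\<Sum>k\<in>K. (cmod (c k))\<^sup>2) \<le> ((1/2) ^ n)\<^sup>2"
    by simp
  then obtain K' where K': "\<And>n. finite (K' n)" "\<And>n. T - (\<Sum>k\<in>K' n. (cmod (c k))\<^sup>2) \<le> ((1/2) ^ n)\<^sup>2"
    by metis
  \<comment> \<open>Unions make the sets increasing, so that \<open>dist_le\<close> applies to
    consecutive ones.\<close>
  define K where "K n = (\<Union>i\<le>n. K' i)" for n
  have finK: "finite (K n)" for n
    unfolding K_def using K' by auto
  have dist_le: "L2_norm (\<lambda>x. s L x - s (K n) x) \<le> (1/2) ^ n" if "K n \<subseteq> L" "finite L" for n L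
  proof (rule power2_le_imp_le)
    have "(\<Sum>k\<in>K' n. (cmod (c k))\<^sup>2) \<le> (\<Sum>k\<in>K n. (cmod (c k))\<^sup>2)"
      using finK by (intro sum_mono2) (auto simp: K_def)
    then show "(L2_norm (\<lambda>x. s L x - s (K n) x))\<^sup>2 \<le> ((1/2) ^ n)\<^sup>2"
      using diff[OF that] K'(2)[of n] by linarith
  qed simp
  obtain g where g: "g \<in> L2" "(\<lambda>n. L2_norm (\<lambda>x. g x - s (K n) x)) \<longlonglongrightarrow> 0"
  proof (rule L2_complete[of "\<lambda>n. s (K n)"])
    show "L2_norm (\<lambda>x. s (K (Suc n)) x - s (K n) x) \<le> (1/2) ^ n" for n
      using finK by (intro dist_le) (force simp: K_def)+
  qed (auto intro: s)
  have "((\<lambda>K. L2_norm (\<lambda>x. g x - s K x)) \<longlongrightarrow> 0) (finite_subsets_at_top UNIV)"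
  proof (rule tendstoI)
    fix e :: real assume e: "0 < e"
    have "(\<lambda>n. L2_norm (\<lambda>x. g x - s (K n) x) + (1/2) ^ n) \<longlonglongrightarrow> 0 + 0"
      by (intro tendsto_add g LIMSEQ_realpow_zero) auto
    then have "eventually (\<lambda>n. L2_norm (\<lambda>x. g x - s (K n) x) + (1/2) ^ n < e) sequentially"
      using e by (intro order_tendstoD(2)) auto
    then obtain n where n: "L2_norm (\<lambda>x. g x - s (K n) x) + (1/2) ^ n < e"
      by (auto simp: eventually_sequentially)
    have "L2_norm (\<lambda>x. g x - s L x) < e" if "K n \<subseteq> L" "finite L" for L
      using L2_dist_triangle[OF g(1) s[of "K n"] s[of L]] L2_norm_minus_commute[of "s (K n)" "s L"]
        dist_le[OF that] n by linarith
    then show "eventually (\<lambda>L. dist (L2_norm (\<lambda>x. g x - s L x)) 0 < e) (finite_subsets_at_top UNIV)"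
      unfolding eventually_finite_subsets_at_top using finK
      by (intro exI[of _ "K n"]) (auto simp: L2_norm_nonneg)
  qed
  then have "L2_has_sum (\<lambda>k x. c k * \<psi> k x) g"
    unfolding L2_has_sum_def using g(1) L2_cmult \<psi>(1) by (auto simp: s_def)
  then show ?thesis
    by (auto simp: c_def)
qed

section \<open>Fourier series\<close>

definition wave :: "real \<Rightarrow> real \<Rightarrow> complex" where
  "wave s x = cis (2 * pi * s * x)"

lemma wave_0 [simp]: "wave 0 x = 1"
  by (simp add: wave_def)

lemma norm_wave [simp]: "cmod (wave s x) = 1"
  by (simp add: wave_def)

lemma wave_mult: "wave s x * wave t x = wave (s + t) x"
  by (simp add: wave_def cis_mult distrib_left distrib_right)

lemma cnj_wave: "cnj (wave s x) = wave (- s) x"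
  by (simp add: wave_def cis_cnj)

lemma wave_add: "wave s (x + y) = wave s x * wave s y"
  by (simp add: wave_def cis_mult distrib_left)

lemma wave_of_int: "wave (of_int j) (of_int k) = 1"
proof -
  have "2 * pi * real_of_int j * real_of_int k = 2 * pi * real_of_int (j * k)"
    by simp
  then show ?thesis
    unfolding wave_def by (metis cis_multiple_2pi Ints_of_int)
qed

lemma isCont_wave: "isCont (wave s) x"
  unfolding wave_def cis_conv_exp by (intro continuous_intros)

lemma measurable_wave [measurable]: "wave s \<in> borel_measurable borel"
  by (intro borel_measurable_continuous_onI continuous_at_imp_continuous_on ballI isCont_wave)

lemma fourier_eq_wave: "fourier f \<gamma> = (LINT t|lborel. f t * wave (- \<gamma>) t)"
  unfolding fourier_def wave_def cis_conv_exp by (intro Bochner_Integration.integral_cong refl) (simp add: mult_ac)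

section \<open>Exponentials on one period\<close>

abbreviation torus :: "real set" where "torus \<equiv> {-1/2..<1/2}"

text \<open>Cutting the exponential off outside one period lets the theory of Fourier series run
  inside \<open>L2\<close> of the whole line, without a second norm and inner product.\<close>

definition torus_wave :: "int \<Rightarrow> real \<Rightarrow> complex" where
  "torus_wave k x = indicator torus x * wave (of_int k) x"

lemma integral_torus_wave: "(LINT x|lborel. torus_wave k x) = (if k = 0 then 1 else 0)"
proof -
  define F where "F x = (if k = 0 then of_real x else wave (of_int k) x / (2 * pi * \<i> * of_int k))" for x
  have "(LINT x|lborel. torus_wave k x) = (LINT x|lborel. indicator {-1/2..1/2} x *\<^sub>R wave (of_int k) x)"
  proof (intro integral_cong_AE)
    show "torus_wave k \<in> borel_measurable lborel"
      unfolding torus_wave_def by measurable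
    show "AE x in lborel. torus_wave k x = indicator {-1/2..1/2} x *\<^sub>R wave (of_int k) x"
      using AE_lborel_singleton[of "1/2 :: real"] by eventually_elim (auto simp: torus_wave_def indicator_def)
  qed measurable
  also have "\<dots> = F (1/2) - F (-1/2)"
  proof (rule integral_FTC_Icc)
    fix x :: real
    have "((\<lambda>x. cis (2 * pi * of_int k * x)) has_vector_derivative
        (2 * pi * \<i> * of_int k) * cis (2 * pi * of_int k * x)) (at x within {-1/2..1/2})"
    proof -
      have "((\<lambda>z. exp (2 * pi * \<i> * of_int k * z)) has_field_derivative
          (2 * pi * \<i> * of_int k) * exp (2 * pi * \<i> * of_int k * of_real x)) (at (of_real x))"
        by (rule derivative_eq_intros refl | simp)+
      from has_vector_derivative_real_field[OF this] show ?thesis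
        unfolding cis_conv_exp by (simp add: mult_ac)
    qed
    then show "(F has_vector_derivative wave (of_int k) x) (at x within {-1/2..1/2})"
      by (cases "k = 0")
        (auto simp: F_def[abs_def] wave_def intro!: derivative_eq_intros has_vector_derivative_of_real)
  qed (auto intro!: continuous_at_imp_continuous_on isCont_wave)
  also have "\<dots> = (if k = 0 then 1 else 0)"
  proof -
    have "wave (of_int k) (1/2) = wave (of_int k) (- 1/2)"
      using wave_add[of "of_int k" "-1/2" "of_int 1"] unfolding wave_of_int by simp
    then show ?thesis by (simp add: F_def)
  qed
  finally show ?thesis .
qed

lemma measurable_torus_wave [measurable]: "torus_wave k \<in> borel_measurable borel"
  unfolding torus_wave_def by measurable

lemma L2_torus: "(\<lambda>x. indicator torus x :: complex) \<in> L2"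
proof (rule L2I)
  have "(\<lambda>x. (cmod (indicator torus x))\<^sup>2) = (indicator torus :: real \<Rightarrow> real)"
    by (auto simp: indicator_def)
  then show "integrable lborel (\<lambda>x. (cmod (indicator torus x))\<^sup>2)"
    by simp
qed measurable

lemma L2_bounded_torus:
  assumes "p \<in> borel_measurable borel" "\<And>x. cmod (p x) \<le> M"
  shows "(\<lambda>x. indicator torus x * p x) \<in> L2"
  by (rule L2_mono(1)[OF L2_cmult[OF L2_torus, of "of_real M"]])
    (use assms in \<open>auto simp: indicator_def intro!: AE_I2 order_trans[OF _ abs_ge_self]\<close>)

lemma L2_torus_wave: "torus_wave k \<in> L2"
  unfolding torus_wave_def[abs_def] by (rule L2_bounded_torus[where M = 1]) auto

lemma torus_wave_orthonormal: "L2_inner (torus_wave j) (torus_wave k) = (if j = k then 1 else 0)"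
proof -
  have "torus_wave j x * cnj (torus_wave k x) = torus_wave (j - k) x" for x
    by (auto simp: torus_wave_def indicator_def cnj_wave wave_mult)
  then show ?thesis
    by (simp add: L2_inner_def integral_torus_wave)
qed

text \<open>Pythagoras with the square completed. It shows that the Fourier coefficients minimise
  the left side, that at them this is the defect in Bessel's inequality, and, for
  \<open>f = 0\<close>, it gives the norm of a trigonometric sum.\<close>

lemma torus_wave_expand:
  assumes "finite K" "f \<in> L2"
  shows "(L2_norm (\<lambda>x. f x - (\<Sum>k\<in>K. c k * torus_wave k x)))\<^sup>2
    = (L2_norm f)\<^sup>2 - (\<Sum>k\<in>K. (cmod (L2_inner f (torus_wave k)))\<^sup>2)
      + (\<Sum>k\<in>K. (cmod (L2_inner f (torus_wave k) - c k))\<^sup>2)"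
  using assms(1)
proof (induction K)
  case (insert j K)
  define g where "g x = f x - (\<Sum>k\<in>K. c k * torus_wave k x)" for x
  have L: "(\<lambda>x. \<Sum>k\<in>K. c k * torus_wave k x) \<in> L2"
    by (intro L2_sum L2_cmult L2_torus_wave)
  have g: "g \<in> L2"
    unfolding g_def by (intro L2_diff assms L)
  have ip: "L2_inner g (torus_wave j) = L2_inner f (torus_wave j)"
  proof -
    have "L2_inner (torus_wave j) (\<lambda>x. \<Sum>k\<in>K. c k * torus_wave k x) = 0"
      using insert.hyps
      by (subst L2_inner_sum_right)
        (auto simp: L2_torus_wave L2_cmult L2_inner_cmult_right torus_wave_orthonormal intro!: sum.neutral)
    then have "L2_inner (\<lambda>x. \<Sum>k\<in>K. c k * torus_wave k x) (torus_wave j) = 0"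
      by (subst L2_inner_commute) simp
    then show ?thesis
      unfolding g_def by (subst L2_inner_diff_left) (auto simp: assms L L2_torus_wave)
  qed
  have one: "L2_norm (torus_wave j) = 1"
  proof -
    have "of_real ((L2_norm (torus_wave j))\<^sup>2) = (1 :: complex)"
      unfolding L2_inner_self[symmetric] torus_wave_orthonormal by simp
    then show ?thesis
      using L2_norm_nonneg[of "torus_wave j"] by (simp only: of_real_eq_1_iff) (simp add: power2_eq_1_iff)
  qed
  have sq: "- 2 * Re (cnj a * b) + (cmod a)\<^sup>2 = (cmod (b - a))\<^sup>2 - (cmod b)\<^sup>2" for a b
    by (simp add: cmod_power2 power2_diff algebra_simps)
  have "(L2_norm (\<lambda>x. f x - (\<Sum>k\<in>insert j K. c k * torus_wave k x)))\<^sup>2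
      = (L2_norm (\<lambda>x. g x - c j * torus_wave j x))\<^sup>2"
    using insert.hyps by (simp add: g_def algebra_simps)
  also have "\<dots> = (L2_norm g)\<^sup>2 - 2 * Re (cnj (c j) * L2_inner f (torus_wave j)) + (cmod (c j))\<^sup>2"
    by (simp add: L2_norm_diff_sq g L2_cmult L2_torus_wave L2_inner_cmult_right ip L2_norm_cmult one
        del: times_complex.sel)
  also have "\<dots> = (L2_norm g)\<^sup>2 + ((cmod (L2_inner f (torus_wave j) - c j))\<^sup>2 - (cmod (L2_inner f (torus_wave j)))\<^sup>2)"
    unfolding sq[symmetric] by simp
  also have "g = (\<lambda>x. f x - (\<Sum>k\<in>K. c k * torus_wave k x))"
    by (simp add: g_def fun_eq_iff)
  finally show ?case
    using insert by simp
qed simp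

lemma L2_norm_trig_sum:
  assumes "finite K"
  shows "(L2_norm (\<lambda>x. \<Sum>k\<in>K. c k * torus_wave k x))\<^sup>2 = (\<Sum>k\<in>K. (cmod (c k))\<^sup>2)"
proof -
  have "L2_norm (\<lambda>x. - (\<Sum>k\<in>K. c k * torus_wave k x)) = L2_norm (\<lambda>x. \<Sum>k\<in>K. c k * torus_wave k x)"
    by (simp add: L2_norm_def)
  moreover have "L2_inner (\<lambda>x. 0) g = 0" for g
    by (simp add: L2_inner_def)
  ultimately show ?thesis
    using torus_wave_expand[OF assms L2_zero, of c] by simp
qed

section \<open>Density of trigonometric polynomials\<close>

definition trig :: "(real \<Rightarrow> complex) \<Rightarrow> bool" where
  "trig p \<longleftrightarrow> (\<exists>K c. finite K \<and> p = (\<lambda>x. \<Sum>k\<in>K. c k * wave (of_int k) x))"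

lemma trig_wave: "trig (\<lambda>x. c * wave (of_int k) x)"
  unfolding trig_def by (intro exI[of _ "{k}"] exI[of _ "\<lambda>_. c"]) auto

lemma trig_const: "trig (\<lambda>x. c)"
  using trig_wave[of c 0] by simp

lemma trig_add:
  assumes "trig p" "trig q"
  shows "trig (\<lambda>x. p x + q x)"
proof -
  obtain K c where K: "finite K" "p = (\<lambda>x. \<Sum>k\<in>K. c k * wave (of_int k) x)"
    using assms by (auto simp: trig_def)
  obtain L d where L: "finite L" "q = (\<lambda>x. \<Sum>k\<in>L. d k * wave (of_int k) x)"
    using assms by (auto simp: trig_def)
  have 1: "p x = (\<Sum>k\<in>K \<union> L. (if k \<in> K then c k else 0) * wave (of_int k) x)" for x
    unfolding K(2) using K(1) L(1) by (intro sum.mono_neutral_cong_left) auto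
  have 2: "q x = (\<Sum>k\<in>K \<union> L. (if k \<in> L then d k else 0) * wave (of_int k) x)" for x
    unfolding L(2) using K(1) L(1) by (intro sum.mono_neutral_cong_left) auto
  have "p x + q x = (\<Sum>k\<in>K \<union> L. ((if k \<in> K then c k else 0) + (if k \<in> L then d k else 0)) * wave (of_int k) x)" for x
    unfolding 1 2 sum.distrib[symmetric] distrib_right[symmetric] ..
  then show ?thesis
    unfolding trig_def using K(1) L(1)
    by (intro exI[of _ "K \<union> L"] exI[of _ "\<lambda>k. (if k \<in> K then c k else 0) + (if k \<in> L then d k else 0)"])
      simp
qed

lemma trig_sum: "(\<And>i. i \<in> A \<Longrightarrow> trig (p i)) \<Longrightarrow> trig (\<lambda>x. \<Sum>i\<in>A. p i x)"
  by (induction A rule: infinite_finite_induct) (auto intro: trig_add trig_const)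

lemma trig_mult:
  assumes "trig p" "trig q"
  shows "trig (\<lambda>x. p x * q x)"
proof -
  obtain K c where K: "finite K" "p = (\<lambda>x. \<Sum>k\<in>K. c k * wave (of_int k) x)"
    using assms by (auto simp: trig_def)
  obtain L d where L: "finite L" "q = (\<lambda>x. \<Sum>k\<in>L. d k * wave (of_int k) x)"
    using assms by (auto simp: trig_def)
  have "p x * q x = (\<Sum>k\<in>K. \<Sum>j\<in>L. (c k * d j) * wave (of_int (k + j)) x)" for x
    unfolding K(2) L(2) sum_product
    by (intro sum.cong refl) (simp add: wave_mult[symmetric] mult_ac)
  then show ?thesis
    by (simp only:) (intro trig_sum trig_wave)
qed

text \<open>Cosine and sine are combinations of the frequencies 1 and -1. This turns
  Stone-Weierstrass on the circle into approximation by trigonometric polynomials.\<close>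

lemma trig_real_polynomial:
  assumes "real_polynomial_function (P :: complex \<Rightarrow> real)"
  shows "trig (\<lambda>x. of_real (P (wave 1 x)))"
  using assms
proof (induction P rule: real_polynomial_function.induct)
  case (linear f)
  then have lin: "linear f"
    by (rule bounded_linear.linear)
  have "f z = Re z * f 1 + Im z * f \<i>" for z
  proof -
    have "z = Re z *\<^sub>R 1 + Im z *\<^sub>R \<i>"
      by (simp add: complex_eq_iff)
    then have "f z = f (Re z *\<^sub>R 1 + Im z *\<^sub>R \<i>)"
      by (rule arg_cong)
    also have "\<dots> = Re z * f 1 + Im z * f \<i>"
      by (simp only: linear_add[OF lin] linear_scale[OF lin] real_scaleR_def)
    finally show ?thesis .
  qed
  then have "of_real (f (wave 1 x)) = of_real (Re (wave 1 x)) * of_real (f 1)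
      + of_real (Im (wave 1 x)) * (of_real (f \<i>) :: complex)" for x
    by (metis of_real_add of_real_mult)
  moreover have "of_real (Re (wave 1 x)) = 1/2 * wave (of_int 1) x + 1/2 * wave (of_int (-1)) x"
    "of_real (Im (wave 1 x)) = (- \<i>/2) * wave (of_int 1) x + (\<i>/2) * wave (of_int (-1)) x" for x
    by (auto simp: wave_def complex_eq_iff)
  ultimately have eq: "of_real (f (wave 1 x)) = (1/2 * wave (of_int 1) x + 1/2 * wave (of_int (-1)) x) * of_real (f 1)
      + ((- \<i>/2) * wave (of_int 1) x + (\<i>/2) * wave (of_int (-1)) x) * of_real (f \<i>)" for x
    by (simp only:)
  show ?case
    unfolding eq by (intro trig_add trig_mult trig_const trig_wave)
next
  case (const c)
  then show ?case by (simp add: trig_const)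
next
  case (add f g)
  then show ?case by (simp add: trig_add)
next
  case (mult f g)
  then show ?case by (simp add: trig_mult)
qed

lemma trig_polynomial:
  assumes "polynomial_function (P :: complex \<Rightarrow> complex)"
  shows "trig (\<lambda>x. P (wave 1 x))"
proof -
  have "trig (\<lambda>x. of_real ((Re \<circ> P) (wave 1 x)))" "trig (\<lambda>x. of_real ((Im \<circ> P) (wave 1 x)))"
    using assms bounded_linear_Re bounded_linear_Im unfolding polynomial_function_def
    by (blast intro: trig_real_polynomial)+
  then have "trig (\<lambda>x. of_real ((Re \<circ> P) (wave 1 x)) + \<i> * of_real ((Im \<circ> P) (wave 1 x)))"
    by (intro trig_add trig_mult trig_const)
  then show ?thesis
    by (simp add: complex_eq[symmetric])
qed

lemma trig_measurable: "trig p \<Longrightarrow> p \<in> borel_measurable borel"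
  by (auto simp: trig_def)

text \<open>The radial retraction onto the disc of radius \<open>M\<close>. Continuous approximants
  of a bounded function need not be bounded, while dominated convergence needs a common
  bound.\<close>

definition clip :: "real \<Rightarrow> complex \<Rightarrow> complex" where
  "clip M w = of_real (M / max M (cmod w)) * w"

lemma clip:
  assumes "0 < M"
  shows "cmod (clip M w) \<le> M" "cmod w \<le> M \<Longrightarrow> clip M w = w" "continuous_on A (clip M)"
proof -
  show "cmod (clip M w) \<le> M"
  proof (cases "cmod w \<le> M")
    case False
    then show ?thesis
      using assms by (simp add: clip_def norm_mult norm_divide max_def)
  qed (use assms in \<open>auto simp: clip_def max_def\<close>)
  show "clip M w = w" if "cmod w \<le> M"
    using that assms by (simp add: clip_def max_def)
  show "continuous_on A (clip M)"
    unfolding clip_def using assms by (intro continuous_intros) (auto simp: max_def)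
qed

text \<open>A measurable function is almost everywhere a limit of continuous ones. These are
  clipped, carried to the unit circle by \<open>Arg\<close>, made continuous at \<open>-1\<close>,
  and approximated there uniformly by polynomials to within \<open>1 / (n + 1) \<le> 1\<close>,
  which explains \<open>M + 1\<close>.\<close>

lemma bounded_trig_approx:
  assumes f: "f \<in> borel_measurable borel" "\<And>x. cmod (f x) \<le> M" and M: "0 < M"
  obtains t where "\<And>n. trig (t n)" "\<And>n x. cmod (t n x) \<le> M + 1"
    "AE x in lborel. x \<in> torus \<longrightarrow> (\<lambda>n. t n x) \<longlonglongrightarrow> f x"
proof -
  have "f measurable_on UNIV"
    using f(1) by (intro lebesgue_measurable_imp_measurable_on) (auto intro: measurable_completion)
  then obtain N g where N: "negligible N" and g: "\<And>n. continuous_on UNIV (g n :: real \<Rightarrow> complex)"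
    and lim: "\<And>x. x \<notin> N \<Longrightarrow> (\<lambda>n. g n x) \<longlonglongrightarrow> f x"
    unfolding measurable_on_def by auto
  \<comment> \<open>\<open>Arg\<close> jumps at \<open>-1\<close>, the one point of the circle on
    its branch cut. The first factor vanishes there and equals 1 for large \<open>n\<close> at any
    other point.\<close>
  define q where "q n z = of_real (min 1 (real n * cmod (z + 1))) * clip M (g n (Arg z / (2 * pi)))" for n :: nat and z
  have q_le: "cmod (q n z) \<le> M" for n z
  proof -
    have "cmod (q n z) \<le> 1 * M"
      unfolding q_def norm_mult using clip[OF M] by (intro mult_mono) auto
    then show ?thesis by simp
  qed
  have q_cont: "continuous_on (sphere 0 1) (q n)" for n
  proof (rule continuous_at_imp_continuous_on, rule ballI)
    fix z :: complex assume z: "z \<in> sphere 0 1"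
    show "isCont (q n) z"
    proof (cases "z = -1")
      case True
      have "q n z = 0"
        using True by (simp add: q_def)
      moreover have "(q n \<longlongrightarrow> 0) (at z)"
      proof (rule Lim_null_comparison)
        have "((\<lambda>z. real n * cmod (z + 1) * M) \<longlongrightarrow> real n * cmod (z + 1) * M) (at z)"
          by (intro tendsto_intros)
        then show "((\<lambda>z. real n * cmod (z + 1) * M) \<longlongrightarrow> 0) (at z)"
          using True by simp
        have "cmod (q n w) \<le> real n * cmod (w + 1) * M" for w
          unfolding q_def norm_mult using clip[OF M] by (intro mult_mono) auto
        then show "eventually (\<lambda>w. cmod (q n w) \<le> real n * cmod (w + 1) * M) (at z)"
          by (intro always_eventually allI)
      qed
      ultimately show ?thesis
        by (simp add: isCont_def)
    next
      case False
      have "z \<notin> \<real>\<^sub>\<le>\<^sub>0"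
      proof
        assume "z \<in> \<real>\<^sub>\<le>\<^sub>0"
        then obtain r where "z = of_real r" "r \<le> 0"
          by (auto elim: nonpos_Reals_cases)
        then show False
          using z False by auto
      qed
      then have a: "isCont (\<lambda>z. Arg z / (2 * pi)) z"
        using continuous_at_Arg by (intro continuous_intros) auto
      have b: "isCont (g n) x" for x
        using g[of n] by (simp add: continuous_on_eq_continuous_at)
      have c: "isCont (clip M) w" for w
        using clip(3)[OF M, of UNIV] by (simp add: continuous_on_eq_continuous_at)
      have "isCont (\<lambda>z. clip M (g n (Arg z / (2 * pi)))) z"
        by (rule isCont_o2[OF isCont_o2[OF a b] c])
      then show ?thesis
        unfolding q_def by (intro continuous_intros)
    qed
  qed
  have "\<exists>p. polynomial_function p \<and> (\<forall>z\<in>sphere 0 1. cmod (q n z - p z) < 1 / real (Suc n))" for n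
    using q_cont by (intro Stone_Weierstrass_polynomial_function) auto
  then obtain p where p: "\<And>n. polynomial_function (p n)"
    "\<And>n z. z \<in> sphere 0 1 \<Longrightarrow> cmod (q n z - p n z) < 1 / real (Suc n)"
    by metis
  have near: "cmod (q n (wave 1 x) - p n (wave 1 x)) < 1 / real (Suc n)" for n x
    by (rule p(2)) simp
  show ?thesis
  proof
    show "trig (\<lambda>x. p n (wave 1 x))" for n
      by (intro trig_polynomial p)
    show "cmod (p n (wave 1 x)) \<le> M + 1" for n x
    proof -
      have "1 / real (Suc n) \<le> 1" by simp
      then show ?thesis
        using near[of n x] q_le[of n "wave 1 x"] norm_triangle_ineq3[of "q n (wave 1 x)" "p n (wave 1 x)"]
        by linarith
    qed
    have "AE x in lborel. x \<notin> N"
      using N by (metis AE_not_in negligible_iff_null_sets AE_completion_iff)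
    then show "AE x in lborel. x \<in> torus \<longrightarrow> (\<lambda>n. p n (wave 1 x)) \<longlonglongrightarrow> f x"
      \<comment> \<open>The end point \<open>-1/2\<close> is sent to \<open>-1\<close>, where the
        cut-off never becomes 1; it is dropped as a null set.\<close>
      using AE_lborel_singleton[of "-1/2 :: real"]
    proof eventually_elim
      case (elim x)
      show ?case
      proof
        assume "x \<in> torus"
        then have x: "-1/2 < x" "x < 1/2"
          using elim by auto
        have "2 * pi * x \<in> {- pi<..pi}"
          using x mult_strict_left_mono[of "-1/2" x "2 * pi"] mult_strict_left_mono[of x "1/2" "2 * pi"] by auto
        then have arg: "Arg (wave 1 x) / (2 * pi) = x"
          unfolding wave_def by (subst Arg_cis) auto
        have ne: "wave 1 x + 1 \<noteq> 0"
        proof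
          assume "wave 1 x + 1 = 0"
          then have "wave 1 x = -1"
            by (simp add: eq_neg_iff_add_eq_0)
          then have "Arg (wave 1 x) = pi"
            using Arg_cis[of pi] by simp
          then show False
            using arg x by simp
        qed
        have "eventually (\<lambda>n. real n * cmod (wave 1 x + 1) \<ge> 1) sequentially"
        proof -
          obtain n0 where "1 / cmod (wave 1 x + 1) \<le> real n0"
            using real_arch_simple by blast
          then have "1 \<le> real n * cmod (wave 1 x + 1)" if "n0 \<le> n" for n
            using ne that by (simp add: divide_le_eq) (meson mult_right_mono norm_ge_zero of_nat_mono order_trans)
          then show ?thesis
            by (auto simp: eventually_sequentially)
        qed
        then have "eventually (\<lambda>n. clip M (g n x) = q n (wave 1 x)) sequentially"
          by eventually_elim (simp add: q_def arg min_def)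
        moreover have "(\<lambda>n. clip M (g n x)) \<longlonglongrightarrow> clip M (f x)"
          using clip(3)[OF M, of UNIV] lim elim(1) by (auto intro: continuous_on_tendsto_compose)
        ultimately have "(\<lambda>n. q n (wave 1 x)) \<longlonglongrightarrow> f x"
          using clip(2)[OF M f(2)] by (auto elim: Lim_transform_eventually)
        moreover have "(\<lambda>n. q n (wave 1 x) - p n (wave 1 x)) \<longlonglongrightarrow> 0"
          by (rule Lim_null_comparison[OF _ LIMSEQ_Suc[OF lim_1_over_n]])
            (intro always_eventually allI less_imp_le near)
        ultimately have "(\<lambda>n. q n (wave 1 x) - (q n (wave 1 x) - p n (wave 1 x))) \<longlonglongrightarrow> f x - 0"
          by (rule tendsto_diff)
        then show "(\<lambda>n. p n (wave 1 x)) \<longlonglongrightarrow> f x"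
          by simp
      qed
    qed
  qed
qed

lemma L2_dominated_limit:
  assumes "\<And>n. h n \<in> borel_measurable borel" "w \<in> L2" "\<And>n x. cmod (h n x) \<le> cmod (w x)"
    and "AE x in lborel. (\<lambda>n. h n x) \<longlonglongrightarrow> 0"
  shows "(\<lambda>n. L2_norm (h n)) \<longlonglongrightarrow> 0"
proof -
  have "(\<lambda>n. LINT x|lborel. (cmod (h n x))\<^sup>2) \<longlonglongrightarrow> (LINT x|(lborel :: real measure). 0)"
  proof (rule integral_dominated_convergence[where w = "\<lambda>x. (cmod (w x))\<^sup>2"])
    show "integrable lborel (\<lambda>x. (cmod (w x))\<^sup>2)"
      by (rule L2_integrable[OF assms(2)])
    show "AE x in lborel. (\<lambda>n. (cmod (h n x))\<^sup>2) \<longlonglongrightarrow> 0"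
      using assms(4) by eventually_elim (auto intro!: tendsto_eq_intros)
  qed (use assms in \<open>auto intro!: AE_I2 power_mono\<close>)
  then have "(\<lambda>n. sqrt (LINT x|lborel. (cmod (h n x))\<^sup>2)) \<longlonglongrightarrow> sqrt 0"
    by (intro tendsto_real_sqrt) simp
  then show ?thesis
    by (simp add: L2_norm_def)
qed

text \<open>Large values are cut off first, then the bounded remainder is approximated; dominated
  convergence turns both pointwise limits into L2 limits.\<close>

lemma trig_dense:
  assumes f: "f \<in> L2" "\<And>x. x \<notin> torus \<Longrightarrow> f x = 0" and e: "0 < e"
  obtains p where "trig p" "L2_norm (\<lambda>x. f x - indicator torus x * p x) < e"
proof -
  note [measurable] = L2_measurable[OF f(1)]
  define h where "h n x = f x - (if cmod (f x) \<le> real n then f x else 0)" for n x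
  have [measurable]: "h n \<in> borel_measurable borel" for n
    unfolding h_def by measurable
  have "(\<lambda>n. L2_norm (h n)) \<longlonglongrightarrow> 0"
  proof (rule L2_dominated_limit[OF _ f(1)])
    show "AE x in lborel. (\<lambda>n. h n x) \<longlonglongrightarrow> 0"
    proof (rule AE_I2)
      fix x
      obtain n0 where "cmod (f x) \<le> real n0"
        using real_arch_simple by blast
      then have "eventually (\<lambda>n. h n x = 0) sequentially"
        unfolding eventually_sequentially h_def by (intro exI[of _ n0]) auto
      then show "(\<lambda>n. h n x) \<longlonglongrightarrow> 0"
        by (rule tendsto_eventually)
    qed
  qed (auto simp: h_def)
  then have "eventually (\<lambda>n. L2_norm (h n) < e / 2) sequentially"
    using e by (intro order_tendstoD) auto
  then obtain n where n: "L2_norm (h n) < e / 2"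
    by (auto simp: eventually_sequentially)
  define b where "b x = f x - h n x" for x
  \<comment> \<open>The bound is \<open>n + 1\<close> rather than \<open>n\<close> so that it is
    positive for \<open>n = 0\<close> too.\<close>
  have b: "b \<in> borel_measurable borel" "\<And>x. cmod (b x) \<le> real n + 1"
    unfolding b_def by (auto simp: h_def)
  have b0: "b x = indicator torus x * b x" for x
    using f(2)[of x] by (auto simp: b_def h_def indicator_def)
  obtain t where t: "\<And>n. trig (t n)" "\<And>m x. cmod (t m x) \<le> (real n + 1) + 1"
    "AE x in lborel. x \<in> torus \<longrightarrow> (\<lambda>n. t n x) \<longlonglongrightarrow> b x"
    by (rule bounded_trig_approx[OF b]) auto
  have bL2: "b \<in> L2"
    using L2_bounded_torus[OF b] b0 by (metis (no_types, lifting) ext)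
  have pL2: "(\<lambda>x. indicator torus x * t m x) \<in> L2" for m
    by (rule L2_bounded_torus[OF trig_measurable[OF t(1)] t(2)])
  have "(\<lambda>m. L2_norm (\<lambda>x. b x - indicator torus x * t m x)) \<longlonglongrightarrow> 0"
  \<comment> \<open>\<open>2 * n + 3\<close> is the sum of the bounds \<open>n + 1\<close> on
    \<open>b\<close> and \<open>n + 2\<close> on the approximants.\<close>
  proof (rule L2_dominated_limit[OF _ L2_cmult[OF L2_torus, of "of_real (2 * real n + 3)"]])
    show "(\<lambda>x. b x - indicator torus x * t m x) \<in> borel_measurable borel" for m
      using trig_measurable[OF t(1)[of m]] b(1) by measurable
    show "cmod (b x - indicator torus x * t m x) \<le> cmod (of_real (2 * real n + 3) * indicator torus x)" for m x
    proof (cases "x \<in> torus")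
      case True
      have "cmod (b x - t m x) \<le> (real n + 1) + (real n + 1 + 1)"
        using norm_triangle_ineq4[of "b x" "t m x"] b(2)[of x] t(2)[of m x] by linarith
      also have "\<dots> = cmod (of_real (2 * real n + 3))"
        unfolding norm_of_real by simp
      finally show ?thesis
        using True by simp
    qed (use b0[of x] in auto)
    show "AE x in lborel. (\<lambda>m. b x - indicator torus x * t m x) \<longlonglongrightarrow> 0"
      using t(3)
    proof eventually_elim
      case (elim x)
      show ?case
      proof (cases "x \<in> torus")
        case True
        then show ?thesis
          using tendsto_diff[OF tendsto_const elim[rule_format, OF True], of "b x"] by simp
      qed (use b0[of x] in auto)
    qed
  qed
  then have "eventually (\<lambda>m. L2_norm (\<lambda>x. b x - indicator torus x * t m x) < e / 2) sequentially"
    using e by (intro order_tendstoD) auto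
  then obtain m where m: "L2_norm (\<lambda>x. b x - indicator torus x * t m x) < e / 2"
    by (auto simp: eventually_sequentially)
  have "L2_norm (\<lambda>x. f x - indicator torus x * t m x)
      \<le> L2_norm (\<lambda>x. f x - b x) + L2_norm (\<lambda>x. b x - indicator torus x * t m x)"
    by (rule L2_dist_triangle[OF f(1) bL2 pL2])
  also have "\<dots> < e"
    using n m by (simp add: b_def)
  finally show ?thesis
    by (rule that[OF t(1)])
qed

section \<open>Convergence of Fourier series and Parseval's identity\<close>

text \<open>Best approximation: once \<open>K\<close> contains the frequencies of a trigonometric
  polynomial close to \<open>f\<close>, the partial sum over \<open>K\<close> is at least as close.
  No order of summation enters, so the limit holds along all finite sets.\<close>

lemma fourier_series_tendsto:
  assumes f: "f \<in> L2" "\<And>x. x \<notin> torus \<Longrightarrow> f x = 0"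
  shows "((\<lambda>K. L2_norm (\<lambda>x. f x - (\<Sum>k\<in>K. L2_inner f (torus_wave k) * torus_wave k x))) \<longlongrightarrow> 0)
    (finite_subsets_at_top UNIV)"
proof (rule tendstoI)
  fix e :: real assume "0 < e"
  obtain p where p: "trig p" "L2_norm (\<lambda>x. f x - indicator torus x * p x) < e"
    using trig_dense[OF f \<open>0 < e\<close>] .
  obtain L c where L: "finite L" "p = (\<lambda>x. \<Sum>k\<in>L. c k * wave (of_int k) x)"
    using p(1) by (auto simp: trig_def)
  have best: "L2_norm (\<lambda>x. f x - (\<Sum>k\<in>K. L2_inner f (torus_wave k) * torus_wave k x)) < e"
    if "L \<subseteq> K" "finite K" for K
  proof -
    define d where "d k = (if k \<in> L then c k else 0)" for k
    have "(L2_norm (\<lambda>x. f x - (\<Sum>k\<in>K. L2_inner f (torus_wave k) * torus_wave k x)))\<^sup>2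
        \<le> (L2_norm (\<lambda>x. f x - (\<Sum>k\<in>K. d k * torus_wave k x)))\<^sup>2"
      unfolding torus_wave_expand[OF that(2) f(1)] by (simp add: sum_nonneg)
    then have "L2_norm (\<lambda>x. f x - (\<Sum>k\<in>K. L2_inner f (torus_wave k) * torus_wave k x))
        \<le> L2_norm (\<lambda>x. f x - (\<Sum>k\<in>K. d k * torus_wave k x))"
      by (rule power2_le_imp_le) (rule L2_norm_nonneg)
    moreover have eq: "(\<Sum>k\<in>K. d k * torus_wave k x) = indicator torus x * p x" for x
      unfolding L(2) sum_distrib_left using that
      by (intro sum.mono_neutral_cong_right) (auto simp: d_def torus_wave_def)
    ultimately show ?thesis
      using p(2) unfolding eq by linarith
  qed
  then show "eventually (\<lambda>K. dist (L2_norm (\<lambda>x. f x - (\<Sum>k\<in>K. L2_inner f (torus_wave k) * torus_wave k x))) 0 < e)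
      (finite_subsets_at_top UNIV)"
    unfolding eventually_finite_subsets_at_top using L(1)
    by (intro exI[of _ L]) (auto simp: L2_norm_nonneg)
qed

text \<open>The defect in Bessel's inequality is the squared error of the partial sum, which tends
  to 0. The \<open>count_space\<close> form fits the inner sum of
  \<open>nn_integral_periodize\<close>.\<close>

lemma parseval_torus:
  assumes f: "f \<in> L2" "\<And>x. x \<notin> torus \<Longrightarrow> f x = 0"
  shows "(\<integral>\<^sup>+k. ennreal ((cmod (L2_inner f (torus_wave k)))\<^sup>2) \<partial>count_space UNIV) = ennreal ((L2_norm f)\<^sup>2)"
    (is "?l = _")
proof (rule antisym)
  have eq: "(\<Sum>k\<in>K. (cmod (L2_inner f (torus_wave k)))\<^sup>2) = (L2_norm f)\<^sup>2
      - (L2_norm (\<lambda>x. f x - (\<Sum>k\<in>K. L2_inner f (torus_wave k) * torus_wave k x)))\<^sup>2" if "finite K" for K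
    unfolding torus_wave_expand[OF that f(1)] by simp
  show "?l \<le> ennreal ((L2_norm f)\<^sup>2)"
  proof (rule nn_integral_count_int_le)
    fix K :: "int set" assume "finite K"
    then show "(\<Sum>k\<in>K. ennreal ((cmod (L2_inner f (torus_wave k)))\<^sup>2)) \<le> ennreal ((L2_norm f)\<^sup>2)"
      by (subst sum_ennreal) (auto simp: eq intro!: ennreal_leI)
  qed
  have "((\<lambda>K. (L2_norm f)\<^sup>2 - (L2_norm (\<lambda>x. f x - (\<Sum>k\<in>K. L2_inner f (torus_wave k) * torus_wave k x)))\<^sup>2)
      \<longlongrightarrow> (L2_norm f)\<^sup>2 - 0\<^sup>2) (finite_subsets_at_top UNIV)"
    by (intro tendsto_intros fourier_series_tendsto f)
  then have "((\<lambda>K. ennreal ((L2_norm f)\<^sup>2 - (L2_norm (\<lambda>x. f x - (\<Sum>k\<in>K. L2_inner f (torus_wave k) * torus_wave k x)))\<^sup>2))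
      \<longlongrightarrow> ennreal ((L2_norm f)\<^sup>2)) (finite_subsets_at_top UNIV)"
    by (intro tendsto_ennrealI) simp
  then show "ennreal ((L2_norm f)\<^sup>2) \<le> ?l"
  proof (rule tendsto_upperbound)
    have "ennreal (\<Sum>k\<in>K. (cmod (L2_inner f (torus_wave k)))\<^sup>2) \<le> ?l" if "finite K" for K
    proof -
      have "ennreal (\<Sum>k\<in>K. (cmod (L2_inner f (torus_wave k)))\<^sup>2)
          = (\<integral>\<^sup>+k. ennreal ((cmod (L2_inner f (torus_wave k)))\<^sup>2) \<partial>count_space K)"
        using that by (simp add: nn_integral_count_space_finite sum_ennreal)
      also have "\<dots> = (\<integral>\<^sup>+k. ennreal ((cmod (L2_inner f (torus_wave k)))\<^sup>2) * indicator K k \<partial>count_space UNIV)"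
        by (rule nn_integral_count_space_indicator) simp
      also have "\<dots> \<le> ?l"
        by (intro nn_integral_mono) (auto simp: indicator_def)
      finally show ?thesis .
    qed
    then show "eventually (\<lambda>K. ennreal ((L2_norm f)\<^sup>2 - (L2_norm (\<lambda>x. f x
        - (\<Sum>k\<in>K. L2_inner f (torus_wave k) * torus_wave k x)))\<^sup>2) \<le> ?l) (finite_subsets_at_top UNIV)"
      unfolding eventually_finite_subsets_at_top by (intro exI[of _ "{}"]) (auto simp: eq[symmetric])
  qed simp
qed

section \<open>Plancherel's theorem\<close>

text \<open>Each \<open>x\<close> lies in exactly one integer translate of
  \<open>[-1/2, 1/2)\<close>, that of \<open>k = floor (x + 1/2)\<close>. Inserting this partition
  and exchanging sum and integral folds the line onto one period.\<close>

lemma nn_integral_periodize: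
  fixes h :: "real \<Rightarrow> ennreal"
  assumes [measurable]: "h \<in> borel_measurable borel"
  shows "(\<integral>\<^sup>+x. h x \<partial>lborel)
    = (\<integral>\<^sup>+u. indicator torus u * (\<integral>\<^sup>+k. h (u + real_of_int k) \<partial>count_space UNIV) \<partial>lborel)"
proof -
  have "(\<integral>\<^sup>+x. h x \<partial>lborel)
      = (\<integral>\<^sup>+x. \<integral>\<^sup>+k. indicator torus (x - real_of_int k) * h x \<partial>count_space UNIV \<partial>lborel)"
  proof (intro nn_integral_cong)
    fix x :: real
    define j where "j = \<lfloor>x + 1/2\<rfloor>"
    have "(\<integral>\<^sup>+k. indicator torus (x - real_of_int k) * h x \<partial>count_space UNIV)
        = (\<Sum>k\<in>{j}. indicator torus (x - real_of_int k) * h x)"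
    proof (rule nn_integral_count_space')
      fix k :: int assume "k \<notin> {j}"
      then have "x - real_of_int k \<notin> torus"
        using floor_unique[of k "x + 1/2"] by (auto simp: j_def)
      then show "indicator torus (x - real_of_int k) * h x = 0"
        using indicator_simps(2) by (metis mult_zero_left)
    qed auto
    moreover have "x - real_of_int j \<in> torus"
      unfolding j_def by auto linarith+
    ultimately show "h x = (\<integral>\<^sup>+k. indicator torus (x - real_of_int k) * h x \<partial>count_space UNIV)"
      by (simp only: sum.insert sum.empty indicator_simps finite.emptyI empty_iff not_False_eq_True mult_1 add_0_right)
  qed
  also have "\<dots> = (\<integral>\<^sup>+k. \<integral>\<^sup>+x. indicator torus (x - real_of_int k) * h x \<partial>lborel \<partial>count_space UNIV)"
    by (intro nn_integral_count_space_nn_integral) auto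
  also have "\<dots> = (\<integral>\<^sup>+k. \<integral>\<^sup>+u. indicator torus u * h (u + real_of_int k) \<partial>lborel \<partial>count_space UNIV)"
  proof (rule nn_integral_cong)
    fix k :: int
    show "(\<integral>\<^sup>+x. indicator torus (x - real_of_int k) * h x \<partial>lborel)
        = (\<integral>\<^sup>+u. indicator torus u * h (u + real_of_int k) \<partial>lborel)"
      by (subst nn_integral_real_affine[where c = 1 and t = "real_of_int k"]) (auto simp: add.commute)
  qed
  also have "\<dots> = (\<integral>\<^sup>+u. \<integral>\<^sup>+k. indicator torus u * h (u + real_of_int k) \<partial>count_space UNIV \<partial>lborel)"
    by (intro nn_integral_count_space_nn_integral[symmetric]) auto
  also have "\<dots> = (\<integral>\<^sup>+u. indicator torus u * (\<integral>\<^sup>+k. h (u + real_of_int k) \<partial>count_space UNIV) \<partial>lborel)"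
    by (intro nn_integral_cong nn_integral_cmult) auto
  finally show ?thesis .
qed

lemma measurable_fourier:
  assumes [measurable]: "f \<in> borel_measurable borel"
  shows "fourier f \<in> borel_measurable borel"
proof -
  have [measurable]: "cis \<in> borel_measurable borel"
    unfolding cis_conv_exp by (intro borel_measurable_continuous_onI continuous_intros)
  have "(\<lambda>(\<gamma>, t). f t * wave (- \<gamma>) t) \<in> borel_measurable (borel \<Otimes>\<^sub>M lborel)"
    unfolding wave_def by measurable
  then show ?thesis
    unfolding fourier_eq_wave[abs_def]
    by (intro lborel.borel_measurable_lebesgue_integral)
qed

text \<open>For fixed \<open>u\<close> the values \<open>fourier f (u + k)\<close> are the Fourier
  coefficients of \<open>wave (- u) * f\<close>, whose norm does not depend on \<open>u\<close>. By
  Parseval every shifted lattice has the same sum, and the shifts fill an interval of length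
  1.\<close>

lemma plancherel_torus:
  assumes f: "f \<in> L2" "\<And>x. x \<notin> torus \<Longrightarrow> f x = 0"
  shows "(\<integral>\<^sup>+\<gamma>. ennreal ((cmod (fourier f \<gamma>))\<^sup>2) \<partial>lborel) = ennreal ((L2_norm f)\<^sup>2)"
proof -
  note [measurable] = L2_measurable[OF f(1)] measurable_fourier[OF L2_measurable[OF f(1)]]
  have inner: "(\<integral>\<^sup>+k. ennreal ((cmod (fourier f (u + real_of_int k)))\<^sup>2) \<partial>count_space UNIV) = ennreal ((L2_norm f)\<^sup>2)" for u
  proof -
    define g where "g t = wave (- u) t * f t" for t
    have g: "g \<in> L2"
      unfolding g_def by (rule L2_bounded_mult[OF f(1)]) auto
    have "fourier f (u + real_of_int k) = L2_inner g (torus_wave k)" for k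
      unfolding fourier_eq_wave L2_inner_def
    proof (intro Bochner_Integration.integral_cong refl)
      fix t
      show "f t * wave (- (u + real_of_int k)) t = g t * cnj (torus_wave k t)"
        using f(2)[of t] wave_mult[of "-u" t "- real_of_int k"]
        by (cases "t \<in> torus") (auto simp: g_def torus_wave_def cnj_wave mult_ac)
    qed
    moreover have "L2_norm g = L2_norm f"
      by (simp add: L2_norm_def g_def norm_mult)
    ultimately show ?thesis
      using parseval_torus[OF g] f(2) by (auto simp: g_def)
  qed
  have "(\<integral>\<^sup>+\<gamma>. ennreal ((cmod (fourier f \<gamma>))\<^sup>2) \<partial>lborel)
      = (\<integral>\<^sup>+u. indicator torus u * ennreal ((L2_norm f)\<^sup>2) \<partial>lborel)"
    by (subst nn_integral_periodize) (auto simp: inner)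
  also have "\<dots> = ennreal ((L2_norm f)\<^sup>2)"
    by (subst nn_integral_multc) auto
  finally show ?thesis .
qed

section \<open>Dilations and translations\<close>

text \<open>Dilation by an arbitrary positive factor: \<open>2 powi n\<close> recovers
  \<open>dilation_pow n\<close>, while other factors squeeze a bounded support into one
  period.\<close>

definition dil :: "real \<Rightarrow> (real \<Rightarrow> complex) \<Rightarrow> real \<Rightarrow> complex" where
  "dil a f x = of_real (sqrt a) * f (a * x)"

lemma dil_dil: "0 < a \<Longrightarrow> 0 < b \<Longrightarrow> dil a (dil b f) = dil (a * b) f"
  by (auto simp: dil_def fun_eq_iff real_sqrt_mult mult_ac)

lemma dil_1 [simp]: "dil 1 f = f"
  by (simp add: dil_def fun_eq_iff)

lemma dil_diff: "dil a (\<lambda>x. f x - g x) = (\<lambda>x. dil a f x - dil a g x)"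
  by (simp add: dil_def fun_eq_iff algebra_simps)

lemma dil_sum: "dil a (\<lambda>x. \<Sum>k\<in>K. c k * f k x) = (\<lambda>x. \<Sum>k\<in>K. c k * dil a (f k) x)"
  by (simp add: dil_def fun_eq_iff sum_distrib_left mult_ac)

lemma nn_integral_dil:
  assumes [measurable]: "f \<in> borel_measurable borel" and a: "0 < a"
  shows "(\<integral>\<^sup>+x. ennreal ((cmod (dil a f x))\<^sup>2) \<partial>lborel) = (\<integral>\<^sup>+x. ennreal ((cmod (f x))\<^sup>2) \<partial>lborel)"
proof -
  have "(\<integral>\<^sup>+x. ennreal ((cmod (f x))\<^sup>2) \<partial>lborel) = ennreal \<bar>a\<bar> * (\<integral>\<^sup>+x. ennreal ((cmod (f (0 + a * x)))\<^sup>2) \<partial>lborel)"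
    using a by (intro nn_integral_real_affine) auto
  also have "\<dots> = (\<integral>\<^sup>+x. ennreal a * ennreal ((cmod (f (a * x)))\<^sup>2) \<partial>lborel)"
    using a by (subst nn_integral_cmult) auto
  also have "\<dots> = (\<integral>\<^sup>+x. ennreal ((cmod (dil a f x))\<^sup>2) \<partial>lborel)"
    using a by (intro nn_integral_cong)
      (simp add: dil_def norm_mult power_mult_distrib ennreal_mult[symmetric])
  finally show ?thesis ..
qed

lemma L2_dil:
  assumes "f \<in> L2" "0 < a"
  shows "dil a f \<in> L2" "L2_norm (dil a f) = L2_norm f"
proof -
  note [measurable] = L2_measurable[OF assms(1)]
  have m: "dil a f \<in> borel_measurable borel"
    unfolding dil_def by measurable
  have eq: "(\<integral>\<^sup>+x. ennreal ((cmod (dil a f x))\<^sup>2) \<partial>lborel) = ennreal ((L2_norm f)\<^sup>2)"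
    using nn_integral_L2[OF assms(1)] assms(2) by (subst nn_integral_dil) auto
  show L: "dil a f \<in> L2"
    unfolding L2_iff_nn_integral eq using m by simp
  show "L2_norm (dil a f) = L2_norm f"
    using eq unfolding nn_integral_L2[OF L] by (simp add: L2_norm_nonneg)
qed

lemma L2_inner_dil:
  assumes "0 < a"
  shows "L2_inner (dil a f) (dil a g) = L2_inner f g"
proof -
  have "L2_inner f g = \<bar>a\<bar> *\<^sub>R (LINT x|lborel. f (0 + a * x) * cnj (g (0 + a * x)))"
    unfolding L2_inner_def using assms by (intro lborel_integral_real_affine) auto
  also have "\<dots> = (LINT x|lborel. dil a f x * cnj (dil a g x))"
  proof -
    have "dil a f x * cnj (dil a g x) = of_real a * (f (0 + a * x) * cnj (g (0 + a * x)))" for x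
    proof -
      have "of_real (sqrt a) * of_real (sqrt a) = (of_real a :: complex)"
        using assms by (simp flip: of_real_mult)
      moreover have "(s * F) * cnj (s * G) = (s * cnj s) * (F * cnj G)" for s F G :: complex
        by (simp add: mult_ac)
      ultimately show ?thesis
        unfolding dil_def by (simp only: complex_cnj_complex_of_real add_0_left)
    qed
    then show ?thesis
      using assms by (simp add: scaleR_conv_of_real)
  qed
  finally show ?thesis
    by (simp add: L2_inner_def)
qed

lemma fourier_dil:
  assumes "0 < a"
  shows "fourier (dil a f) = dil (1 / a) (fourier f)"
proof
  fix \<gamma>
  have "fourier f (\<gamma> / a) = \<bar>a\<bar> *\<^sub>R (LINT t|lborel. f (0 + a * t) * wave (- (\<gamma> / a)) (0 + a * t))"
    unfolding fourier_eq_wave using assms by (intro lborel_integral_real_affine) auto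
  also have "(LINT t|lborel. f (0 + a * t) * wave (- (\<gamma> / a)) (0 + a * t)) = (LINT t|lborel. f (a * t) * wave (- \<gamma>) t)"
    using assms by (intro Bochner_Integration.integral_cong refl) (simp add: wave_def mult.assoc)
  finally have "fourier f (\<gamma> / a) = of_real a * (LINT t|lborel. f (a * t) * wave (- \<gamma>) t)"
    using assms by (simp add: scaleR_conv_of_real)
  moreover have "sqrt (1 / a) * a = sqrt a"
    using assms by (simp add: real_sqrt_divide real_div_sqrt)
  moreover have "fourier (dil a f) \<gamma> = of_real (sqrt a) * (LINT t|lborel. f (a * t) * wave (- \<gamma>) t)"
    unfolding fourier_eq_wave dil_def by (simp add: mult.assoc)
  ultimately show "fourier (dil a f) \<gamma> = dil (1 / a) (fourier f) \<gamma>"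
    unfolding dil_def by (simp add: mult.assoc[symmetric] flip: of_real_mult)
qed

lemma plancherel_bounded_support:
  assumes f: "f \<in> L2" "\<And>x. R < \<bar>x\<bar> \<Longrightarrow> f x = 0"
  shows "fourier f \<in> L2" "L2_norm (fourier f) = L2_norm f"
proof -
  \<comment> \<open>Half of \<open>a\<close> exceeds \<open>R\<close>, so scaling by
    \<open>a\<close> sends every point outside \<open>torus\<close> beyond \<open>R\<close>; the
    added 1 also keeps \<open>a\<close> positive.\<close>
  define a where "a = 2 * \<bar>R\<bar> + 1"
  have a: "0 < a" by (simp add: a_def)
  define g where "g = dil a f"
  have g: "g \<in> L2" "L2_norm g = L2_norm f"
    using L2_dil[OF f(1) a] by (auto simp: g_def)
  have g0: "g x = 0" if "x \<notin> torus" for x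
  proof -
    have "1/2 \<le> \<bar>x\<bar>" using that by auto
    then have "a * (1/2) \<le> a * \<bar>x\<bar>"
      using a by (intro mult_left_mono) auto
    moreover have "R < a * (1/2)"
      by (simp add: a_def)
    moreover have "\<bar>a * x\<bar> = a * \<bar>x\<bar>"
      using a by (simp add: abs_mult)
    ultimately have "R < \<bar>a * x\<bar>"
      by linarith
    then show ?thesis
      using f(2) by (simp add: g_def dil_def)
  qed
  have fg: "fourier f = dil a (fourier g)"
    unfolding g_def using a by (simp add: fourier_dil dil_dil)
  have m: "fourier g \<in> borel_measurable borel"
    by (intro measurable_fourier L2_measurable g)
  have eq: "(\<integral>\<^sup>+x. ennreal ((cmod (fourier f x))\<^sup>2) \<partial>lborel) = ennreal ((L2_norm f)\<^sup>2)"
    unfolding fg nn_integral_dil[OF m a] g(2)[symmetric] by (rule plancherel_torus[OF g(1) g0])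
  show F: "fourier f \<in> L2"
    unfolding L2_iff_nn_integral eq by (auto intro: measurable_fourier L2_measurable f)
  show "L2_norm (fourier f) = L2_norm f"
    using eq unfolding nn_integral_L2[OF F] by (simp add: L2_norm_nonneg)
qed

lemma L2_translation:
  assumes "f \<in> L2"
  shows "translation k f \<in> L2" "L2_norm (translation k f) = L2_norm f"
proof -
  note [measurable] = L2_measurable[OF assms]
  have m: "translation k f \<in> borel_measurable borel"
    unfolding translation_def by measurable
  have "(\<integral>\<^sup>+x. ennreal ((cmod (translation k f x))\<^sup>2) \<partial>lborel)
      = (\<integral>\<^sup>+x. ennreal ((cmod (f x))\<^sup>2) \<partial>lborel)"
    unfolding translation_def
    by (subst nn_integral_real_affine[where c = 1 and t = "real_of_int k"]) auto
  then have eq: "(\<integral>\<^sup>+x. ennreal ((cmod (translation k f x))\<^sup>2) \<partial>lborel) = ennreal ((L2_norm f)\<^sup>2)"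
    by (simp add: nn_integral_L2[OF assms])
  show L: "translation k f \<in> L2"
    unfolding L2_iff_nn_integral eq using m by simp
  show "L2_norm (translation k f) = L2_norm f"
    using eq unfolding nn_integral_L2[OF L] by (simp add: L2_norm_nonneg)
qed

lemma fourier_translation: "fourier (translation k f) \<gamma> = wave (- of_int k) \<gamma> * fourier f \<gamma>"
proof -
  have "fourier (translation k f) \<gamma> = \<bar>1\<bar> *\<^sub>R (LINT t|lborel. translation k f (of_int k + 1 * t) * wave (- \<gamma>) (of_int k + 1 * t))"
    unfolding fourier_eq_wave by (intro lborel_integral_real_affine) auto
  also have "\<dots> = (LINT t|lborel. wave (- of_int k) \<gamma> * (f t * wave (- \<gamma>) t))"
  proof -
    have "wave (- \<gamma>) (of_int k) = wave (- of_int k) \<gamma>"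
      by (simp add: wave_def mult_ac)
    then show ?thesis
      by (simp add: translation_def wave_add mult_ac)
  qed
  finally show ?thesis
    by (simp add: fourier_eq_wave)
qed

section \<open>Plancherel's identity for combinations of translates\<close>

lemma integrable_bounded_support:
  assumes f: "f \<in> L2" "\<And>x. R < \<bar>x\<bar> \<Longrightarrow> f x = 0"
  shows "integrable lborel (\<lambda>t. f t * wave s t)"
proof -
  have "(\<lambda>x. indicator {-R..R} x :: complex) \<in> L2"
  proof (rule L2I)
    have "(\<lambda>x. (cmod (indicator {-R..R} x))\<^sup>2) = (indicator {-R..R} :: real \<Rightarrow> real)"
      by (auto simp: indicator_def)
    then show "integrable lborel (\<lambda>x. (cmod (indicator {-R..R} x))\<^sup>2)"
      by (auto intro!: integrable_real_indicator simp: emeasure_lborel_Icc_eq)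
  qed measurable
  then have "integrable lborel (\<lambda>x. (wave s x * f x) * cnj (indicator {-R..R} x))"
    by (intro L2_inner_integrable L2_bounded_mult f) auto
  moreover have "(wave s x * f x) * cnj (indicator {-R..R} x) = f x * wave s x" for x
    using f(2)[of x] by (cases "x \<in> {-R..R}") (auto simp: mult.commute abs_le_iff)
  ultimately show ?thesis
    by simp
qed

text \<open>Linearity requires every integral to exist, and a bounded support makes an L2 function
  integrable. Without it an integral may take the default value 0.\<close>

lemma fourier_diff_sum:
  assumes f: "f \<in> L2" "\<And>x. R < \<bar>x\<bar> \<Longrightarrow> f x = 0"
    and h: "\<And>k. k \<in> K \<Longrightarrow> h k \<in> L2" "\<And>k x. k \<in> K \<Longrightarrow> R < \<bar>x\<bar> \<Longrightarrow> h k x = 0"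
  shows "fourier (\<lambda>x. f x - (\<Sum>k\<in>K. c k * h k x)) \<gamma> = fourier f \<gamma> - (\<Sum>k\<in>K. c k * fourier (h k) \<gamma>)"
proof -
  have "fourier (\<lambda>x. f x - (\<Sum>k\<in>K. c k * h k x)) \<gamma>
      = (LINT t|lborel. f t * wave (- \<gamma>) t - (\<Sum>k\<in>K. c k * (h k t * wave (- \<gamma>) t)))"
    unfolding fourier_eq_wave
    by (intro Bochner_Integration.integral_cong refl) (simp add: left_diff_distrib sum_distrib_right mult.assoc)
  also have "\<dots> = fourier f \<gamma> - (\<Sum>k\<in>K. c k * fourier (h k) \<gamma>)"
    unfolding fourier_eq_wave using integrable_bounded_support[OF f] integrable_bounded_support[OF h]
    by (subst Bochner_Integration.integral_diff) (auto simp: Bochner_Integration.integral_sum)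
  finally show ?thesis .
qed

lemma L2_norm_diff_sum_tendsto:
  assumes f: "f \<in> L2" "\<And>n. fn n \<in> L2" "(\<lambda>n. L2_norm (\<lambda>x. f x - fn n x)) \<longlonglongrightarrow> 0"
    and h: "\<And>k. k \<in> K \<Longrightarrow> h k \<in> L2" "\<And>k n. k \<in> K \<Longrightarrow> hn k n \<in> L2"
      "\<And>k. k \<in> K \<Longrightarrow> (\<lambda>n. L2_norm (\<lambda>x. h k x - hn k n x)) \<longlonglongrightarrow> 0"
    and "finite K"
  shows "(\<lambda>n. L2_norm (\<lambda>x. fn n x - (\<Sum>k\<in>K. c k * hn k n x))) \<longlonglongrightarrow> L2_norm (\<lambda>x. f x - (\<Sum>k\<in>K. c k * h k x))"
proof -
  have L: "(\<lambda>x. f x - (\<Sum>k\<in>K. c k * h k x)) \<in> L2" "(\<lambda>x. fn n x - (\<Sum>k\<in>K. c k * hn k n x)) \<in> L2" for n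
    by (intro L2_diff L2_sum L2_cmult f h; assumption)+
  have "(\<lambda>n. L2_norm (\<lambda>x. (f x - (\<Sum>k\<in>K. c k * h k x)) - (fn n x - (\<Sum>k\<in>K. c k * hn k n x)))) \<longlonglongrightarrow> 0"
    using \<open>finite K\<close> h
  proof (induction K)
    case empty
    then show ?case using f by simp
  next
    case (insert j K)
    define A where "A n x = (f x - (\<Sum>k\<in>K. c k * h k x)) - (fn n x - (\<Sum>k\<in>K. c k * hn k n x))" for n x
    have A: "A n \<in> L2" for n
      unfolding A_def by (intro L2_diff L2_sum L2_cmult f) (use insert.prems in auto)
    have IH: "(\<lambda>n. L2_norm (A n)) \<longlonglongrightarrow> 0"
      unfolding A_def using insert.prems by (intro insert.IH) auto
    have lim: "(\<lambda>n. L2_norm (A n) + cmod (c j) * L2_norm (\<lambda>x. h j x - hn j n x)) \<longlonglongrightarrow> 0 + cmod (c j) * 0"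
      using insert.prems by (intro tendsto_intros IH) auto
    have le: "L2_norm (\<lambda>x. (f x - (\<Sum>k\<in>insert j K. c k * h k x)) - (fn n x - (\<Sum>k\<in>insert j K. c k * hn k n x)))
        \<le> L2_norm (A n) + cmod (c j) * L2_norm (\<lambda>x. h j x - hn j n x)" for n
    proof -
      have "(\<lambda>x. (f x - (\<Sum>k\<in>insert j K. c k * h k x)) - (fn n x - (\<Sum>k\<in>insert j K. c k * hn k n x)))
          = (\<lambda>x. A n x - c j * (h j x - hn j n x))"
        using insert.hyps by (simp add: A_def fun_eq_iff algebra_simps)
      moreover have "L2_norm (\<lambda>x. A n x - c j * (h j x - hn j n x))
          \<le> L2_norm (A n) + L2_norm (\<lambda>x. c j * (h j x - hn j n x))"
        using insert.prems by (intro L2_norm_diff_triangle A L2_cmult L2_diff) auto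
      ultimately show ?thesis
        by (simp only: L2_norm_cmult)
    qed
    show ?case
      by (rule Lim_null_comparison[OF _ lim[simplified]]) (use le in \<open>auto simp: L2_norm_nonneg\<close>)
  qed
  then show ?thesis
    by (rule L2_norm_tendsto) (use L in auto)
qed

lemma L2_truncation_tendsto:
  assumes "f \<in> L2"
  shows "(\<lambda>n. L2_norm (\<lambda>x. f x - indicator {-real n..real n} x * f x)) \<longlonglongrightarrow> 0"
proof (rule L2_dominated_limit[OF _ assms])
  note [measurable] = L2_measurable[OF assms]
  show "(\<lambda>x. f x - indicator {-real n..real n} x * f x) \<in> borel_measurable borel" for n
    by measurable
  show "cmod (f x - indicator {-real n..real n} x * f x) \<le> cmod (f x)" for n x
    by (cases "x \<in> {-real n..real n}") auto
  show "AE x in lborel. (\<lambda>n. f x - indicator {-real n..real n} x * f x) \<longlonglongrightarrow> 0"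
  proof (rule AE_I2)
    fix x
    obtain n0 where n0: "\<bar>x\<bar> \<le> real n0"
      using real_arch_simple by blast
    have "f x - indicator {-real n..real n} x * f x = 0" if "n0 \<le> n" for n
    proof -
      have "x \<in> {-real n..real n}" using n0 that by auto
      then show ?thesis by simp
    qed
    then have "eventually (\<lambda>n. f x - indicator {-real n..real n} x * f x = 0) sequentially"
      unfolding eventually_sequentially by blast
    then show "(\<lambda>n. f x - indicator {-real n..real n} x * f x) \<longlonglongrightarrow> 0"
      by (rule tendsto_eventually)
  qed
qed

lemma L2_fourier_seq:
  assumes "L2_fourier f F"
  shows "(\<lambda>n. L2_norm (\<lambda>\<gamma>. F \<gamma> - fourier (\<lambda>t. indicator {-real n..real n} t * f t) \<gamma>)) \<longlonglongrightarrow> 0"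
  using assms unfolding L2_fourier_def by (auto intro: filterlim_compose[OF _ filterlim_real_sequentially])

text \<open>Both sides are limits of the identity for functions cut off to \<open>[-n, n]\<close>.
  \<open>\<phi>\<close> is cut off before it is translated, so that the translation becomes an exact
  factor on the frequency side. The form with \<open>f\<close> minus a finite sum covers the
  approximation errors and, by polarisation, the coefficients.\<close>

lemma plancherel_translates:
  assumes f: "L2_fourier f F" and \<phi>: "L2_fourier \<phi> \<Phi>" and K: "finite K"
  shows "L2_norm (\<lambda>x. f x - (\<Sum>k\<in>K. c k * translation k \<phi> x))
    = L2_norm (\<lambda>\<gamma>. F \<gamma> - (\<Sum>k\<in>K. c k * (wave (- of_int k) \<gamma> * \<Phi> \<gamma>)))"
proof (rule LIMSEQ_unique)
  have fL: "f \<in> L2" "F \<in> L2" "\<phi> \<in> L2" "\<Phi> \<in> L2"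
    using f \<phi> by (auto simp: L2_fourier_def)
  define fn where "fn n x = indicator {-real n..real n} x * f x" for n x
  define pn where "pn n x = indicator {-real n..real n} x * \<phi> x" for n x
  have fn: "fn n \<in> L2" and pn: "pn n \<in> L2" for n
    unfolding fn_def pn_def by (intro L2_indicator fL; simp)+
  \<comment> \<open>\<open>M\<close> bounds every shift in \<open>K\<close>, so the translated
    truncations are supported in \<open>[-(n + M), n + M]\<close>.\<close>
  define M where "M = (\<Sum>k\<in>K. \<bar>real_of_int k\<bar>)"
  have M: "\<bar>real_of_int k\<bar> \<le> M" if "k \<in> K" for k
    unfolding M_def by (rule member_le_sum) (use that K in auto)
  have fn0: "fn n x = 0" and pn0: "pn n x = 0" if "real n < \<bar>x\<bar>" for n x
    using that by (auto simp: fn_def pn_def indicator_def)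
  have M0: "0 \<le> M" by (auto simp: M_def intro: sum_nonneg)
  have eq: "L2_norm (\<lambda>x. fn n x - (\<Sum>k\<in>K. c k * translation k (pn n) x))
      = L2_norm (\<lambda>\<gamma>. fourier (fn n) \<gamma> - (\<Sum>k\<in>K. c k * (wave (- of_int k) \<gamma> * fourier (pn n) \<gamma>)))" for n
  proof -
    have s1: "fn n x = 0" if "real n + M < \<bar>x\<bar>" for x
      using that M0 by (intro fn0) auto
    have s2: "translation k (pn n) x = 0" if "k \<in> K" "real n + M < \<bar>x\<bar>" for k x
      unfolding translation_def using that M[of k] by (intro pn0) auto
    have "L2_norm (fourier (\<lambda>x. fn n x - (\<Sum>k\<in>K. c k * translation k (pn n) x)))
        = L2_norm (\<lambda>x. fn n x - (\<Sum>k\<in>K. c k * translation k (pn n) x))"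
    proof (rule plancherel_bounded_support)
      show "(\<lambda>x. fn n x - (\<Sum>k\<in>K. c k * translation k (pn n) x)) \<in> L2"
        by (intro L2_diff L2_sum L2_cmult L2_translation fn pn)
      fix x assume "real n + M < \<bar>x\<bar>"
      then show "fn n x - (\<Sum>k\<in>K. c k * translation k (pn n) x) = 0"
        using s1 s2 by (simp add: sum.neutral)
    qed
    also have "fourier (\<lambda>x. fn n x - (\<Sum>k\<in>K. c k * translation k (pn n) x))
        = (\<lambda>\<gamma>. fourier (fn n) \<gamma> - (\<Sum>k\<in>K. c k * (wave (- of_int k) \<gamma> * fourier (pn n) \<gamma>)))"
      using s1 s2 by (simp add: fun_eq_iff fourier_diff_sum[where R = "real n + M"] fn L2_translation(1)[OF pn]
          fourier_translation)
    finally show ?thesis ..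
  qed
  show "(\<lambda>n. L2_norm (\<lambda>x. fn n x - (\<Sum>k\<in>K. c k * translation k (pn n) x)))
      \<longlonglongrightarrow> L2_norm (\<lambda>x. f x - (\<Sum>k\<in>K. c k * translation k \<phi> x))"
  proof (rule L2_norm_diff_sum_tendsto)
    show "(\<lambda>n. L2_norm (\<lambda>x. f x - fn n x)) \<longlonglongrightarrow> 0"
      unfolding fn_def by (rule L2_truncation_tendsto[OF fL(1)])
    fix k
    have "L2_norm (\<lambda>x. translation k \<phi> x - translation k (pn n) x) = L2_norm (\<lambda>x. \<phi> x - pn n x)" for n
      using L2_translation(2)[OF L2_diff[OF fL(3) pn[of n]], of k] by (simp add: translation_def)
    then show "(\<lambda>n. L2_norm (\<lambda>x. translation k \<phi> x - translation k (pn n) x)) \<longlonglongrightarrow> 0"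
      using L2_truncation_tendsto[OF fL(3)] by (simp add: pn_def)
  qed (auto intro: fL fn pn K L2_translation)
  show "(\<lambda>n. L2_norm (\<lambda>x. fn n x - (\<Sum>k\<in>K. c k * translation k (pn n) x)))
      \<longlonglongrightarrow> L2_norm (\<lambda>\<gamma>. F \<gamma> - (\<Sum>k\<in>K. c k * (wave (- of_int k) \<gamma> * \<Phi> \<gamma>)))"
    unfolding eq
  proof (rule L2_norm_diff_sum_tendsto)
    show "fourier (fn n) \<in> L2" for n
      by (rule plancherel_bounded_support(1)[OF fn fn0])
    have p: "fourier (pn n) \<in> L2" for n
      by (rule plancherel_bounded_support(1)[OF pn pn0])
    show "(\<lambda>n. L2_norm (\<lambda>\<gamma>. F \<gamma> - fourier (fn n) \<gamma>)) \<longlonglongrightarrow> 0"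
      unfolding fn_def by (rule L2_fourier_seq[OF f])
    fix k
    show "(\<lambda>\<gamma>. wave (- of_int k) \<gamma> * fourier (pn n) \<gamma>) \<in> L2" for n
      by (rule L2_bounded_mult[OF p]) auto
    show "(\<lambda>\<gamma>. wave (- of_int k) \<gamma> * \<Phi> \<gamma>) \<in> L2"
      by (rule L2_bounded_mult[OF fL(4)]) auto
    have "L2_norm (\<lambda>\<gamma>. wave (- of_int k) \<gamma> * \<Phi> \<gamma> - wave (- of_int k) \<gamma> * fourier (pn n) \<gamma>)
        = L2_norm (\<lambda>\<gamma>. \<Phi> \<gamma> - fourier (pn n) \<gamma>)" for n
      unfolding right_diff_distrib[symmetric] by (simp add: L2_norm_def norm_mult)
    then show "(\<lambda>n. L2_norm (\<lambda>\<gamma>. wave (- of_int k) \<gamma> * \<Phi> \<gamma> - wave (- of_int k) \<gamma> * fourier (pn n) \<gamma>)) \<longlonglongrightarrow> 0"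
      using L2_fourier_seq[OF \<phi>] by (simp add: pn_def[abs_def])
  qed (auto intro: fL K)
qed

text \<open>Cutting the dilated function off at \<open>R\<close> is the same as dilating the
  function cut off at \<open>a * R\<close>, and \<open>a * R\<close> tends to infinity with
  \<open>R\<close>.\<close>

lemma L2_fourier_dil:
  assumes f: "L2_fourier f F" and a: "0 < a"
  shows "L2_fourier (dil a f) (dil (1 / a) F)"
  unfolding L2_fourier_def
proof (intro conjI)
  have fL: "f \<in> L2" "F \<in> L2"
    using f by (auto simp: L2_fourier_def)
  show "dil a f \<in> L2" "dil (1 / a) F \<in> L2"
    using a by (auto intro: L2_dil fL)
  define e where "e R = L2_norm (\<lambda>\<gamma>. F \<gamma> - fourier (\<lambda>t. indicator {-R..R} t * f t) \<gamma>)" for R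
  have "(e \<longlongrightarrow> 0) at_top"
    using f by (simp add: L2_fourier_def e_def[abs_def])
  moreover have "filterlim (\<lambda>R. a * R) at_top at_top"
    using a by (intro filterlim_tendsto_pos_mult_at_top[OF tendsto_const] filterlim_ident)
  ultimately have lim: "((\<lambda>R. e (a * R)) \<longlongrightarrow> 0) at_top"
    by (rule filterlim_compose)
  have "L2_norm (\<lambda>\<gamma>. dil (1 / a) F \<gamma> - fourier (\<lambda>t. indicator {-R..R} t * dil a f t) \<gamma>) = e (a * R)" for R
  proof -
    define h where "h t = indicator {-(a * R)..a * R} t * f t" for t
    have h: "h \<in> L2" "\<And>x. \<bar>a * R\<bar> < \<bar>x\<bar> \<Longrightarrow> h x = 0"
      unfolding h_def by (rule L2_indicator[OF fL(1)]) (auto simp: indicator_def)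
    have "(\<lambda>t. indicator {-R..R} t * dil a f t) = dil a h"
    proof
      fix t
      have "t \<in> {-R..R} \<longleftrightarrow> a * t \<in> {-(a * R)..a * R}"
        using a mult_le_cancel_left_pos[of a t R] mult_le_cancel_left_pos[of a "-R" t] by auto
      then have "indicator {-R..R} t = (indicator {-(a * R)..a * R} (a * t) :: complex)"
        unfolding indicator_def by (simp only:)
      then show "indicator {-R..R} t * dil a f t = dil a h t"
        unfolding h_def dil_def by (simp only: mult_ac)
    qed
    then have "(\<lambda>\<gamma>. dil (1 / a) F \<gamma> - fourier (\<lambda>t. indicator {-R..R} t * dil a f t) \<gamma>)
        = dil (1 / a) (\<lambda>\<gamma>. F \<gamma> - fourier h \<gamma>)"
      using a by (simp add: fourier_dil dil_diff)
    moreover have "(\<lambda>\<gamma>. F \<gamma> - fourier h \<gamma>) \<in> L2"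
      by (intro L2_diff fL plancherel_bounded_support(1)[OF h])
    ultimately show ?thesis
      using a L2_dil(2) by (simp add: e_def h_def[abs_def])
  qed
  then show "((\<lambda>R. L2_norm (\<lambda>\<gamma>. dil (1 / a) F \<gamma> - fourier (\<lambda>t. indicator {-R..R} t * dil a f t) \<gamma>)) \<longlongrightarrow> 0) at_top"
    using lim by simp
qed

section \<open>Approximation order\<close>

lemma L2_fourier_zero: "L2_fourier (\<lambda>x. 0) (\<lambda>x. 0)"
  by (simp add: L2_fourier_def fourier_def)

text \<open>Subtracting \<open>floor (x + 1/2)\<close> gives the representative of \<open>x\<close>
  modulo 1 in \<open>[-1/2, 1/2)\<close>, so only the values of \<open>p\<close> there
  matter.\<close>

definition periodic_extension :: "(real \<Rightarrow> complex) \<Rightarrow> real \<Rightarrow> complex" where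
  "periodic_extension p x = p (x - of_int \<lfloor>x + 1/2\<rfloor>)"

lemma periodic_extension_shift:
  assumes "u \<in> torus"
  shows "periodic_extension p (u + of_int k) = p u"
proof -
  have "\<lfloor>u + of_int k + 1/2\<rfloor> = k"
    using assms by (intro floor_unique) auto
  then show ?thesis
    by (simp add: periodic_extension_def)
qed

lemma periodic_extension_torus: "u \<in> torus \<Longrightarrow> periodic_extension p u = p u"
  using periodic_extension_shift[of u p 0] by simp

lemma measurable_periodic_extension:
  assumes [measurable]: "p \<in> borel_measurable borel"
  shows "periodic_extension p \<in> borel_measurable borel"
  unfolding periodic_extension_def by measurable

text \<open>Polarisation with a single multiplier: for \<open>c\<close> the difference of the two
  inner products, expanding the squares leaves \<open>Re (cnj c * c) = 0\<close>.\<close>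

lemma L2_inner_eq_if_norms_eq:
  assumes L: "f \<in> L2" "g \<in> L2" "F \<in> L2" "G \<in> L2"
    and eq: "\<And>c. L2_norm (\<lambda>x. f x - c * g x) = L2_norm (\<lambda>x. F x - c * G x)"
    and g: "L2_norm g = L2_norm G"
  shows "L2_inner f g = L2_inner F G"
proof -
  have f: "L2_norm f = L2_norm F"
    using eq[of 0] by simp
  define c where "c = L2_inner f g - L2_inner F G"
  have "(L2_norm f)\<^sup>2 - 2 * Re (cnj c * L2_inner f g) + (cmod c * L2_norm g)\<^sup>2
      = (L2_norm F)\<^sup>2 - 2 * Re (cnj c * L2_inner F G) + (cmod c * L2_norm G)\<^sup>2"
    using arg_cong[OF eq[of c], of "\<lambda>x. x\<^sup>2"] L
    by (simp add: L2_norm_diff_sq L2_cmult L2_inner_cmult_right L2_norm_cmult del: times_complex.sel)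
  then have "Re (cnj c * (L2_inner f g - L2_inner F G)) = 0"
    unfolding f g by (simp add: right_diff_distrib del: times_complex.sel)
  then have "Re (cnj c * c) = 0"
    by (simp add: c_def)
  then have "(cmod c)\<^sup>2 = 0"
    unfolding cmod_power2 by (simp add: power2_eq_square)
  then show ?thesis
    by (simp add: c_def)
qed

section \<open>Error analysis on the frequency side\<close>

text \<open>One exponent \<open>\<rho>\<close> serves both conditions, which are asked on one period
  only, where lowering an exponent weakens a bound. \<open>tail\<close> has
  \<open>2 * \<rho>\<close> because it bounds squares.\<close>

locale fourier_generator =
  fixes \<phi> :: "real \<Rightarrow> complex" and \<Phi> :: "real \<Rightarrow> real" and A B \<rho> :: real
  assumes fourier_phi: "L2_fourier \<phi> (\<lambda>\<gamma>. of_real (\<Phi> \<gamma>))"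
    and Phi_nonneg: "0 \<le> \<Phi> x" and Phi_le_1: "\<Phi> x \<le> 1"
    and bracket: "finite K \<Longrightarrow> (\<Sum>k\<in>K. (\<Phi> (u + of_int k))\<^sup>2) \<le> 1"
    and near_0: "u \<in> torus \<Longrightarrow> 1 - \<Phi> u \<le> A * \<bar>u\<bar> powr \<rho>"
    and tail: "u \<in> torus \<Longrightarrow> finite K \<Longrightarrow> 0 \<notin> K \<Longrightarrow>
      (\<Sum>k\<in>K. (\<Phi> (u + of_int k))\<^sup>2) \<le> B * \<bar>u\<bar> powr (2 * \<rho>)"
    and constants: "0 < \<rho>" "0 \<le> A" "0 \<le> B"
begin

lemma phi_L2: "\<phi> \<in> L2" and Phi_L2: "(\<lambda>\<gamma>. of_real (\<Phi> \<gamma>)) \<in> L2"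
  using fourier_phi by (auto simp: L2_fourier_def)

lemma measurable_Phi [measurable]: "\<Phi> \<in> borel_measurable borel"
proof -
  have "(\<lambda>\<gamma>. Re (of_real (\<Phi> \<gamma>))) \<in> borel_measurable borel"
    using L2_measurable[OF Phi_L2] by measurable
  then show ?thesis by simp
qed

text \<open>The Fourier transform of the translate of \<open>\<phi>\<close> by \<open>k\<close>; the
  minus sign in the frequency is why index sets are reflected below.\<close>

definition Psi :: "int \<Rightarrow> real \<Rightarrow> complex" where
  "Psi k \<gamma> = wave (- of_int k) \<gamma> * of_real (\<Phi> \<gamma>)"

lemma Psi_L2: "Psi k \<in> L2"
  unfolding Psi_def[abs_def] by (rule L2_bounded_mult[OF Phi_L2]) auto

text \<open>After folding onto one period, the periodic \<open>p\<close> leaves the lattice sum and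
  the bracket that remains is at most 1. This carries estimates for Fourier series on
  \<open>torus\<close> over to multiples of \<open>\<Phi>\<close> on the line.\<close>

lemma nn_integral_periodic_mult_le:
  assumes [measurable]: "p \<in> borel_measurable borel"
    and per: "\<And>u k. p (u + of_int k) = p u"
  shows "(\<integral>\<^sup>+\<gamma>. ennreal ((cmod (p \<gamma> * of_real (\<Phi> \<gamma>)))\<^sup>2) \<partial>lborel)
    \<le> (\<integral>\<^sup>+u. ennreal ((cmod (indicator torus u * p u))\<^sup>2) \<partial>lborel)"
proof -
  have "(\<integral>\<^sup>+k. ennreal ((cmod (p (u + of_int k) * of_real (\<Phi> (u + of_int k))))\<^sup>2) \<partial>count_space UNIV)
      \<le> ennreal ((cmod (p u))\<^sup>2)" for u
  proof (rule nn_integral_count_int_le)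
    fix K :: "int set" assume K: "finite K"
    have "(\<Sum>k\<in>K. ennreal ((cmod (p (u + of_int k) * of_real (\<Phi> (u + of_int k))))\<^sup>2))
        = ennreal ((cmod (p u))\<^sup>2 * (\<Sum>k\<in>K. (\<Phi> (u + of_int k))\<^sup>2))"
      by (simp add: per norm_mult power_mult_distrib sum_ennreal sum_distrib_left)
    also have "\<dots> \<le> ennreal ((cmod (p u))\<^sup>2 * 1)"
      by (intro ennreal_leI mult_left_mono bracket K) auto
    finally show "(\<Sum>k\<in>K. ennreal ((cmod (p (u + of_int k) * of_real (\<Phi> (u + of_int k))))\<^sup>2)) \<le> ennreal ((cmod (p u))\<^sup>2)"
      by simp
  qed
  then have "(\<integral>\<^sup>+u. indicator torus u * (\<integral>\<^sup>+k. ennreal ((cmod (p (u + of_int k) * of_real (\<Phi> (u + of_int k))))\<^sup>2)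
        \<partial>count_space UNIV) \<partial>lborel) \<le> (\<integral>\<^sup>+u. indicator torus u * ennreal ((cmod (p u))\<^sup>2) \<partial>lborel)"
    by (intro nn_integral_mono mult_left_mono) auto
  also have "\<dots> = (\<integral>\<^sup>+u. ennreal ((cmod (indicator torus u * p u))\<^sup>2) \<partial>lborel)"
    by (intro nn_integral_cong) (auto simp: indicator_def)
  finally show ?thesis
    by (subst nn_integral_periodize) auto
qed

lemma L2_norm_periodic_mult_le:
  assumes "p \<in> borel_measurable borel" "\<And>u k. p (u + of_int k) = p u" "(\<lambda>u. indicator torus u * p u) \<in> L2"
  shows "(\<lambda>\<gamma>. p \<gamma> * of_real (\<Phi> \<gamma>)) \<in> L2"
    and "L2_norm (\<lambda>\<gamma>. p \<gamma> * of_real (\<Phi> \<gamma>)) \<le> L2_norm (\<lambda>u. indicator torus u * p u)"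
proof -
  have m: "(\<lambda>\<gamma>. p \<gamma> * of_real (\<Phi> \<gamma>)) \<in> borel_measurable borel"
    using assms(1) by measurable
  have "(\<integral>\<^sup>+\<gamma>. ennreal ((cmod (p \<gamma> * of_real (\<Phi> \<gamma>)))\<^sup>2) \<partial>lborel)
      \<le> ennreal ((L2_norm (\<lambda>u. indicator torus u * p u))\<^sup>2)"
    using nn_integral_periodic_mult_le[OF assms(1,2)] unfolding nn_integral_L2[OF assms(3)] by simp
  from L2_norm_le_nn_integral[OF this L2_norm_nonneg m]
  show "(\<lambda>\<gamma>. p \<gamma> * of_real (\<Phi> \<gamma>)) \<in> L2"
    "L2_norm (\<lambda>\<gamma>. p \<gamma> * of_real (\<Phi> \<gamma>)) \<le> L2_norm (\<lambda>u. indicator torus u * p u)"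
    by auto
qed

lemma wave_int_periodic: "wave (- of_int j) (u + of_int k) = wave (- of_int j) u"
  using wave_of_int[of "-j" k] by (simp add: wave_add)

text \<open>A finite combination of the \<open>Psi k\<close> is a trigonometric polynomial times
  \<open>\<Phi>\<close>, so its norm is at most the norm of the polynomial on one period, which
  orthonormality evaluates.\<close>

lemma bessel_Psi: "bessel Psi"
  unfolding bessel_def
proof (intro conjI allI impI Psi_L2)
  fix K :: "int set" and c :: "int \<Rightarrow> complex" assume K: "finite K"
  define p where "p \<gamma> = (\<Sum>k\<in>K. c k * wave (- of_int k) \<gamma>)" for \<gamma>
  have eq: "indicator torus u * p u = (\<Sum>k\<in>uminus ` K. c (- k) * torus_wave k u)" for u
    unfolding p_def sum_distrib_left
    by (subst sum.reindex) (auto simp: torus_wave_def mult.left_commute)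
  have "L2_norm (\<lambda>x. \<Sum>k\<in>K. c k * Psi k x) = L2_norm (\<lambda>\<gamma>. p \<gamma> * of_real (\<Phi> \<gamma>))"
    by (simp add: p_def Psi_def sum_distrib_right mult.assoc)
  also have "\<dots> \<le> L2_norm (\<lambda>u. indicator torus u * p u)"
  proof (rule L2_norm_periodic_mult_le)
    show "p \<in> borel_measurable borel"
      unfolding p_def by measurable
    show "p (u + of_int k) = p u" for u k
      by (simp add: p_def wave_int_periodic)
    show "(\<lambda>u. indicator torus u * p u) \<in> L2"
      unfolding eq by (intro L2_sum L2_cmult L2_torus_wave)
  qed
  finally have "(L2_norm (\<lambda>x. \<Sum>k\<in>K. c k * Psi k x))\<^sup>2 \<le> (L2_norm (\<lambda>u. indicator torus u * p u))\<^sup>2"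
    by (intro power_mono L2_norm_nonneg)
  also have "\<dots> = (\<Sum>k\<in>uminus ` K. (cmod (c (- k)))\<^sup>2)"
    unfolding eq using K by (intro L2_norm_trig_sum) auto
  also have "\<dots> = (\<Sum>k\<in>K. (cmod (c k))\<^sup>2)"
    by (subst sum.reindex) auto
  finally show "(L2_norm (\<lambda>x. \<Sum>k\<in>K. c k * Psi k x))\<^sup>2 \<le> (\<Sum>k\<in>K. (cmod (c k))\<^sup>2)" .
qed

lemma plancherel_phi:
  assumes "L2_fourier f F" "finite K"
  shows "L2_norm (\<lambda>x. f x - (\<Sum>k\<in>K. c k * translation k \<phi> x)) = L2_norm (\<lambda>\<gamma>. F \<gamma> - (\<Sum>k\<in>K. c k * Psi k \<gamma>))"
  unfolding Psi_def by (rule plancherel_translates[OF assms(1) fourier_phi assms(2)])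

lemma plancherel_phi_sum:
  assumes "finite K"
  shows "L2_norm (\<lambda>x. \<Sum>k\<in>K. c k * translation k \<phi> x) = L2_norm (\<lambda>\<gamma>. \<Sum>k\<in>K. c k * Psi k \<gamma>)"
proof -
  have "L2_norm (\<lambda>x. - g x) = L2_norm g" for g
    by (simp add: L2_norm_def)
  then show ?thesis
    using plancherel_phi[OF L2_fourier_zero assms, of c] by simp
qed

lemma bessel_translates: "bessel (\<lambda>k. translation k \<phi>)"
  using besselD(2)[OF bessel_Psi] by (simp add: bessel_def plancherel_phi_sum L2_translation(1)[OF phi_L2])

lemma L2_inner_phi:
  assumes f: "L2_fourier f F"
  shows "L2_inner f (translation k \<phi>) = L2_inner F (Psi k)"
proof (rule L2_inner_eq_if_norms_eq)
  show "L2_norm (\<lambda>x. f x - c * translation k \<phi> x) = L2_norm (\<lambda>x. F x - c * Psi k x)" for c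
    using plancherel_phi[OF f, of "{k}" "\<lambda>_. c"] by simp
  show "L2_norm (translation k \<phi>) = L2_norm (Psi k)"
    using plancherel_phi_sum[of "{k}" "\<lambda>_. 1"] by simp
qed (use f in \<open>auto simp: L2_fourier_def Psi_L2 L2_translation(1)[OF phi_L2]\<close>)

text \<open>Outside \<open>torus\<close> one has \<open>1 \<le> 2 * |\<gamma>|\<close>, hence
  \<open>1 \<le> (2 * |\<gamma>|) powr \<rho>\<close>; this is the origin of
  \<open>2 powr \<rho>\<close>.\<close>

lemma high_frequency_le:
  assumes W: "(\<lambda>\<gamma>. of_real (\<bar>\<gamma>\<bar> powr \<rho>) * F \<gamma>) \<in> L2" and F: "F \<in> L2"
  shows "L2_norm (\<lambda>\<gamma>. F \<gamma> - indicator torus \<gamma> * F \<gamma>) \<le> 2 powr \<rho> * L2_norm (\<lambda>\<gamma>. of_real (\<bar>\<gamma>\<bar> powr \<rho>) * F \<gamma>)"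
proof -
  note [measurable] = L2_measurable[OF F]
  have "cmod (F \<gamma> - indicator torus \<gamma> * F \<gamma>) \<le> cmod (of_real (2 powr \<rho>) * (of_real (\<bar>\<gamma>\<bar> powr \<rho>) * F \<gamma>))" for \<gamma>
  proof (cases "\<gamma> \<in> torus")
    case False
    then have "1 \<le> 2 * \<bar>\<gamma>\<bar>" by auto
    then have "1 \<le> (2 * \<bar>\<gamma>\<bar>) powr \<rho>"
      using constants by (intro ge_one_powr_ge_zero) auto
    then have "1 * cmod (F \<gamma>) \<le> (2 powr \<rho> * \<bar>\<gamma>\<bar> powr \<rho>) * cmod (F \<gamma>)"
      by (intro mult_right_mono) (auto simp: powr_mult)
    then show ?thesis
      using False by (simp add: norm_mult mult.assoc del: atLeastLessThan_iff)
  qed (simp add: norm_mult del: atLeastLessThan_iff)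
  then have "L2_norm (\<lambda>\<gamma>. F \<gamma> - indicator torus \<gamma> * F \<gamma>)
      \<le> L2_norm (\<lambda>\<gamma>. of_real (2 powr \<rho>) * (of_real (\<bar>\<gamma>\<bar> powr \<rho>) * F \<gamma>))"
    by (intro L2_mono(2) L2_cmult W AE_I2) auto
  then show ?thesis
    by (subst (asm) L2_norm_cmult) simp
qed

text \<open>The error left when \<open>F\<close> is cut off to \<open>torus\<close> and all
  \<open>k\<close> are summed: the coefficients against \<open>Psi k\<close> are the Fourier
  coefficients of \<open>F * \<Phi>\<close> on one period, so the full series is the periodic
  extension of that product, times \<open>\<Phi>\<close>.\<close>

definition low_error :: "(real \<Rightarrow> complex) \<Rightarrow> real \<Rightarrow> complex" where
  "low_error F \<gamma> = indicator torus \<gamma> * F \<gamma>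
     - periodic_extension (\<lambda>u. indicator torus u * F u * of_real (\<Phi> u)) \<gamma> * of_real (\<Phi> \<gamma>)"

text \<open>On the lattice \<open>u + k\<close> the error is \<open>F u\<close> times a vector with
  entry \<open>1 - (\<Phi> u)\<^sup>2\<close> at \<open>k = 0\<close> and
  \<open>- \<Phi> u * \<Phi> (u + k)\<close> elsewhere. \<open>near_0\<close> and
  \<open>tail\<close> bound the two squared parts by \<open>4 * A\<^sup>2\<close> and
  \<open>B\<close> times \<open>|u| powr (2 * \<rho>)\<close>.\<close>

lemma low_error_le:
  assumes W: "(\<lambda>\<gamma>. of_real (\<bar>\<gamma>\<bar> powr \<rho>) * F \<gamma>) \<in> L2" and F: "F \<in> L2"
  shows "low_error F \<in> L2"
    and "L2_norm (low_error F) \<le> sqrt (4 * A\<^sup>2 + B) * L2_norm (\<lambda>\<gamma>. of_real (\<bar>\<gamma>\<bar> powr \<rho>) * F \<gamma>)"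
proof -
  note [measurable] = L2_measurable[OF F]
  have m [measurable]: "low_error F \<in> borel_measurable borel"
    unfolding low_error_def by (intro borel_measurable_diff borel_measurable_times measurable_periodic_extension) measurable
  define C where "C = 4 * A\<^sup>2 + B"
  have C: "0 \<le> C" using constants by (simp add: C_def)
  have inner: "(\<integral>\<^sup>+k. ennreal ((cmod (low_error F (u + of_int k)))\<^sup>2) \<partial>count_space UNIV)
      \<le> ennreal (C * (\<bar>u\<bar> powr (2 * \<rho>) * (cmod (F u))\<^sup>2))" if u: "u \<in> torus" for u
  proof (rule nn_integral_count_int_le)
    fix K :: "int set" assume K: "finite K"
    have e0: "low_error F u = of_real (1 - (\<Phi> u)\<^sup>2) * F u"
      using u by (simp add: low_error_def periodic_extension_torus power2_eq_square algebra_simps del: atLeastLessThan_iff)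
    have ek: "low_error F (u + of_int k) = - (of_real (\<Phi> u * \<Phi> (u + of_int k)) * F u)" if "k \<noteq> 0" for k
    proof -
      have "1 \<le> \<bar>k\<bar>" using that by linarith
      then have "1 \<le> \<bar>real_of_int k\<bar>" by linarith
      then have "u + of_int k \<notin> torus"
        using u by auto
      then show ?thesis
        using u by (simp add: low_error_def periodic_extension_shift mult_ac del: atLeastLessThan_iff)
    qed
    \<comment> \<open>In \<open>(1 - \<Phi> u) * (1 + \<Phi> u)\<close> the second factor is at most
      2; squared, this is the 4 in \<open>4 * A\<^sup>2\<close>.\<close>
    have near: "(1 - (\<Phi> u)\<^sup>2)\<^sup>2 \<le> 4 * A\<^sup>2 * \<bar>u\<bar> powr (2 * \<rho>)"
    proof -
      have "1 - (\<Phi> u)\<^sup>2 = (1 - \<Phi> u) * (1 + \<Phi> u)"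
        by (simp add: power2_eq_square algebra_simps)
      also have "\<dots> \<le> (A * \<bar>u\<bar> powr \<rho>) * 2"
        using Phi_le_1[of u] Phi_nonneg[of u] constants near_0[OF u]
        by (intro mult_mono) auto
      finally have "1 - (\<Phi> u)\<^sup>2 \<le> 2 * A * \<bar>u\<bar> powr \<rho>"
        by simp
      moreover have "0 \<le> 1 - (\<Phi> u)\<^sup>2"
        using Phi_le_1[of u] Phi_nonneg[of u] by (simp add: power_le_one)
      ultimately have "(1 - (\<Phi> u)\<^sup>2)\<^sup>2 \<le> (2 * A * \<bar>u\<bar> powr \<rho>)\<^sup>2"
        by (rule power_mono)
      also have "\<dots> = 4 * A\<^sup>2 * \<bar>u\<bar> powr (2 * \<rho>)"
        by (simp add: power_mult_distrib power2_eq_square[of "_ powr _"] flip: powr_add)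
      finally show ?thesis .
    qed
    have far: "(\<Phi> u)\<^sup>2 * (\<Sum>k\<in>K - {0}. (\<Phi> (u + of_int k))\<^sup>2) \<le> B * \<bar>u\<bar> powr (2 * \<rho>)"
    proof -
      have "(\<Phi> u)\<^sup>2 * (\<Sum>k\<in>K - {0}. (\<Phi> (u + of_int k))\<^sup>2) \<le> 1 * (B * \<bar>u\<bar> powr (2 * \<rho>))"
        using K Phi_le_1[of u] Phi_nonneg[of u]
        by (intro mult_mono tail u) (auto intro: power_le_one sum_nonneg)
      then show ?thesis by simp
    qed
    \<comment> \<open>Adding 0 to \<open>K\<close> can only enlarge the sum and lets the central
      entry be split off.\<close>
    have "(\<Sum>k\<in>K. (cmod (low_error F (u + of_int k)))\<^sup>2)
        \<le> (\<Sum>k\<in>insert 0 (K - {0}). (cmod (low_error F (u + of_int k)))\<^sup>2)"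
      using K by (intro sum_mono2) auto
    also have "\<dots> = (cmod (low_error F u))\<^sup>2 + (\<Sum>k\<in>K - {0}. (cmod (low_error F (u + of_int k)))\<^sup>2)"
      using K by (subst sum.insert) auto
    also have "(cmod (low_error F u))\<^sup>2 = (1 - (\<Phi> u)\<^sup>2)\<^sup>2 * (cmod (F u))\<^sup>2"
      unfolding e0 norm_mult norm_of_real power_mult_distrib power2_abs ..
    also have "(\<Sum>k\<in>K - {0}. (cmod (low_error F (u + of_int k)))\<^sup>2)
        = ((\<Phi> u)\<^sup>2 * (\<Sum>k\<in>K - {0}. (\<Phi> (u + of_int k))\<^sup>2)) * (cmod (F u))\<^sup>2"
      unfolding sum_distrib_left sum_distrib_right
      by (intro sum.cong refl) (simp add: ek norm_mult power_mult_distrib)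
    also have "(1 - (\<Phi> u)\<^sup>2)\<^sup>2 * (cmod (F u))\<^sup>2
        + ((\<Phi> u)\<^sup>2 * (\<Sum>k\<in>K - {0}. (\<Phi> (u + of_int k))\<^sup>2)) * (cmod (F u))\<^sup>2
        \<le> (4 * A\<^sup>2 * \<bar>u\<bar> powr (2 * \<rho>)) * (cmod (F u))\<^sup>2 + (B * \<bar>u\<bar> powr (2 * \<rho>)) * (cmod (F u))\<^sup>2"
      by (intro add_mono mult_right_mono near far) auto
    also have "\<dots> = C * (\<bar>u\<bar> powr (2 * \<rho>) * (cmod (F u))\<^sup>2)"
      by (simp add: C_def algebra_simps)
    finally show "(\<Sum>k\<in>K. ennreal ((cmod (low_error F (u + of_int k)))\<^sup>2))
        \<le> ennreal (C * (\<bar>u\<bar> powr (2 * \<rho>) * (cmod (F u))\<^sup>2))"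
      by (subst sum_ennreal) (auto intro: ennreal_leI)
  qed
  have "(\<integral>\<^sup>+\<gamma>. ennreal ((cmod (low_error F \<gamma>))\<^sup>2) \<partial>lborel)
      = (\<integral>\<^sup>+u. indicator torus u * (\<integral>\<^sup>+k. ennreal ((cmod (low_error F (u + of_int k)))\<^sup>2) \<partial>count_space UNIV) \<partial>lborel)"
    by (rule nn_integral_periodize) measurable
  also have "\<dots> \<le> (\<integral>\<^sup>+u. ennreal C * ennreal ((cmod (of_real (\<bar>u\<bar> powr \<rho>) * F u))\<^sup>2) \<partial>lborel)"
  proof (intro nn_integral_mono)
    fix u :: real
    show "indicator torus u * (\<integral>\<^sup>+k. ennreal ((cmod (low_error F (u + of_int k)))\<^sup>2) \<partial>count_space UNIV)
        \<le> ennreal C * ennreal ((cmod (of_real (\<bar>u\<bar> powr \<rho>) * F u))\<^sup>2)"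
    proof (cases "u \<in> torus")
      case True
      have "(cmod (of_real (\<bar>u\<bar> powr \<rho>) * F u))\<^sup>2 = \<bar>u\<bar> powr (2 * \<rho>) * (cmod (F u))\<^sup>2"
        by (simp add: norm_mult power_mult_distrib power2_eq_square[of "_ powr _"] flip: powr_add)
      then show ?thesis
        using inner[OF True] True C by (simp add: ennreal_mult[symmetric] del: atLeastLessThan_iff)
    qed simp
  qed
  also have "\<dots> = ennreal C * ennreal ((L2_norm (\<lambda>\<gamma>. of_real (\<bar>\<gamma>\<bar> powr \<rho>) * F \<gamma>))\<^sup>2)"
    by (subst nn_integral_cmult) (use nn_integral_L2[OF W] in auto)
  also have "\<dots> = ennreal ((sqrt C * L2_norm (\<lambda>\<gamma>. of_real (\<bar>\<gamma>\<bar> powr \<rho>) * F \<gamma>))\<^sup>2)"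
    using C by (simp add: power_mult_distrib ennreal_mult)
  finally have le: "(\<integral>\<^sup>+\<gamma>. ennreal ((cmod (low_error F \<gamma>))\<^sup>2) \<partial>lborel)
      \<le> ennreal ((sqrt C * L2_norm (\<lambda>\<gamma>. of_real (\<bar>\<gamma>\<bar> powr \<rho>) * F \<gamma>))\<^sup>2)" .
  show "low_error F \<in> L2"
    "L2_norm (low_error F) \<le> sqrt (4 * A\<^sup>2 + B) * L2_norm (\<lambda>\<gamma>. of_real (\<bar>\<gamma>\<bar> powr \<rho>) * F \<gamma>)"
    using L2_norm_le_nn_integral[OF le _ m] C by (auto simp: C_def L2_norm_nonneg)
qed

text \<open>The error of a partial sum splits into three: the high frequencies minus their own
  partial sum, at most twice their norm by Bessel; the ideal error \<open>low_error F\<close>; and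
  the remainder of a Fourier series times \<open>\<Phi>\<close>, dominated by its norm
  \<open>e K\<close> on one period.\<close>

lemma fourier_partial_error:
  assumes F: "F \<in> L2" and low: "low_error F \<in> L2"
  obtains e where "(e \<longlongrightarrow> 0) (finite_subsets_at_top UNIV)"
    "\<And>K. finite K \<Longrightarrow> L2_norm (\<lambda>\<gamma>. F \<gamma> - (\<Sum>k\<in>K. L2_inner F (Psi k) * Psi k \<gamma>))
      \<le> 2 * L2_norm (\<lambda>\<gamma>. F \<gamma> - indicator torus \<gamma> * F \<gamma>) + L2_norm (low_error F) + e K"
proof -
  define F1 where "F1 \<gamma> = indicator torus \<gamma> * F \<gamma>" for \<gamma>
  define F2 where "F2 \<gamma> = F \<gamma> - F1 \<gamma>" for \<gamma>
  define s where "s u = F1 u * of_real (\<Phi> u)" for u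
  have F1: "F1 \<in> L2"
    unfolding F1_def by (intro L2_indicator F) auto
  have F2: "F2 \<in> L2"
    unfolding F2_def by (intro L2_diff F F1)
  have s: "s \<in> L2"
    unfolding s_def by (subst mult.commute) (rule L2_bounded_mult[OF F1], auto simp: Phi_nonneg Phi_le_1)
  have s0: "s u = 0" if "u \<notin> torus" for u
    using that by (simp add: s_def F1_def del: atLeastLessThan_iff)
  note [measurable] = L2_measurable[OF s]
  define e where "e K = L2_norm (\<lambda>u. s u - (\<Sum>k\<in>uminus ` K. L2_inner s (torus_wave k) * torus_wave k u))" for K
  \<comment> \<open>\<open>Psi k\<close> carries the frequency \<open>- k\<close>, so partial sums
    over \<open>K\<close> correspond to Fourier sums over \<open>uminus\<close> applied to
    \<open>K\<close>; reflection respects the filter of finite sets.\<close>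
  have flip: "filterlim (\<lambda>K. uminus ` K) (finite_subsets_at_top UNIV) (finite_subsets_at_top (UNIV :: int set))"
    unfolding filterlim_iff
  proof (intro allI impI)
    fix P :: "int set \<Rightarrow> bool" assume "eventually P (finite_subsets_at_top UNIV)"
    then obtain X where X: "finite X" "\<And>Y. finite Y \<Longrightarrow> X \<subseteq> Y \<Longrightarrow> P Y"
      by (auto simp: eventually_finite_subsets_at_top)
    have "P (uminus ` Y)" if "finite Y" "uminus ` X \<subseteq> Y" for Y
    proof (rule X(2))
      show "X \<subseteq> uminus ` Y"
        using image_mono[OF that(2), of uminus] by (simp add: image_image)
    qed (use that in auto)
    then show "eventually (\<lambda>K. P (uminus ` K)) (finite_subsets_at_top UNIV)"
      unfolding eventually_finite_subsets_at_top using X(1) by (intro exI[of _ "uminus ` X"]) auto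
  qed
  have e: "(e \<longlongrightarrow> 0) (finite_subsets_at_top UNIV)"
    unfolding e_def by (rule filterlim_compose[OF fourier_series_tendsto[OF s s0] flip])
  have coeff: "L2_inner F1 (Psi k) = L2_inner s (torus_wave (- k))" for k
    unfolding L2_inner_def
    by (intro Bochner_Integration.integral_cong refl)
      (simp add: s_def F1_def Psi_def torus_wave_def indicator_def mult_ac)
  have le: "L2_norm (\<lambda>\<gamma>. F \<gamma> - (\<Sum>k\<in>K. L2_inner F (Psi k) * Psi k \<gamma>))
      \<le> 2 * L2_norm F2 + L2_norm (low_error F) + e K" if K: "finite K" for K
  proof -
    define Q where "Q G \<gamma> = (\<Sum>k\<in>K. L2_inner G (Psi k) * Psi k \<gamma>)" for G \<gamma>
    have Q: "Q G \<in> L2" for G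
      unfolding Q_def by (intro L2_sum L2_cmult Psi_L2)
    define p where "p \<gamma> = periodic_extension s \<gamma> - (\<Sum>k\<in>K. L2_inner s (torus_wave (- k)) * wave (- of_int k) \<gamma>)" for \<gamma>
    have ind: "indicator torus u * p u = s u - (\<Sum>k\<in>uminus ` K. L2_inner s (torus_wave k) * torus_wave k u)" for u
    proof -
      have "(\<Sum>k\<in>uminus ` K. L2_inner s (torus_wave k) * torus_wave k u)
          = (\<Sum>k\<in>K. L2_inner s (torus_wave (- k)) * torus_wave (- k) u)"
        by (subst sum.reindex) auto
      then show ?thesis
        using s0[of u] by (cases "u \<in> torus")
          (simp_all add: p_def periodic_extension_torus torus_wave_def del: atLeastLessThan_iff)
    qed
    have per: "p (u + of_int k) = p u" for u k
    proof -
      have "\<lfloor>u + of_int k + 1/2\<rfloor> = \<lfloor>u + 1/2\<rfloor> + k"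
        using floor_add_int[of "u + 1/2" k] by (simp add: add_ac)
      then show ?thesis
        by (simp add: p_def wave_int_periodic periodic_extension_def)
    qed
    have pm: "p \<in> borel_measurable borel"
      unfolding p_def by (intro borel_measurable_diff measurable_periodic_extension) measurable
    have pL: "(\<lambda>u. indicator torus u * p u) \<in> L2"
      unfolding ind by (intro L2_diff L2_sum L2_cmult L2_torus_wave s)
    note pP = L2_norm_periodic_mult_le[OF pm per pL]
    have pe: "L2_norm (\<lambda>\<gamma>. p \<gamma> * of_real (\<Phi> \<gamma>)) \<le> e K"
      using pP(2) unfolding ind e_def .
    have split: "F \<gamma> - Q F \<gamma> = (F2 \<gamma> - Q F2 \<gamma>) + (low_error F \<gamma> + p \<gamma> * of_real (\<Phi> \<gamma>))" for \<gamma>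
    proof -
      have "L2_inner F2 (Psi k) = L2_inner F (Psi k) - L2_inner F1 (Psi k)" for k
        unfolding F2_def by (rule L2_inner_diff_left[OF F F1 Psi_L2])
      then have "Q F2 \<gamma> = Q F \<gamma> - Q F1 \<gamma>"
        by (simp add: Q_def left_diff_distrib sum_subtractf)
      moreover have "Q F1 \<gamma> = (\<Sum>k\<in>K. L2_inner s (torus_wave (- k)) * wave (- of_int k) \<gamma>) * of_real (\<Phi> \<gamma>)"
        unfolding Q_def coeff Psi_def sum_distrib_right by (simp add: mult.assoc)
      moreover have "low_error F \<gamma> = F1 \<gamma> - periodic_extension s \<gamma> * of_real (\<Phi> \<gamma>)"
        by (simp add: low_error_def F1_def s_def[abs_def])
      ultimately show ?thesis
        by (simp add: F2_def p_def algebra_simps)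
    qed
    have "L2_norm (\<lambda>\<gamma>. F \<gamma> - Q F \<gamma>)
        \<le> L2_norm (\<lambda>\<gamma>. F2 \<gamma> - Q F2 \<gamma>) + L2_norm (\<lambda>\<gamma>. low_error F \<gamma> + p \<gamma> * of_real (\<Phi> \<gamma>))"
      unfolding split by (intro L2_norm_triangle L2_diff L2_add F2 Q low pP)
    also have "\<dots> \<le> (L2_norm F2 + L2_norm (Q F2)) + (L2_norm (low_error F) + L2_norm (\<lambda>\<gamma>. p \<gamma> * of_real (\<Phi> \<gamma>)))"
      by (intro add_mono L2_norm_triangle L2_norm_diff_triangle F2 Q low pP)
    also have "L2_norm (Q F2) \<le> L2_norm F2"
      unfolding Q_def by (rule bessel_sum_le[OF bessel_Psi F2 K])
    finally show ?thesis
      using pe unfolding Q_def by linarith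
  qed
  show ?thesis
    by (rule that[OF e]) (use le in \<open>simp add: F2_def[abs_def] F1_def[abs_def]\<close>)
qed

text \<open>Plancherel carries over the bound for partial sums. The two terms that depend on
  \<open>K\<close>, namely \<open>e K\<close> and the distance from the partial sum to
  \<open>g\<close>, vanish in the limit.\<close>

lemma approximation_error:
  assumes f: "L2_fourier f F" and W: "(\<lambda>\<gamma>. of_real (\<bar>\<gamma>\<bar> powr \<rho>) * F \<gamma>) \<in> L2"
    and g: "L2_has_sum (\<lambda>k x. L2_inner f (translation k \<phi>) * translation k \<phi> x) g"
  shows "L2_norm (\<lambda>x. f x - g x)
    \<le> (2 * 2 powr \<rho> + sqrt (4 * A\<^sup>2 + B)) * L2_norm (\<lambda>\<gamma>. of_real (\<bar>\<gamma>\<bar> powr \<rho>) * F \<gamma>)"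
proof -
  have fL: "f \<in> L2" "F \<in> L2"
    using f by (auto simp: L2_fourier_def)
  define S where "S K x = (\<Sum>k\<in>K. L2_inner f (translation k \<phi>) * translation k \<phi> x)" for K x
  have S: "S K \<in> L2" for K
    unfolding S_def by (intro L2_sum L2_cmult L2_translation phi_L2)
  have gL: "g \<in> L2" and gS: "((\<lambda>K. L2_norm (\<lambda>x. g x - S K x)) \<longlongrightarrow> 0) (finite_subsets_at_top UNIV)"
    using g by (auto simp: L2_has_sum_def S_def)
  define w where "w = L2_norm (\<lambda>\<gamma>. of_real (\<bar>\<gamma>\<bar> powr \<rho>) * F \<gamma>)"
  obtain e where e: "(e \<longlongrightarrow> 0) (finite_subsets_at_top UNIV)"
    "\<And>K. finite K \<Longrightarrow> L2_norm (\<lambda>\<gamma>. F \<gamma> - (\<Sum>k\<in>K. L2_inner F (Psi k) * Psi k \<gamma>))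
      \<le> 2 * L2_norm (\<lambda>\<gamma>. F \<gamma> - indicator torus \<gamma> * F \<gamma>) + L2_norm (low_error F) + e K"
    using fourier_partial_error[OF fL(2) low_error_le(1)[OF W fL(2)]] by blast
  define C where "C = 2 * (2 powr \<rho> * w) + sqrt (4 * A\<^sup>2 + B) * w"
  have le: "L2_norm (\<lambda>x. f x - g x) \<le> C + e K + L2_norm (\<lambda>x. g x - S K x)" if K: "finite K" for K
  proof -
    have "L2_norm (\<lambda>x. f x - g x) \<le> L2_norm (\<lambda>x. f x - S K x) + L2_norm (\<lambda>x. g x - S K x)"
      using L2_dist_triangle[OF fL(1) S gL] by (simp add: L2_norm_minus_commute[of g])
    also have "L2_norm (\<lambda>x. f x - S K x) = L2_norm (\<lambda>\<gamma>. F \<gamma> - (\<Sum>k\<in>K. L2_inner F (Psi k) * Psi k \<gamma>))"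
      unfolding S_def plancherel_phi[OF f K] L2_inner_phi[OF f] ..
    also have "\<dots> \<le> C + e K"
      using e(2)[OF K] high_frequency_le[OF W fL(2)] low_error_le(2)[OF W fL(2)]
      unfolding C_def w_def by linarith
    finally show ?thesis by simp
  qed
  have "((\<lambda>K. C + e K + L2_norm (\<lambda>x. g x - S K x)) \<longlongrightarrow> C + 0 + 0) (finite_subsets_at_top UNIV)"
    by (intro tendsto_intros e(1) gS)
  then have "L2_norm (\<lambda>x. f x - g x) \<le> C + 0 + 0"
    by (rule tendsto_lowerbound) (auto intro!: eventually_finite_subsets_at_top_weakI le)
  then show ?thesis
    by (simp add: C_def w_def algebra_simps)
qed

lemma dilation_pow_dil: "dilation_pow n f = dil (2 powi n) f"
proof -
  have "sqrt 2 powi n = sqrt (2 powi n)"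
    by (simp add: power_int_def real_sqrt_power real_sqrt_inverse[symmetric] power_inverse)
  then show ?thesis
    by (simp add: dilation_pow_eq dil_def fun_eq_iff)
qed

section \<open>The operators at level n\<close>

text \<open>Dilation preserves norms and commutes with finite sums, so the system at each level is
  again Bessel and its sum exists; the choice in \<open>quasi_projection\<close> then picks a true
  sum.\<close>

lemma quasi_projection_has_sum:
  assumes "f \<in> L2"
  shows "L2_has_sum (projection_term \<phi> n f) (quasi_projection \<phi> n f)"
proof -
  define a :: real where "a = 2 powi n"
  have a: "0 < a" by (simp add: a_def)
  have "bessel (\<lambda>k. dil a (translation k \<phi>))"
    unfolding bessel_def
  proof (intro conjI allI impI)
    fix k show "dil a (translation k \<phi>) \<in> L2"
      by (intro L2_dil L2_translation phi_L2 a)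
  next
    fix K :: "int set" and c assume K: "finite K"
    have "L2_norm (dil a (\<lambda>x. \<Sum>k\<in>K. c k * translation k \<phi> x)) = L2_norm (\<lambda>x. \<Sum>k\<in>K. c k * translation k \<phi> x)"
      by (intro L2_dil L2_sum L2_cmult L2_translation phi_L2 a)
    then show "(L2_norm (\<lambda>x. \<Sum>k\<in>K. c k * dil a (translation k \<phi>) x))\<^sup>2 \<le> (\<Sum>k\<in>K. (cmod (c k))\<^sup>2)"
      using besselD(2)[OF bessel_translates K] by (simp add: dil_sum)
  qed
  from bessel_has_sum[OF this assms] have "\<exists>g. L2_has_sum (projection_term \<phi> n f) g"
    by (simp add: projection_term_def[abs_def] dilation_pow_dil a_def)
  then show ?thesis
    unfolding quasi_projection_def by (rule someI_ex)
qed

text \<open>Dilating by \<open>1 / a\<close> turns level \<open>n\<close> into level 0 for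
  \<open>f' = dil (1 / a) f\<close>, whose transform is \<open>dil a F\<close>. Homogeneity of the
  weight then extracts the factor \<open>a powr (- \<rho>)\<close>.\<close>

lemma scaled_approximation_error:
  assumes f: "L2_fourier f F" and W: "(\<lambda>\<gamma>. of_real (\<bar>\<gamma>\<bar> powr \<rho>) * F \<gamma>) \<in> L2"
  shows "L2_norm (\<lambda>x. f x - quasi_projection \<phi> n f x)
    \<le> (2 * 2 powr \<rho> + sqrt (4 * A\<^sup>2 + B)) * L2_norm (\<lambda>\<gamma>. of_real (\<bar>\<gamma>\<bar> powr \<rho>) * F \<gamma>) * 2 powr (- (of_int n * \<rho>))"
proof -
  have fL: "f \<in> L2"
    using f by (auto simp: L2_fourier_def)
  define a :: real where "a = 2 powi n"
  have a: "0 < a" "0 < 1 / a" by (auto simp: a_def)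
  define g where "g = quasi_projection \<phi> n f"
  define f' where "f' = dil (1 / a) f"
  define g' where "g' = dil (1 / a) g"
  have has_sum: "L2_has_sum (projection_term \<phi> n f) g"
    unfolding g_def by (rule quasi_projection_has_sum[OF fL])
  then have gL: "g \<in> L2"
    by (simp add: L2_has_sum_def)
  have f_eq: "f = dil a f'" and g_eq: "g = dil a g'"
    using a by (auto simp: f'_def g'_def dil_dil)
  have f'L: "f' \<in> L2" and g'L: "g' \<in> L2"
    using a by (auto simp: f'_def g'_def L2_dil fL gL)
  have coeffs: "projection_term \<phi> n f k x = L2_inner f' (translation k \<phi>) * dil a (translation k \<phi>) x" for k x
    unfolding projection_term_def dilation_pow_dil a_def[symmetric]
    by (subst (1) f_eq) (simp add: L2_inner_dil[OF a(1)])
  have sum': "L2_has_sum (\<lambda>k x. L2_inner f' (translation k \<phi>) * translation k \<phi> x) g'"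
    unfolding L2_has_sum_def
  proof (intro conjI allI g'L)
    show "(\<lambda>x. L2_inner f' (translation k \<phi>) * translation k \<phi> x) \<in> L2" for k
      by (intro L2_cmult L2_translation phi_L2)
    have "L2_norm (\<lambda>x. g x - (\<Sum>k\<in>K. projection_term \<phi> n f k x))
        = L2_norm (\<lambda>x. g' x - (\<Sum>k\<in>K. L2_inner f' (translation k \<phi>) * translation k \<phi> x))" for K
    proof -
      have "(\<lambda>x. g x - (\<Sum>k\<in>K. projection_term \<phi> n f k x))
          = dil a (\<lambda>x. g' x - (\<Sum>k\<in>K. L2_inner f' (translation k \<phi>) * translation k \<phi> x))"
        unfolding dil_diff dil_sum coeffs by (subst g_eq) simp
      moreover have "(\<lambda>x. g' x - (\<Sum>k\<in>K. L2_inner f' (translation k \<phi>) * translation k \<phi> x)) \<in> L2"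
        by (intro L2_diff L2_sum L2_cmult L2_translation phi_L2 g'L)
      ultimately show ?thesis
        using a L2_dil(2) by simp
    qed
    then show "((\<lambda>K. L2_norm (\<lambda>x. g' x - (\<Sum>k\<in>K. L2_inner f' (translation k \<phi>) * translation k \<phi> x))) \<longlongrightarrow> 0)
        (finite_subsets_at_top UNIV)"
      using has_sum by (simp add: L2_has_sum_def)
  qed
  define F' where "F' = dil a F"
  have F': "L2_fourier f' F'"
    using L2_fourier_dil[OF f a(2)] by (simp add: f'_def F'_def)
  have weight: "(\<lambda>\<gamma>. of_real (\<bar>\<gamma>\<bar> powr \<rho>) * F' \<gamma>) = (\<lambda>\<gamma>. of_real (a powr (- \<rho>)) * dil a (\<lambda>\<gamma>. of_real (\<bar>\<gamma>\<bar> powr \<rho>) * F \<gamma>) \<gamma>)"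
  proof
    fix \<gamma>
    have "\<bar>a * \<gamma>\<bar> powr \<rho> = a powr \<rho> * \<bar>\<gamma>\<bar> powr \<rho>"
      using a by (simp add: abs_mult powr_mult)
    then have "\<bar>\<gamma>\<bar> powr \<rho> = a powr (- \<rho>) * \<bar>a * \<gamma>\<bar> powr \<rho>"
      using a by (simp add: powr_minus)
    then show "of_real (\<bar>\<gamma>\<bar> powr \<rho>) * F' \<gamma> = of_real (a powr (- \<rho>)) * dil a (\<lambda>\<gamma>. of_real (\<bar>\<gamma>\<bar> powr \<rho>) * F \<gamma>) \<gamma>"
      by (simp only: F'_def dil_def of_real_mult mult_ac)
  qed
  have W': "(\<lambda>\<gamma>. of_real (\<bar>\<gamma>\<bar> powr \<rho>) * F' \<gamma>) \<in> L2"
    unfolding weight by (intro L2_cmult L2_dil W a)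
  have ar: "a powr (- \<rho>) = 2 powr (- (of_int n * \<rho>))"
    by (simp add: a_def powr_real_of_int'[symmetric] powr_powr)
  have "L2_norm (\<lambda>x. f x - g x) = L2_norm (dil a (\<lambda>x. f' x - g' x))"
    unfolding dil_diff by (simp add: f_eq[symmetric] g_eq[symmetric])
  also have "\<dots> = L2_norm (\<lambda>x. f' x - g' x)"
    by (intro L2_dil L2_diff f'L g'L a)
  also have "\<dots> \<le> (2 * 2 powr \<rho> + sqrt (4 * A\<^sup>2 + B)) * L2_norm (\<lambda>\<gamma>. of_real (\<bar>\<gamma>\<bar> powr \<rho>) * F' \<gamma>)"
    by (rule approximation_error[OF F' W' sum'])
  also have "L2_norm (\<lambda>\<gamma>. of_real (\<bar>\<gamma>\<bar> powr \<rho>) * F' \<gamma>)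
      = a powr (- \<rho>) * L2_norm (\<lambda>\<gamma>. of_real (\<bar>\<gamma>\<bar> powr \<rho>) * F \<gamma>)"
    unfolding weight by (subst L2_norm_cmult) (simp add: L2_dil(2)[OF W a(1)])
  finally show ?thesis
    unfolding g_def ar by (simp add: mult_ac)
qed

text \<open>The estimate holds at every level with one constant, so the \<open>O\<close> needs no
  threshold. The Sobolev weight enters through \<open>|\<gamma>| powr (2 * \<rho>) \<le> (1 +
  \<gamma>\<^sup>2) powr \<rho>\<close>.\<close>

lemma approximation_order: "provides_approximation_order (quasi_projection \<phi>) \<rho>"
  unfolding provides_approximation_order_def
proof (intro conjI allI ballI)
  fix n f assume "f \<in> L2"
  then show "quasi_projection \<phi> n f \<in> L2"
    using quasi_projection_has_sum by (auto simp: L2_has_sum_def)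
next
  fix f assume "f \<in> sobolev \<rho>"
  then obtain F where F: "L2_fourier f F" "integrable lborel (\<lambda>\<gamma>. (1 + \<gamma>\<^sup>2) powr \<rho> * (cmod (F \<gamma>))\<^sup>2)"
    by (auto simp: sobolev_def)
  have [measurable]: "F \<in> borel_measurable borel"
    using F(1) by (auto simp: L2_fourier_def intro: L2_measurable)
  have W: "(\<lambda>\<gamma>. of_real (\<bar>\<gamma>\<bar> powr \<rho>) * F \<gamma>) \<in> L2"
  proof (rule L2I)
    show "integrable lborel (\<lambda>\<gamma>. (cmod (of_real (\<bar>\<gamma>\<bar> powr \<rho>) * F \<gamma>))\<^sup>2)"
    proof (rule Bochner_Integration.integrable_bound[OF F(2)])
      show "AE \<gamma> in lborel. norm ((cmod (of_real (\<bar>\<gamma>\<bar> powr \<rho>) * F \<gamma>))\<^sup>2)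
          \<le> norm ((1 + \<gamma>\<^sup>2) powr \<rho> * (cmod (F \<gamma>))\<^sup>2)"
      proof (rule AE_I2)
        fix \<gamma> :: real
        have "(\<bar>\<gamma>\<bar> powr \<rho>)\<^sup>2 = (\<gamma>\<^sup>2) powr \<rho>"
          by (simp add: power2_eq_square abs_mult_self_eq flip: powr_mult)
        also have "\<dots> \<le> (1 + \<gamma>\<^sup>2) powr \<rho>"
          using constants by (intro powr_mono2) auto
        finally show "norm ((cmod (of_real (\<bar>\<gamma>\<bar> powr \<rho>) * F \<gamma>))\<^sup>2)
            \<le> norm ((1 + \<gamma>\<^sup>2) powr \<rho> * (cmod (F \<gamma>))\<^sup>2)"
          by (simp add: norm_mult power_mult_distrib mult_right_mono)
      qed
    qed measurable
  qed measurable
  show "(\<lambda>n. L2_norm (\<lambda>x. f x - quasi_projection \<phi> n f x)) \<in> O(\<lambda>n. 2 powr (- (of_int n * \<rho>)))"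
    by (rule bigoI[OF always_eventually]) (use scaled_approximation_error[OF F(1) W] in \<open>auto simp: L2_norm_nonneg\<close>)
qed

end

section \<open>Application to pseudo-splines\<close>

text \<open>The first conjunct certifies that the representative picked by
  \<open>quasi_projection\<close> is a genuine unconditional L2 sum, so that the second speaks of
  the intended operators.\<close>

theorem proposition5p5:
  fixes \<alpha> :: real and l :: nat and \<phi> :: "real \<Rightarrow> complex"
  assumes "1 \<le> \<alpha>"
    and "int l \<le> \<lfloor>\<alpha> - 1/2\<rfloor>"
    and "pseudo_spline \<alpha> l \<phi>"
  shows "(\<forall>n. \<forall>f\<in>L2. L2_has_sum (projection_term \<phi> n f) (quasi_projection \<phi> n f)) \<and>
         provides_approximation_order (quasi_projection \<phi>) (min (2 * \<alpha>) (2 * (real l + 1)))"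
proof -
  interpret spline_order \<alpha> l
    using assms(1,2) by unfold_locales (simp_all add: le_floor_iff)
  interpret lp: lowpass "refinement_mask \<alpha> l" "real_binomial (\<alpha> + real l) (Suc l) * pi ^ (2 * Suc l)"
    "(\<Sum>k=0..l. real_binomial (\<alpha> + real l) k) * pi powr (2 * \<alpha>)" "2 * (real l + 1)" "2 * \<alpha>"
    by (rule lowpass_refinement_mask)
  define \<rho> where "\<rho> = min (2 * \<alpha>) (2 * (real l + 1))"
  have \<rho>: "0 < \<rho>" "\<rho> \<le> 2 * \<alpha>" "\<rho> \<le> 2 * (real l + 1)"
    using \<alpha> by (auto simp: \<rho>_def)
  \<comment> \<open>On one period \<open>|u| \<le> 1/2\<close>, so lowering an exponent enlarges the
    power; both orders can drop to their minimum \<open>\<rho>\<close>.\<close>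
  have powr_le: "\<bar>u\<bar> powr b \<le> \<bar>u\<bar> powr c" if "u \<in> torus" "c \<le> b" for u b c :: real
    using that powr_mono'[of c b "\<bar>u\<bar>"] by auto
  obtain A where A: "0 \<le> A" "\<And>x. 1 - lp.limit x \<le> A * \<bar>x\<bar> powr (2 * (real l + 1))"
  proof
    show "0 \<le> real_binomial (\<alpha> + real l) (Suc l) * pi ^ (2 * Suc l)
        * (2 powr (- (2 * (real l + 1))) / (1 - 2 powr (- (2 * (real l + 1)))))"
      using lp.pos lp.ratio by (intro mult_nonneg_nonneg[OF lp.pos(3)] divide_nonneg_nonneg) auto
  qed (rule lp.one_minus_limit_le)
  obtain B where B: "0 \<le> B" "\<And>n K x. K \<subseteq> {- int n..int n} - {0} \<Longrightarrow>
      (\<Sum>k\<in>K. (lp.limit (x + real_of_int k))\<^sup>2) \<le> B * \<bar>x\<bar> powr (2 * (2 * \<alpha>))"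
  proof
    show "0 \<le> ((\<Sum>k=0..l. real_binomial (\<alpha> + real l) k) * pi powr (2 * \<alpha>))\<^sup>2 * 2 powr (- 2 * (2 * \<alpha>))
        / (1 - 2 powr (- 2 * (2 * \<alpha>)))"
      using \<alpha> by (intro divide_nonneg_nonneg mult_nonneg_nonneg) (auto simp: powr_le_one_le intro!: less_imp_le[OF powr_less_one])
  qed (rule lp.limit_bracket_tail_le)
  interpret fourier_generator \<phi> lp.limit A B \<rho>
  proof
    show "L2_fourier \<phi> (\<lambda>\<gamma>. of_real (lp.limit \<gamma>))"
      using assms(3) by (simp add: pseudo_spline_def lp.limit_def)
    show "1 - lp.limit u \<le> A * \<bar>u\<bar> powr \<rho>" if "u \<in> torus" for u
      using A(2)[of u] mult_left_mono[OF powr_le[OF that \<rho>(3)] A(1)] by linarith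
    show "(\<Sum>k\<in>K. (lp.limit (u + real_of_int k))\<^sup>2) \<le> B * \<bar>u\<bar> powr (2 * \<rho>)"
      if "u \<in> torus" "finite K" "0 \<notin> K" for u K
    proof -
      \<comment> \<open>\<open>limit_bracket_tail_le\<close> asks for a symmetric window; the sum of
        the absolute values bounds every element of \<open>K\<close>.\<close>
      have "K \<subseteq> {- int n..int n} - {0}" if "n = nat (\<Sum>k\<in>K. \<bar>k\<bar>)" for n
      proof
        fix k assume k: "k \<in> K"
        then have "\<bar>k\<bar> \<le> (\<Sum>k\<in>K. \<bar>k\<bar>)"
          using \<open>finite K\<close> by (intro member_le_sum) auto
        then show "k \<in> {- int n..int n} - {0}"
          using k \<open>0 \<notin> K\<close> that by auto
      qed
      then have "(\<Sum>k\<in>K. (lp.limit (u + real_of_int k))\<^sup>2) \<le> B * \<bar>u\<bar> powr (2 * (2 * \<alpha>))"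
        using B(2) by blast
      also have "\<dots> \<le> B * \<bar>u\<bar> powr (2 * \<rho>)"
        using \<rho>(2) B(1) that(1) by (intro mult_left_mono powr_le) auto
      finally show ?thesis .
    qed
  qed (use \<rho> A B lp.limit_nonneg lp.limit_le_1 lp.limit_bracket_le_1 in auto)
  show ?thesis
    using quasi_projection_has_sum approximation_order unfolding \<rho>_def by blast
qed

end
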